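(* Let $U = n^{1+\alpha}$ for a constant $\alpha>0$ and word size $w = \log U$. For sufficiently large $n$ and any positive integer $k \le \log^* n$, if a dynamic dictionary (maintaining at most $n$ keys from $[U]$) incurs $r \le \log^{(k)} n$ wasted bits per key, then it must perform $\Omega(nk)$ cell-probes in expectation to process a random operation sequence sampled from the hard distribution below; i.e., the expected amortized time per operation is $\Omega(k)$.
   Context: A dynamic dictionary maintains a set of at most $n$ distinct keys from $[U]$ under insertions, deletions and membership queries, in the cell-probe model: memory consists of cells of $w$ bits, each read/write of a cell costs one unit, computation is free. The memory has $\log\binom{U}{n}+R$ bits; $r=R/n$ is the number of wasted bits per key. Hard distribution: initialize an empty dictionary with capacity $n$ over $[U]$; pick $K$, a uniformly random $n$-element subset of $[U]$, and insert its keys one by one; then for $i=1,\dots,n$ perform a meta-operation: let $d_i$ be a uniformly random key of $K$ not yet removed, query $d_i$, delete $d_i$, let $a_i$ be a uniformly random key of $[U]$ that is neither in $K$ nor in the current dictionary, and insert $a_i$. $\log^{(k)}$ is the $k$-fold iterated logarithm. *)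

theory Defs
  imports "HOL-Probability.Probability"
begin

text \<open>An operation of a (deterministic) cell-probe data structure is an adaptive
decision tree: it reads a cell (and branches on the word read), writes a word to a
cell, or returns an answer.  Memory is a map from cell addresses to words.\<close>

datatype 'r cp = Ret 'r | Rd nat "nat \<Rightarrow> 'r cp" | Wr nat nat "'r cp"

type_synonym mem = "nat \<Rightarrow> nat"

primrec run :: "'r cp \<Rightarrow> mem \<Rightarrow> 'r \<times> mem \<times> nat" where
  "run (Ret r) m = (r, m, 0)"
| "run (Rd a f) m = (case run (f (m a)) m of (r, m', c) \<Rightarrow> (r, m', Suc c))"
| "run (Wr a v t) m = (case run t (m(a := v)) of (r, m', c) \<Rightarrow> (r, m', Suc c))"

primrec cp_ok :: "nat \<Rightarrow> nat \<Rightarrow> 'r cp \<Rightarrow> bool" where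
  "cp_ok S W (Ret r) = True"
| "cp_ok S W (Rd a f) = (a < S \<and> (\<forall>v<W. cp_ok S W (f v)))"
| "cp_ok S W (Wr a v t) = (a < S \<and> v < W \<and> cp_ok S W t)"

record dict =
  init_mem :: mem
  ins_op :: "nat \<Rightarrow> unit cp"
  del_op :: "nat \<Rightarrow> unit cp"
  qry_op :: "nat \<Rightarrow> bool cp"

datatype op = Ins nat | Del nat | Qry nat

fun exec :: "dict \<Rightarrow> op list \<Rightarrow> mem \<Rightarrow> bool option list \<times> mem \<times> nat" where
  "exec D [] m = ([], m, 0)"
| "exec D (Ins x # os) m = (case run (ins_op D x) m of (_, m1, c1) \<Rightarrow>
      (case exec D os m1 of (as, m2, c2) \<Rightarrow> (None # as, m2, c1 + c2)))"
| "exec D (Del x # os) m = (case run (del_op D x) m of (_, m1, c1) \<Rightarrow>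
      (case exec D os m1 of (as, m2, c2) \<Rightarrow> (None # as, m2, c1 + c2)))"
| "exec D (Qry x # os) m = (case run (qry_op D x) m of (b, m1, c1) \<Rightarrow>
      (case exec D os m1 of (as, m2, c2) \<Rightarrow> (Some b # as, m2, c1 + c2)))"

definition cost :: "dict \<Rightarrow> op list \<Rightarrow> nat" where
  "cost D os = snd (snd (exec D os (init_mem D)))"

fun valid_ops :: "nat \<Rightarrow> nat \<Rightarrow> nat set \<Rightarrow> op list \<Rightarrow> bool" where
  "valid_ops n U S [] = True"
| "valid_ops n U S (Ins x # os) = (x < U \<and> x \<notin> S \<and> card S < n \<and> valid_ops n U (insert x S) os)"
| "valid_ops n U S (Del x # os) = (x \<in> S \<and> valid_ops n U (S - {x}) os)"
| "valid_ops n U S (Qry x # os) = (x < U \<and> valid_ops n U S os)"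

fun correct_answers :: "nat set \<Rightarrow> op list \<Rightarrow> bool option list" where
  "correct_answers S [] = []"
| "correct_answers S (Ins x # os) = None # correct_answers (insert x S) os"
| "correct_answers S (Del x # os) = None # correct_answers (S - {x}) os"
| "correct_answers S (Qry x # os) = Some (x \<in> S) # correct_answers S os"

definition dictionary :: "nat \<Rightarrow> nat \<Rightarrow> nat \<Rightarrow> nat \<Rightarrow> dict \<Rightarrow> bool" where
  "dictionary n U w S D \<longleftrightarrow>
     (\<forall>a<S. init_mem D a < 2 ^ w) \<and>
     (\<forall>x. cp_ok S (2 ^ w) (ins_op D x) \<and> cp_ok S (2 ^ w) (del_op D x)
          \<and> cp_ok S (2 ^ w) (qry_op D x)) \<and>
     (\<forall>os. valid_ops n U {} os \<longrightarrow> fst (exec D os (init_mem D)) = correct_answers {} os)"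

text \<open>i meta-operations; K is the initial key set, rem the keys of K not yet removed,
cur the current content of the dictionary.\<close>
fun meta_ops :: "nat \<Rightarrow> nat set \<Rightarrow> nat set \<Rightarrow> nat set \<Rightarrow> nat \<Rightarrow> op list pmf" where
  "meta_ops U K rem cur 0 = return_pmf []"
| "meta_ops U K rem cur (Suc i) =
     pmf_of_set rem \<bind> (\<lambda>d.
     pmf_of_set ({..<U} - K - (cur - {d})) \<bind> (\<lambda>a.
     meta_ops U K (rem - {d}) (insert a (cur - {d})) i \<bind> (\<lambda>rest.
     return_pmf (Qry d # Del d # Ins a # rest))))"

definition hard_dist :: "nat \<Rightarrow> nat \<Rightarrow> op list pmf" where
  "hard_dist n U =
     pmf_of_set {K. K \<subseteq> {..<U} \<and> card K = n} \<bind> (\<lambda>K.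
     meta_ops U K K K n \<bind> (\<lambda>rest.
     return_pmf (map Ins (sorted_list_of_set K) @ rest)))"

definition iter_log :: "nat \<Rightarrow> real \<Rightarrow> real" where
  "iter_log k x = ((\<lambda>y. log 2 y) ^^ k) x"

definition log_star :: "real \<Rightarrow> nat" where
  "log_star x = (LEAST k. iter_log k x \<le> 1)"

end

theory Submission
  imports Defs "HOL-Combinatorics.Transposition" "HOL-Real_Asymp.Real_Asymp"
begin

text \<open>
The first meta-operations are cut recursively into nodes: a node of \<open>L\<close> meta-operations has
\<open>B\<close> children of \<open>l = L / B\<close> meta-operations each, with \<open>log B\<close> a large multiple of \<open>n r / L\<close>, the
number of wasted bits per meta-operation of the node.  A probe is charged to the node at which the
current and the next access to the cell lie in different children, so every probe is charged at
most once.  Since \<open>n / L\<close> grows from level to level only as an iterated exponential of \<open>r\<close>, there are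
\<open>\<Omega>(k)\<close> levels, and it suffices that the probes charged to a node number \<open>\<Omega>(L)\<close> on average.

Suppose not.  Then for most children almost all cells touched by the child keep their contents until
the end of the node.  Fix a child, its start state and its deleted keys, and call two choices
of its inserted keys close if the two resulting memories agree on almost all cells touched by both
runs.  (i) If only a fraction \<open>U^(- \<epsilon> l)\<close> of all choices is close to the actual one, then the memory at
the end of the node reveals \<open>\<Omega>(l log B)\<close> bits on which of the keys inserted in the node belong to the
child: the candidates that are consistent with the final memory are pairwise close.  Over all
children this exceeds the redundancy of the memory.  (ii) Otherwise the memory after the child can be
compressed: on the cells touched by both the actual run and the run of a close choice, store the
contents before the child instead.  These contents certify the deleted keys, which then cost only
\<open>log n\<close> bits each, and rerunning the child with the close choice restores the final contents.  Hence
\<open>l log (U / n)\<close> bits are saved, which is again impossible.  Both parts are counting arguments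
over the injective sequences \<open>x\<close> of \<open>2 n\<close> keys, which the hard distribution samples uniformly.
\<close>

subsection \<open>Cells touched by an execution\<close>

text \<open>The final memory does not reveal which cells a child touched. Closeness therefore
  compares two memories only on cells touched by both runs, and this is just enough for both cases.
  If the final memory of the node contradicts each of two candidates in at most \<open>d\<close> of
  its own touched cells, the candidates disagree on at most \<open>2 * d\<close> common cells. A
  cell touched by the actual run alone is ignored by the rerun, so the compressed memory can hold
  its final contents. A choice for child \<open>i\<close> draws only on keys inserted from child
  \<open>i\<close> on, so only the first half of the children is used, where at least
  \<open>B / 2\<close> rows remain. The threshold is \<open>d = l / 2^g\<close> with
  \<open>g\<close> depending on \<alpha> alone: a patch of \<open>2 * d\<close> cells costs as many
  words of \<Theta>(log n) bits, which must stay below the \<Omega>(l log n) bits saved in (ii).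
  Boundedly many logarithms are lost to constants, so the levels say nothing for small
  \<open>k\<close>. There the initial insertions suffice: writing too few cells cannot produce
  \<open>U choose n\<close> different sets.\<close>

primrec touched :: "'r cp \<Rightarrow> mem \<Rightarrow> nat set" where
  "touched (Ret r) m = {}"
| "touched (Rd a f) m = insert a (touched (f (m a)) m)"
| "touched (Wr a v t) m = insert a (touched t (m(a := v)))"

definition agree :: "nat set \<Rightarrow> mem \<Rightarrow> mem \<Rightarrow> bool" where
  "agree Q m m' \<longleftrightarrow> (\<forall>e\<in>Q. m e = m' e)"

text \<open>A decision tree follows the same path as long as the cells that it reads agree.
  \<open>Q\<close> may be larger than the touched set and stays fixed during the induction, so that
  agreement can be carried through a whole sequence of operations.\<close>

lemma run_local:
  assumes "touched t m \<subseteq> Q" "agree Q m m'"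
  shows "touched t m' = touched t m \<and> fst (run t m') = fst (run t m)
    \<and> agree Q (fst (snd (run t m))) (fst (snd (run t m')))"
  using assms
proof (induction t arbitrary: m m')
  case (Ret r)
  then show ?case by simp
next
  case (Rd a f)
  then have "m a = m' a" by (auto simp: agree_def)
  with Rd.IH[of "f (m a)" m m'] Rd.prems show ?case
    by (auto simp: case_prod_beta)
next
  case (Wr a v t)
  have 1: "agree Q (m(a := v)) (m'(a := v))" using Wr.prems by (auto simp: agree_def)
  have 2: "touched t (m(a := v)) \<subseteq> Q" using Wr.prems by simp
  note IH = Wr.IH[OF 2 1]
  show ?case
    unfolding touched.simps run.simps case_prod_beta fst_conv snd_conv
    using IH by presburger
qed

lemma run_untouched: "e \<notin> touched t m \<Longrightarrow> fst (snd (run t m)) e = m e"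
  by (induction t arbitrary: m) (auto simp: case_prod_beta)

lemma finite_touched: "finite (touched t m)"
  by (induction t arbitrary: m) auto

lemma card_touched_le: "card (touched t m) \<le> snd (snd (run t m))"
proof (induction t arbitrary: m)
  case (Rd a f)
  have "card (touched (Rd a f) m) \<le> Suc (card (touched (f (m a)) m))"
    by (simp add: card_insert_le_m1 finite_touched card_insert_if)
  also have "\<dots> \<le> Suc (snd (snd (run (f (m a)) m)))" using Rd by auto
  finally show ?case by (simp add: case_prod_beta)
next
  case (Wr a v t)
  have "card (touched (Wr a v t) m) \<le> Suc (card (touched t (m(a := v))))"
    by (simp add: finite_touched card_insert_if)
  also have "\<dots> \<le> Suc (snd (snd (run t (m(a := v)))))" using Wr by auto
  finally show ?case by (simp add: case_prod_beta)
qed simp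

text \<open>Memories are total functions, but only the cells below \<open>S\<close> are stored.
  Pinning the others to \<open>m0\<close> makes the number of possible memories exactly
  \<open>W ^ S\<close>, the count used by the encodings.\<close>

definition mem_ok :: "nat \<Rightarrow> nat \<Rightarrow> mem \<Rightarrow> mem \<Rightarrow> bool" where
  "mem_ok S W m0 m \<longleftrightarrow> (\<forall>a<S. m a < W) \<and> (\<forall>a\<ge>S. m a = m0 a)"

lemma run_ok:
  assumes "cp_ok S W t" "mem_ok S W m0 m"
  shows "touched t m \<subseteq> {..<S} \<and> mem_ok S W m0 (fst (snd (run t m)))"
  using assms
proof (induction t arbitrary: m)
  case (Rd a f)
  then have "m a < W" by (auto simp: mem_ok_def)
  with Rd show ?case by (auto simp: case_prod_beta)
next
  case (Wr a v t)
  then have "mem_ok S W m0 (m(a := v))" by (auto simp: mem_ok_def)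
  moreover have "cp_ok S W t" "a < S" using Wr.prems by simp_all
  ultimately show ?case using Wr.IH[of "m(a := v)"]
    unfolding touched.simps run.simps case_prod_beta fst_conv snd_conv by blast
qed simp

fun op_touched :: "dict \<Rightarrow> op \<Rightarrow> mem \<Rightarrow> nat set" where
  "op_touched D (Ins x) m = touched (ins_op D x) m"
| "op_touched D (Del x) m = touched (del_op D x) m"
| "op_touched D (Qry x) m = touched (qry_op D x) m"

fun op_mem :: "dict \<Rightarrow> op \<Rightarrow> mem \<Rightarrow> mem" where
  "op_mem D (Ins x) m = fst (snd (run (ins_op D x) m))"
| "op_mem D (Del x) m = fst (snd (run (del_op D x) m))"
| "op_mem D (Qry x) m = fst (snd (run (qry_op D x) m))"

fun op_cost :: "dict \<Rightarrow> op \<Rightarrow> mem \<Rightarrow> nat" where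
  "op_cost D (Ins x) m = snd (snd (run (ins_op D x) m))"
| "op_cost D (Del x) m = snd (snd (run (del_op D x) m))"
| "op_cost D (Qry x) m = snd (snd (run (qry_op D x) m))"

primrec ops_touched :: "dict \<Rightarrow> op list \<Rightarrow> mem \<Rightarrow> nat set" where
  "ops_touched D [] m = {}"
| "ops_touched D (o1 # os) m = op_touched D o1 m \<union> ops_touched D os (op_mem D o1 m)"

definition ops_mem :: "dict \<Rightarrow> op list \<Rightarrow> mem \<Rightarrow> mem" where
  "ops_mem D os m = fst (snd (exec D os m))"

definition ops_cost :: "dict \<Rightarrow> op list \<Rightarrow> mem \<Rightarrow> nat" where
  "ops_cost D os m = snd (snd (exec D os m))"

lemma ops_mem_simps [simp]:
  "ops_mem D [] m = m"
  "ops_mem D (o1 # os) m = ops_mem D os (op_mem D o1 m)"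
  by (cases o1; simp add: ops_mem_def case_prod_beta)+

lemma ops_cost_simps [simp]:
  "ops_cost D [] m = 0"
  "ops_cost D (o1 # os) m = op_cost D o1 m + ops_cost D os (op_mem D o1 m)"
  by (cases o1; simp add: ops_cost_def case_prod_beta)+

lemma ops_mem_append: "ops_mem D (xs @ ys) m = ops_mem D ys (ops_mem D xs m)"
  by (induction xs arbitrary: m) auto

lemma ops_cost_append: "ops_cost D (xs @ ys) m = ops_cost D xs m + ops_cost D ys (ops_mem D xs m)"
  by (induction xs arbitrary: m) auto

lemma ops_touched_append:
  "ops_touched D (xs @ ys) m = ops_touched D xs m \<union> ops_touched D ys (ops_mem D xs m)"
  by (induction xs arbitrary: m) auto

lemma op_local:
  assumes "op_touched D p m \<subseteq> Q" "agree Q m m'"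
  shows "op_touched D p m' = op_touched D p m \<and> agree Q (op_mem D p m) (op_mem D p m')"
  using assms run_local[of "ins_op D _" m Q m'] run_local[of "del_op D _" m Q m']
    run_local[of "qry_op D _" m Q m'] by (cases p) auto

lemma ops_local:
  assumes "ops_touched D os m \<subseteq> Q" "agree Q m m'"
  shows "ops_touched D os m' = ops_touched D os m \<and> agree Q (ops_mem D os m) (ops_mem D os m')"
  using assms
proof (induction os arbitrary: m m')
  case (Cons p os)
  with op_local[of D p m Q m'] Cons.IH[of "op_mem D p m" "op_mem D p m'"] show ?case by auto
qed simp

lemma op_untouched: "e \<notin> op_touched D p m \<Longrightarrow> op_mem D p m e = m e"
  by (cases p) (auto simp: run_untouched)

lemma ops_untouched: "e \<notin> ops_touched D os m \<Longrightarrow> ops_mem D os m e = m e"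
  by (induction os arbitrary: m) (auto simp: op_untouched)

lemma card_ops_touched_le: "card (ops_touched D os m) \<le> ops_cost D os m"
proof (induction os arbitrary: m)
  case (Cons p os)
  have "card (op_touched D p m) \<le> op_cost D p m" by (cases p) (auto simp: card_touched_le)
  then show ?case using Cons[of "op_mem D p m"] card_Un_le[of "op_touched D p m" "ops_touched D os (op_mem D p m)"]
    by simp
qed simp

lemma fst_exec_append:
  "fst (exec D (xs @ ys) m) = fst (exec D xs m) @ fst (exec D ys (ops_mem D xs m))"
proof (induction xs arbitrary: m)
  case (Cons p xs)
  then show ?case by (cases p) (simp_all add: case_prod_beta)
qed simp

fun op_set :: "nat set \<Rightarrow> op \<Rightarrow> nat set" where
  "op_set S (Ins x) = insert x S"
| "op_set S (Del x) = S - {x}"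
| "op_set S (Qry x) = S"

lemma correct_answers_append:
  "correct_answers S (xs @ ys) = correct_answers S xs @ correct_answers (foldl op_set S xs) ys"
proof (induction xs arbitrary: S)
  case (Cons p xs)
  then show ?case by (cases p) auto
qed simp

lemma valid_ops_append:
  "valid_ops n U S (xs @ ys) \<longleftrightarrow> valid_ops n U S xs \<and> valid_ops n U (foldl op_set S xs) ys"
proof (induction xs arbitrary: S)
  case (Cons p xs)
  then show ?case by (cases p) auto
qed simp

lemma length_correct_answers: "length (correct_answers S xs) = length xs"
proof (induction xs arbitrary: S)
  case (Cons p xs)
  then show ?case by (cases p) auto
qed simp

lemma length_exec: "length (fst (exec D xs m)) = length xs"
proof (induction xs arbitrary: m)
  case (Cons p xs)
  then show ?case by (cases p) (simp_all add: case_prod_beta)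
qed simp

lemma op_ok:
  assumes "dictionary n U w S D" "mem_ok S (2 ^ w) m0 m"
  shows "op_touched D p m \<subseteq> {..<S} \<and> mem_ok S (2 ^ w) m0 (op_mem D p m)"
proof -
  have "cp_ok S (2 ^ w) (ins_op D x) \<and> cp_ok S (2 ^ w) (del_op D x) \<and> cp_ok S (2 ^ w) (qry_op D x)" for x
    using assms(1) by (auto simp: dictionary_def)
  then show ?thesis
    using run_ok[OF _ assms(2), of "ins_op D _"] run_ok[OF _ assms(2), of "del_op D _"]
      run_ok[OF _ assms(2), of "qry_op D _"] by (cases p) (simp_all)
qed

lemma ops_ok:
  assumes "dictionary n U w S D" "mem_ok S (2 ^ w) m0 m"
  shows "ops_touched D os m \<subseteq> {..<S} \<and> mem_ok S (2 ^ w) m0 (ops_mem D os m)"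
  using assms(2)
proof (induction os arbitrary: m)
  case (Cons p os)
  with op_ok[OF assms(1), of m0 m p] Cons.IH[of "op_mem D p m"] show ?case by auto
qed simp

lemma card_mem_ok: "finite {m. mem_ok S W m0 m} \<and> card {m. mem_ok S W m0 m} = W ^ S"
proof -
  have "bij_betw (\<lambda>m. restrict m {..<S}) {m. mem_ok S W m0 m} ({..<S} \<rightarrow>\<^sub>E {..<W})"
    by (rule bij_betwI[where g = "\<lambda>f a. if a < S then f a else m0 a"])
      (auto simp: mem_ok_def fun_eq_iff PiE_def Pi_def extensional_def)
  then have "finite {m. mem_ok S W m0 m} = finite ({..<S} \<rightarrow>\<^sub>E {..<W})"
    "card {m. mem_ok S W m0 m} = card ({..<S} \<rightarrow>\<^sub>E {..<W})"
    by (simp_all add: bij_betw_finite bij_betw_same_card)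
  then show ?thesis by (simp add: card_funcsetE finite_PiE)
qed

subsection \<open>Runs on the hard distribution\<close>

lemma foldl_op_set_Ins: "foldl op_set S (map Ins xs) = S \<union> set xs"
  by (induction xs arbitrary: S) auto

lemma valid_ops_Ins:
  assumes "distinct xs" "set xs \<inter> S = {}" "finite S" "card S + length xs \<le> n" "set xs \<subseteq> {..<U}"
  shows "valid_ops n U S (map Ins xs)"
  using assms
proof (induction xs arbitrary: S)
  case (Cons x xs)
  have "valid_ops n U (insert x S) (map Ins xs)"
    using Cons.prems by (intro Cons.IH) auto
  then show ?case using Cons.prems by simp
qed simp

locale dyn_dict =
  fixes D :: dict and n U w S :: nat
  assumes dict: "dictionary n U w S D"
begin

text \<open>A sample of the hard distribution is encoded by one function \<open>x\<close>: meta-operation \<open>p < n\<close>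
deletes \<open>d\<^sub>p = x p\<close> and inserts \<open>a\<^sub>p = x (n + p)\<close>, so that \<open>K = x ` {..<n}\<close>.\<close>

definition mops :: "(nat \<Rightarrow> nat) \<Rightarrow> nat \<Rightarrow> nat \<Rightarrow> op list" where
  "mops x p q = concat (map (\<lambda>r. [Qry (x r), Del (x r), Ins (x (n + r))]) [p..<q])"

definition init_ops :: "(nat \<Rightarrow> nat) \<Rightarrow> op list" where
  "init_ops x = map Ins (sorted_list_of_set (x ` {..<n}))"

definition Mem :: "(nat \<Rightarrow> nat) \<Rightarrow> nat \<Rightarrow> mem" where
  "Mem x p = ops_mem D (init_ops x @ mops x 0 p) (init_mem D)"

definition Tch :: "(nat \<Rightarrow> nat) \<Rightarrow> nat \<Rightarrow> nat \<Rightarrow> nat set" where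
  "Tch x p q = ops_touched D (mops x p q) (Mem x p)"

definition cur :: "(nat \<Rightarrow> nat) \<Rightarrow> nat \<Rightarrow> nat set" where
  "cur x p = x ` {p..<n} \<union> x ` {n..<n + p}"

text \<open>Only the keys used up to time \<open>p\<close> are constrained. A choice of other keys
  for a child may repeat keys that come later in \<open>x\<close>, so the run that it gives rise to
  is legal only up to the end of the child.\<close>

definition valid :: "(nat \<Rightarrow> nat) \<Rightarrow> nat \<Rightarrow> bool" where
  "valid x p \<longleftrightarrow> inj_on x {..<n + p} \<and> x ` {..<n + p} \<subseteq> {..<U}"

text \<open>The content is read off a memory by asking all queries, so a memory encodes the current
  set.\<close>

definition dec :: "mem \<Rightarrow> nat set" where
  "dec m = {v. v < U \<and> fst (run (qry_op D v) m)}"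

lemma mops_append: "p \<le> q \<Longrightarrow> q \<le> r \<Longrightarrow> mops x p r = mops x p q @ mops x q r"
  unfolding mops_def using upt_add_eq_append[of p q "r - q"] by simp

lemma mops_Suc: "p \<le> q \<Longrightarrow> mops x p (Suc q) = mops x p q @ [Qry (x q), Del (x q), Ins (x (n + q))]"
  by (simp add: mops_def)

lemma mops_same [simp]: "mops x p p = []"
  by (simp add: mops_def)

lemma mops_cong:
  "(\<And>r. p \<le> r \<Longrightarrow> r < q \<Longrightarrow> x r = y r \<and> x (n + r) = y (n + r)) \<Longrightarrow> mops x p q = mops y p q"
  unfolding mops_def by (intro arg_cong[where f = concat] map_cong) auto

lemma Mem_step: "p \<le> q \<Longrightarrow> Mem x q = ops_mem D (mops x p q) (Mem x p)"
  using mops_append[of 0 p q x] by (simp add: Mem_def ops_mem_append)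

lemma Tch_append: "p \<le> q \<Longrightarrow> q \<le> r \<Longrightarrow> Tch x p r = Tch x p q \<union> Tch x q r"
  by (simp add: Tch_def mops_append[of p q r] ops_touched_append Mem_step[of p q])

lemma Tch_UN: "p \<le> q \<Longrightarrow> Tch x p q = (\<Union>r\<in>{p..<q}. Tch x r (Suc r))"
proof (induction q rule: dec_induct)
  case base
  then show ?case by (simp add: Tch_def)
next
  case (step m)
  then show ?case using Tch_append[of p m "Suc m" x] by (auto simp: atLeastLessThanSuc)
qed

lemma Mem_untouched: "p \<le> q \<Longrightarrow> e \<notin> Tch x p q \<Longrightarrow> Mem x q e = Mem x p e"
  by (simp add: Mem_step Tch_def ops_untouched)

lemma Mem_cong:
  assumes "\<And>i. i < n + p \<Longrightarrow> x i = y i" "p \<le> n"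
  shows "Mem x p = Mem y p"
proof -
  have "mops x 0 p = mops y 0 p" using assms by (intro mops_cong) auto
  moreover have "x ` {..<n} = y ` {..<n}" using assms by (intro image_cong) auto
  ultimately show ?thesis by (simp add: Mem_def init_ops_def)
qed

lemma Tch_cong:
  assumes "\<And>i. i < n + q \<Longrightarrow> x i = y i" "q \<le> n" "p \<le> q"
  shows "Tch x p q = Tch y p q"
proof -
  have "mops x p q = mops y p q" using assms by (intro mops_cong) auto
  moreover have "Mem x p = Mem y p" using assms by (intro Mem_cong) auto
  ultimately show ?thesis by (simp add: Tch_def)
qed

lemma Mem_ok: "mem_ok S (2 ^ w) (init_mem D) (Mem x p)"
proof -
  have "mem_ok S (2 ^ w) (init_mem D) (init_mem D)"
    using dict by (auto simp: dictionary_def mem_ok_def)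
  from ops_ok[OF dict this, THEN conjunct2] show ?thesis unfolding Mem_def .
qed

lemma Tch_subset: "Tch x p q \<subseteq> {..<S}"
  unfolding Tch_def by (rule ops_ok[OF dict Mem_ok, THEN conjunct1])

lemma finite_Tch [simp]: "finite (Tch x p q)"
  by (rule finite_subset[OF Tch_subset]) simp

lemma valid_mono: assumes "valid x q" "p \<le> q" shows "valid x p"
proof -
  have "{..<n + p} \<subseteq> {..<n + q}" using assms(2) by auto
  then show ?thesis using assms(1) unfolding valid_def by (meson image_mono inj_on_subset order_trans)
qed

lemma cur_Suc:
  assumes "valid x (Suc p)" "Suc p \<le> n"
  shows "cur x (Suc p) = insert (x (n + p)) (cur x p - {x p})" "x p \<in> cur x p" "x (n + p) \<notin> cur x p"
proof -
  have inj: "inj_on x {..<n + Suc p}" using assms(1) by (simp add: valid_def)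
  have ne: "x i \<noteq> x j" if "i < n + Suc p" "j < n + Suc p" "i \<noteq> j" for i j
    using inj that by (auto simp: inj_on_def)
  have 1: "{p..<n} = insert p {Suc p..<n}" "{n..<n + Suc p} = insert (n + p) {n..<n + p}"
    using assms(2) by auto
  have "{Suc p..<n} \<union> {n..<n + p} \<subseteq> {..<n + Suc p}" by auto
  then have 2: "x p \<notin> x ` ({Suc p..<n} \<union> {n..<n + p})"
    using inj_on_image_mem_iff[OF inj, of p "{Suc p..<n} \<union> {n..<n + p}"] assms(2) by auto
  show "cur x (Suc p) = insert (x (n + p)) (cur x p - {x p})"
    unfolding cur_def 1 using 2 ne[of p "n + p"] assms(2) by auto
  show "x p \<in> cur x p" using assms(2) by (auto simp: cur_def)
  have "{p..<n} \<union> {n..<n + p} \<subseteq> {..<n + Suc p}" by auto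
  then show "x (n + p) \<notin> cur x p"
    using inj_on_image_mem_iff[OF inj, of "n + p" "{p..<n} \<union> {n..<n + p}"] assms(2)
    by (auto simp: cur_def)
qed

lemma card_cur:
  assumes "valid x p" "p \<le> n"
  shows "card (cur x p) = n" "cur x p \<subseteq> {..<U}" "finite (cur x p)"
proof -
  have eq: "cur x p = x ` ({p..<n} \<union> {n..<n + p})" by (simp add: cur_def image_Un)
  have sub: "{p..<n} \<union> {n..<n + p} \<subseteq> {..<n + p}" by auto
  have "inj_on x ({p..<n} \<union> {n..<n + p})"
    using assms(1) sub unfolding valid_def by (meson inj_on_subset)
  moreover have "card ({p..<n} \<union> {n..<n + p}) = n"
    using assms(2) by (subst card_Un_disjoint) auto
  ultimately show "card (cur x p) = n" by (simp add: eq card_image)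
  show "cur x p \<subseteq> {..<U}" unfolding eq using assms(1) image_mono[OF sub, of x] unfolding valid_def by blast
  then show "finite (cur x p)" by (rule finite_subset) simp
qed

lemma valid_run:
  assumes "valid x p" "p \<le> n"
  shows "valid_ops n U {} (init_ops x @ mops x 0 p) \<and> foldl op_set {} (init_ops x @ mops x 0 p) = cur x p"
  using assms
proof (induction p)
  case 0
  have "card (x ` {..<n}) = n" using 0 by (simp add: valid_def card_image)
  moreover have "x ` {..<n} \<subseteq> {..<U}" using 0 by (simp add: valid_def)
  ultimately show ?case using 0
    by (simp add: init_ops_def foldl_op_set_Ins valid_ops_Ins cur_def lessThan_atLeast0)
next
  case (Suc p)
  have v: "valid x p" "p \<le> n" using valid_mono[OF Suc.prems(1), of p] Suc.prems(2) by simp_all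
  have IH: "valid_ops n U {} (init_ops x @ mops x 0 p)" "foldl op_set {} (init_ops x @ mops x 0 p) = cur x p"
    using Suc.IH[OF v] by blast+
  have *: "init_ops x @ mops x 0 (Suc p) = (init_ops x @ mops x 0 p) @ [Qry (x p), Del (x p), Ins (x (n + p))]"
    by (simp add: mops_Suc)
  have c: "card (cur x p) = n" "finite (cur x p)" "cur x p \<subseteq> {..<U}"
    using card_cur[OF v] by blast+
  have d: "card (cur x p - {x p}) < n" using c cur_Suc(2)[OF Suc.prems] Suc.prems(2) by (simp add: card_Diff_singleton)
  have e: "x (n + p) < U" using Suc.prems(1) by (auto simp: valid_def)
  show ?case unfolding * valid_ops_append foldl_append
    using IH c d e cur_Suc[OF Suc.prems] by (auto simp: valid_ops_append)
qed

text \<open>Correctness is assumed for operation sequences from the initial memory only. So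
  \<open>Qry v\<close> is appended to the legal run up to time \<open>p\<close>; its answer is a
  function of \<open>Mem x p\<close>.\<close>

lemma dec_Mem:
  assumes "valid x p" "p \<le> n"
  shows "dec (Mem x p) = cur x p"
proof -
  have "fst (run (qry_op D v) (Mem x p)) \<longleftrightarrow> v \<in> cur x p" if "v < U" for v
  proof -
    let ?os = "init_ops x @ mops x 0 p"
    have "valid_ops n U {} (?os @ [Qry v])"
      using valid_run[OF assms] that by (simp only: valid_ops_append) simp
    then have "fst (exec D (?os @ [Qry v]) (init_mem D)) = correct_answers {} (?os @ [Qry v])"
      using dict by (simp add: dictionary_def)
    then have "fst (exec D [Qry v] (Mem x p)) = correct_answers (foldl op_set {} ?os) [Qry v]"
      unfolding fst_exec_append[of D ?os] correct_answers_append[of _ ?os] Mem_def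
      by (simp add: length_exec length_correct_answers)
    then show ?thesis using valid_run[OF assms] by (simp add: case_prod_beta)
  qed
  then show ?thesis using card_cur[OF assms] by (auto simp: dec_def)
qed

text \<open>A cell counts once for each meta-operation that touches it; \<open>gaps\<close> charges
  exactly such pairs of a time and a cell.\<close>

lemma cost_ge:
  "(\<Sum>p<q. card (Tch x p (Suc p))) \<le> ops_cost D (mops x 0 q) (Mem x 0)"
proof (induction q)
  case (Suc q)
  have "ops_cost D (mops x 0 (Suc q)) (Mem x 0)
      = ops_cost D (mops x 0 q) (Mem x 0) + ops_cost D (mops x q (Suc q)) (Mem x q)"
    using mops_append[of 0 q "Suc q" x] Mem_step[of 0 q x] by (simp add: ops_cost_append)
  moreover have "card (Tch x q (Suc q)) \<le> ops_cost D (mops x q (Suc q)) (Mem x q)"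
    unfolding Tch_def by (rule card_ops_touched_le)
  ultimately show ?case using Suc by simp
qed simp

end

subsection \<open>Counting\<close>

lemma card_le_image_mult:
  assumes "finite A" "\<And>y. y \<in> f ` A \<Longrightarrow> card {x \<in> A. f x = y} \<le> k"
  shows "card A \<le> card (f ` A) * k"
proof -
  have "card A = (\<Sum>y\<in>f ` A. card {x \<in> A. f x = y})"
    using sum.image_gen[OF assms(1), of "\<lambda>_. 1::nat" f] by simp
  also have "\<dots> \<le> (\<Sum>y\<in>f ` A. k)" using assms(2) by (intro sum_mono) auto
  finally show ?thesis by simp
qed

text \<open>The members of \<open>F\<close> are the leaves of a tree of depth \<open>l\<close> in
  which every node has at most \<open>k\<close> sons; which sons these are may depend on the prefix.
  The prefixes are counted level by level.\<close>

lemma card_tree_le: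
  fixes F :: "(nat \<Rightarrow> 'a) set"
  assumes F: "F \<subseteq> {..<l} \<rightarrow>\<^sub>E V" "finite V"
    and branch: "\<And>q f. q < l \<Longrightarrow> f \<in> F \<Longrightarrow> card {g q | g. g \<in> F \<and> (\<forall>j<q. g j = f j)} \<le> k"
  shows "card F \<le> k ^ l"
proof -
  have fin: "finite F" using F by (intro finite_subset[OF F(1)] finite_PiE) simp_all
  have "card ((\<lambda>f. restrict f {..<q}) ` F) \<le> k ^ q" if "q \<le> l" for q
    using that
  proof (induction q)
    case 0
    have "card ((\<lambda>f. restrict f {..<0::nat}) ` F) \<le> card {\<lambda>_::nat. undefined::'a}"
      by (rule card_mono) (auto simp: restrict_def)
    also have "\<dots> = k ^ 0" by simp
    finally show ?case .
  next
    case (Suc q)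
    let ?A = "(\<lambda>f. restrict f {..<Suc q}) ` F"
    let ?r = "\<lambda>f::nat \<Rightarrow> 'a. restrict f {..<q}"
    have rr: "?r (restrict f {..<Suc q}) = ?r f" for f by (auto simp: restrict_def)
    have im: "?r ` ?A = ?r ` F" unfolding image_image rr ..
    have "card ?A \<le> card (?r ` ?A) * k"
    proof (rule card_le_image_mult)
      show "finite ?A" using fin by simp
      fix y assume "y \<in> ?r ` ?A"
      then obtain f where f: "f \<in> F" "y = ?r f" unfolding im by auto
      let ?V = "{g q | g. g \<in> F \<and> (\<forall>j<q. g j = f j)}"
      have "card {x \<in> ?A. ?r x = y} \<le> card ?V"
      proof (rule card_inj_on_le[where f = "\<lambda>x. x q"])
        show "finite ?V" using fin by simp
        show "(\<lambda>x. x q) ` {x \<in> ?A. ?r x = y} \<subseteq> ?V"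
        proof
          fix v assume "v \<in> (\<lambda>x. x q) ` {x \<in> ?A. ?r x = y}"
          then obtain g where g: "g \<in> F" "v = g q" "?r g = ?r f" using rr f(2) by auto
          have "g j = f j" if "j < q" for j using fun_cong[OF g(3), of j] that by simp
          then show "v \<in> ?V" using g by auto
        qed
        show "inj_on (\<lambda>x. x q) {x \<in> ?A. ?r x = y}"
        proof (rule inj_onI)
          fix x x' assume x: "x \<in> {x \<in> ?A. ?r x = y}" "x' \<in> {x \<in> ?A. ?r x = y}" and eq: "x q = x' q"
          show "x = x'"
          proof
            fix j
            consider "j < q" | "j = q" | "j > q" by linarith
            then show "x j = x' j"
            proof cases
              case 1
              have "?r x j = ?r x' j" using x by simp
              then show ?thesis using 1 by simp
            next
              case 3
              then show ?thesis using x by auto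
            qed (use eq in simp)
          qed
        qed
      qed
      also have "\<dots> \<le> k" using branch[of q f] f(1) Suc.prems by simp
      finally show "card {x \<in> ?A. ?r x = y} \<le> k" .
    qed
    also have "\<dots> \<le> k ^ q * k" unfolding im by (rule mult_le_mono1, rule Suc.IH) (use Suc.prems in simp)
    finally show ?case by (simp only: power_Suc mult.commute)
  qed
  moreover have "(\<lambda>f. restrict f {..<l}) ` F = F"
  proof -
    have "restrict f {..<l} = f" if "f \<in> F" for f by (rule PiE_restrict[OF subsetD[OF F(1) that]])
    then show ?thesis by simp
  qed
  ultimately show ?thesis by (metis order_refl)
qed

text \<open>The falling factorial. Truncated subtraction makes it 0 for \<open>k > N\<close>, as the
  number of injections should be.\<close>

definition ff :: "nat \<Rightarrow> nat \<Rightarrow> nat" where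
  "ff N k = (\<Prod>i = 0..<k. N - i)"

lemma card_inj_funcset:
  assumes "finite A" "finite C"
  shows "card {f \<in> A \<rightarrow>\<^sub>E C. inj_on f A} = ff (card C) (card A)"
  using card_inj_on_subset_funcset[OF assms order_refl] by (simp add: ff_def)

lemma ff_add: "ff N (j + k) = ff N j * ff (N - j) k"
  by (induction k) (simp_all add: ff_def)

lemma ff_fact: "k \<le> N \<Longrightarrow> ff N k * fact (N - k) = fact N"
proof (induction k)
  case (Suc k)
  then have "N - k = Suc (N - Suc k)" by simp
  then have "fact (N - k) = (N - k) * fact (N - Suc k)" by (metis fact_Suc of_nat_id)
  with Suc show ?case by (simp add: ff_def mult.assoc)
qed (simp add: ff_def)

lemma ff_self: "ff n n = fact n"
  using ff_fact[of n n] by simp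

lemma choose_fact_ff: "n \<le> N \<Longrightarrow> (N choose n) * fact n = ff N n"
proof -
  assume "n \<le> N"
  then have "((N choose n) * fact n) * fact (N - n) = ff N n * fact (N - n)"
    using binomial_fact_lemma[of n N] ff_fact[of n N] by (simp add: mult_ac)
  then show ?thesis by simp
qed

lemma ff_ge: "(N - k) ^ k \<le> ff N k"
proof -
  have "(\<Prod>i = 0..<k. N - k) \<le> (\<Prod>i = 0..<k. N - i)" by (intro prod_mono) auto
  then show ?thesis by (simp add: ff_def)
qed

section \<open>The sample space and its fibers\<close>

context dyn_dict
begin

definition Om :: "(nat \<Rightarrow> nat) set" where
  "Om = {x \<in> {..<2 * n} \<rightarrow>\<^sub>E {..<U}. inj_on x {..<2 * n}}"

definition dels :: "nat \<Rightarrow> nat \<Rightarrow> (nat \<Rightarrow> nat) \<Rightarrow> nat \<Rightarrow> nat" where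
  "dels s t x = restrict (\<lambda>j. x (s + j)) {..<t - s}"

definition ov :: "nat \<Rightarrow> nat \<Rightarrow> (nat \<Rightarrow> nat) \<Rightarrow> (nat \<Rightarrow> nat) \<Rightarrow> nat \<Rightarrow> nat" where
  "ov s t x A = (\<lambda>p. if n + s \<le> p \<and> p < n + t then A (p - (n + s)) else x p)"

text \<open>Meant for runs with the same memory at time \<open>s\<close>. Cells touched by
  \<open>x\<close> alone are exempt because a rerun of \<open>y\<close> never looks at them.\<close>

definition near :: "nat \<Rightarrow> nat \<Rightarrow> nat \<Rightarrow> (nat \<Rightarrow> nat) \<Rightarrow> (nat \<Rightarrow> nat) \<Rightarrow> bool" where
  "near s t h x y \<longleftrightarrow> card {e \<in> Tch x s t \<inter> Tch y s t. Mem x t e \<noteq> Mem y t e} \<le> h"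

definition Alt :: "nat \<Rightarrow> nat \<Rightarrow> nat \<Rightarrow> (nat \<Rightarrow> nat) \<Rightarrow> (nat \<Rightarrow> nat) set" where
  "Alt s t h x = {A \<in> {..<t - s} \<rightarrow>\<^sub>E {..<U}. valid (ov s t x A) t \<and> near s t h x (ov s t x A)}"

lemma finite_Om: "finite Om"
  unfolding Om_def by (rule finite_subset[of _ "{..<2 * n} \<rightarrow>\<^sub>E {..<U}"]) (auto intro: finite_PiE)

lemma card_Om: "card Om = ff U (2 * n)"
  unfolding Om_def using card_inj_funcset[of "{..<2 * n}" "{..<U}"] by simp

lemma valid_Om: "x \<in> Om \<Longrightarrow> p \<le> n \<Longrightarrow> valid x p"
  by (rule valid_mono[of x n]) (auto simp: Om_def valid_def mult_2)

lemma finite_Alt: "finite (Alt s t h x)"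
  unfolding Alt_def by (rule finite_subset[of _ "{..<t - s} \<rightarrow>\<^sub>E {..<U}"]) (auto intro: finite_PiE)

text \<open>The \<open>n\<close> positions in \<open>I1\<close> hold the current set in one of
  \<open>n!\<close> orders, the keys deleted in the child are fixed, and the remaining
  \<open>n - (t - s)\<close> keys avoid all of these.\<close>

lemma card_fiber:
  assumes "s \<le> t" "t \<le> n"
  shows "card {x \<in> Om. (cur x t, dels s t x) = q} \<le> fact n * ff (U - n - (t - s)) (n - (t - s))"
proof (cases "{x \<in> Om. (cur x t, dels s t x) = q} = {}")
  case False
  then obtain x0 where x0: "x0 \<in> Om" "q = (cur x0 t, dels s t x0)" by auto
  define I1 where "I1 = {t..<n} \<union> {n..<n + t}"
  define I3 where "I3 = {..<s} \<union> {n + t..<2 * n}"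
  have inj0: "inj_on x0 {..<2 * n}" and r0: "x0 ` {..<2 * n} \<subseteq> {..<U}" using x0 by (auto simp: Om_def)
  have curI: "cur x t = x ` I1" for x by (auto simp: cur_def I1_def)
  have delI: "dels s t x ` {..<t - s} = x ` {s..<t}" for x
  proof -
    have "(+) s ` {..<t - s} = {s..<t}" using assms by (simp add: lessThan_atLeast0)
    then have "x ` {s..<t} = (\<lambda>j. x (s + j)) ` {..<t - s}" by (metis image_image)
    then show ?thesis by (simp add: dels_def)
  qed
  have cI1: "card I1 = n" unfolding I1_def using assms by (subst card_Un_disjoint) auto
  have c13: "card (I1 \<union> {s..<t}) = n + (t - s)"
  proof -
    have "I1 \<inter> {s..<t} = {}" "finite I1" using assms by (auto simp: I1_def)
    then show ?thesis using cI1 by (simp add: card_Un_disjoint)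
  qed
  define V where "V = {..<U} - x0 ` (I1 \<union> {s..<t})"
  have sub: "I1 \<union> {s..<t} \<subseteq> {..<2 * n}" using assms by (auto simp: I1_def)
  have cV: "card V = U - n - (t - s)"
  proof -
    have "card (x0 ` (I1 \<union> {s..<t})) = n + (t - s)"
      using c13 card_image[OF inj_on_subset[OF inj0 sub]] by simp
    moreover have "x0 ` (I1 \<union> {s..<t}) \<subseteq> {..<U}"
      by (rule order.trans[OF image_mono[OF sub] r0])
    moreover have "finite (I1 \<union> {s..<t})" unfolding I1_def by simp
    ultimately show ?thesis unfolding V_def by (simp add: card_Diff_subset)
  qed
  have cI3: "card I3 = n - (t - s)" unfolding I3_def using assms by (subst card_Un_disjoint) auto
  let ?F1 = "{f \<in> I1 \<rightarrow>\<^sub>E cur x0 t. inj_on f I1}" and ?F3 = "{f \<in> I3 \<rightarrow>\<^sub>E V. inj_on f I3}"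
  have fin: "finite (?F1 \<times> ?F3)"
  proof -
    have "finite I1" "finite I3" "finite V" by (simp_all add: I1_def I3_def V_def)
    moreover have "finite (cur x0 t)" by (rule card_cur(3)[OF valid_Om[OF x0(1) assms(2)] assms(2)])
    ultimately have "finite (I1 \<rightarrow>\<^sub>E cur x0 t)" "finite (I3 \<rightarrow>\<^sub>E V)" by (simp_all add: finite_PiE)
    then show ?thesis by simp
  qed
  have U3: "{..<2 * n} = I1 \<union> {s..<t} \<union> I3" using assms by (auto simp: I1_def I3_def)
  have "card {x \<in> Om. (cur x t, dels s t x) = q} \<le> card (?F1 \<times> ?F3)"
  proof (rule card_inj_on_le[OF _ _ fin, where f = "\<lambda>x. (restrict x I1, restrict x I3)"])
    show "inj_on (\<lambda>x. (restrict x I1, restrict x I3)) {x \<in> Om. (cur x t, dels s t x) = q}"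
    proof (rule inj_onI)
      fix x y assume x: "x \<in> {x \<in> Om. (cur x t, dels s t x) = q}" and y: "y \<in> {x \<in> Om. (cur x t, dels s t x) = q}"
        and eq: "(restrict x I1, restrict x I3) = (restrict y I1, restrict y I3)"
      have d: "dels s t x = dels s t y" using x y by auto
      show "x = y"
      proof
        fix p
        consider "p \<in> I1" | "p \<in> {s..<t}" | "p \<in> I3" | "p \<notin> {..<2 * n}" using U3 by blast
        then show "x p = y p"
        proof cases
          case 1
          have "restrict x I1 p = restrict y I1 p" using eq by simp
          then show ?thesis using 1 by simp
        next
          case 2
          then have "p - s < t - s" "s + (p - s) = p" by auto
          then show ?thesis using fun_cong[OF d, of "p - s"] by (simp add: dels_def)
        next
          case 3
          have "restrict x I3 p = restrict y I3 p" using eq by simp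
          then show ?thesis using 3 by simp
        next
          case 4
          have ext: "x \<in> extensional {..<2 * n}" "y \<in> extensional {..<2 * n}" using x y by (auto simp: Om_def PiE_def)
          show ?thesis unfolding extensional_arb[OF ext(1) 4] extensional_arb[OF ext(2) 4] ..
        qed
      qed
    qed
    show "(\<lambda>x. (restrict x I1, restrict x I3)) ` {x \<in> Om. (cur x t, dels s t x) = q} \<subseteq> ?F1 \<times> ?F3"
    proof
      fix z assume "z \<in> (\<lambda>x. (restrict x I1, restrict x I3)) ` {x \<in> Om. (cur x t, dels s t x) = q}"
      then obtain x where x': "x \<in> Om" "(cur x t, dels s t x) = q" "z = (restrict x I1, restrict x I3)"
        by blast
      then have x: "x \<in> Om" "cur x t = cur x0 t" "dels s t x = dels s t x0" "z = (restrict x I1, restrict x I3)"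
        using x0(2) by simp_all
      have inj: "inj_on x {..<2 * n}" and r: "x ` {..<2 * n} \<subseteq> {..<U}" using x by (auto simp: Om_def)
      have same: "x ` (I1 \<union> {s..<t}) = x0 ` (I1 \<union> {s..<t})"
        using x(2) curI[of x] curI[of x0] delI[of x] delI[of x0] x(3) by (simp add: image_Un)
      have dis: "(I1 \<union> {s..<t}) \<inter> I3 = {}" "I1 \<union> {s..<t} \<subseteq> {..<2 * n}" "I3 \<subseteq> {..<2 * n}"
        using assms by (auto simp: I1_def I3_def)
      have "x ` I3 \<inter> x ` (I1 \<union> {s..<t}) = {}"
        using inj_on_image_Int[OF inj dis(2,3)] dis(1) by (simp add: Int_commute)
      then have "x ` I3 \<subseteq> V" unfolding V_def same[symmetric] using r dis(3) by blast
      moreover have "inj_on x I1" by (rule inj_on_subset[OF inj]) (use dis(2) in simp)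
      moreover have "inj_on x I3" by (rule inj_on_subset[OF inj dis(3)])
      moreover have "x ` I1 = cur x0 t" using x(2) curI[of x] by simp
      ultimately show "z \<in> ?F1 \<times> ?F3" unfolding x(4) by (auto simp: inj_on_def)
    qed
  qed
  also have "\<dots> = fact n * ff (U - n - (t - s)) (n - (t - s))"
  proof -
    have "card ?F1 = ff n n"
      using card_inj_funcset[of I1 "cur x0 t"] cI1 card_cur[OF valid_Om[OF x0(1) assms(2)] assms(2)]
      by (simp add: I1_def)
    moreover have "card ?F3 = ff (U - n - (t - s)) (n - (t - s))"
      using card_inj_funcset[of I3 V] cI3 cV by (simp add: I3_def V_def)
    ultimately show ?thesis by (simp add: card_cartesian_product ff_self)
  qed
  finally show ?thesis .
next
  case True
  show ?thesis unfolding True by simp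
qed

text \<open>\<open>(U choose n) * ff (U - n) l\<close> is the number of pairs of a current set and a
  sequence of deleted keys outside it. So the bound of \<open>card_fiber\<close> is the average
  fiber, and a bound on the number of occurring pairs becomes one on the number of samples.\<close>

lemma fiber_card_Om:
  assumes "l \<le> n" "n \<le> U"
  shows "(U choose n) * ff (U - n) l * (fact n * ff (U - n - l) (n - l)) = card Om"
proof -
  have "ff U (2 * n) = ff U (n + (l + (n - l)))" using assms by (simp add: mult_2)
  also have "\<dots> = ff U n * (ff (U - n) l * ff (U - n - l) (n - l))" by (simp only: ff_add)
  also have "ff U n = (U choose n) * fact n" using choose_fact_ff assms by simp
  finally show ?thesis by (simp add: card_Om mult_ac)
qed

end

context dyn_dict
begin

subsection \<open>Compressing the memory after a child\<close>

text \<open>The deletion sequences compatible with a memory \<open>M\<close> that is only reliable outside \<open>P\<close>.  Each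
sequence is witnessed by a reachable state agreeing with \<open>M\<close> outside \<open>P\<close>; two witnesses with the same
prefix behave alike as long as they avoid \<open>P\<close>, so the next key lies in the current set of either.\<close>

definition delete_seqs :: "nat \<Rightarrow> nat \<Rightarrow> mem \<Rightarrow> nat set \<Rightarrow> (nat \<Rightarrow> nat) \<Rightarrow> (nat \<Rightarrow> nat) set" where
  "delete_seqs s t M P A = {dels s t y | y. valid y t \<and> (\<forall>j<t - s. y (n + s + j) = A j)
     \<and> agree (- P) (Mem y s) M \<and> Tch y s t \<inter> P = {}}"

lemma card_delete_seqs:
  assumes "s \<le> t" "t \<le> n"
  shows "card (delete_seqs s t M P A) \<le> n ^ (t - s)"
    and "delete_seqs s t M P A \<subseteq> {..<t - s} \<rightarrow>\<^sub>E {..<U}"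
proof -
  let ?F = "delete_seqs s t M P A"
  show sub: "?F \<subseteq> {..<t - s} \<rightarrow>\<^sub>E {..<U}"
  proof
    fix f assume "f \<in> ?F"
    then obtain y where y: "f = dels s t y" "valid y t" unfolding delete_seqs_def mem_Collect_eq by blast
    have "y (s + j) < U" if "j < t - s" for j
    proof -
      have "s + j \<in> {..<n + t}" using that assms by simp
      then show ?thesis using y(2) unfolding valid_def by blast
    qed
    then show "f \<in> {..<t - s} \<rightarrow>\<^sub>E {..<U}" unfolding y(1) dels_def by simp
  qed
  show "card ?F \<le> n ^ (t - s)"
  proof (rule card_tree_le[OF sub])
    fix q f assume q: "q < t - s" and f: "f \<in> ?F"
    from f obtain y0 where y0: "f = dels s t y0" "valid y0 t" "\<And>j. j < t - s \<Longrightarrow> y0 (n + s + j) = A j"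
      "agree (- P) (Mem y0 s) M" "Tch y0 s t \<inter> P = {}" unfolding delete_seqs_def mem_Collect_eq by blast
    have vq: "valid y0 (s + q)" "s + q \<le> n" using valid_mono[OF y0(2), of "s + q"] q assms by auto
    have "{g q | g. g \<in> ?F \<and> (\<forall>j<q. g j = f j)} \<subseteq> cur y0 (s + q)"
    proof
      fix v assume "v \<in> {g q | g. g \<in> ?F \<and> (\<forall>j<q. g j = f j)}"
      then obtain g where g: "g \<in> ?F" "\<And>j. j < q \<Longrightarrow> g j = f j" "v = g q" by blast
      from g(1) obtain y where y: "g = dels s t y" "valid y t" "\<And>j. j < t - s \<Longrightarrow> y (n + s + j) = A j"
        "agree (- P) (Mem y s) M" "Tch y s t \<inter> P = {}" unfolding delete_seqs_def mem_Collect_eq by blast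
      have v: "v = y (s + q)" using g(3) y(1) q by (simp add: dels_def)
      have ops: "mops y s (s + q) = mops y0 s (s + q)"
      proof (rule mops_cong)
        fix r assume r: "s \<le> r" "r < s + q"
        then have "g (r - s) = f (r - s)" "r - s < t - s" using g(2)[of "r - s"] q by auto
        then have "y r = y0 r" using r by (simp add: y(1) y0(1) dels_def)
        moreover have "y (n + r) = y0 (n + r)"
          using y(3)[of "r - s"] y0(3)[of "r - s"] r q by simp
        ultimately show "y r = y0 r \<and> y (n + r) = y0 (n + r)" by simp
      qed
      have split: "Tch y s t = Tch y s (s + q) \<union> (Tch y (s + q) (Suc (s + q)) \<union> Tch y (Suc (s + q)) t)"
        using Tch_append[of s "s + q" t y] Tch_append[of "s + q" "Suc (s + q)" t y] q by simp
      have "agree (- P) (Mem y s) (Mem y0 s)" using y(4) y0(4) by (simp add: agree_def)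
      moreover have "ops_touched D (mops y s (s + q)) (Mem y s) \<subseteq> - P"
        using split y(5) unfolding Tch_def by blast
      ultimately have "agree (- P) (ops_mem D (mops y s (s + q)) (Mem y s)) (ops_mem D (mops y s (s + q)) (Mem y0 s))"
        using ops_local by blast
      then have ag: "agree (- P) (Mem y (s + q)) (Mem y0 (s + q))"
        using Mem_step[of s "s + q" y] Mem_step[of s "s + q" y0] ops by simp
      \<comment> \<open>Every meta-operation queries its key before deleting it, so the cells probed
        by this query belong to the touched ones and avoid \<open>P\<close>.\<close>
      have "touched (qry_op D v) (Mem y (s + q)) \<subseteq> Tch y (s + q) (Suc (s + q))"
        unfolding v by (auto simp: Tch_def mops_Suc[of "s + q" "s + q" y])
      then have tq: "touched (qry_op D v) (Mem y (s + q)) \<subseteq> - P" using split y(5) by blast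
      have "fst (run (qry_op D v) (Mem y0 (s + q))) = fst (run (qry_op D v) (Mem y (s + q)))"
        using run_local[OF tq ag] by simp
      moreover have "v \<in> dec (Mem y (s + q))"
      proof -
        have "v \<in> cur y (s + q)" unfolding v cur_def using q assms by auto
        then show ?thesis using dec_Mem[of y "s + q"] valid_mono[OF y(2), of "s + q"] q assms by auto
      qed
      ultimately have "v \<in> dec (Mem y0 (s + q))" by (simp add: dec_def)
      then show "v \<in> cur y0 (s + q)" using dec_Mem[OF vq] by simp
    qed
    then have "card {g q | g. g \<in> ?F \<and> (\<forall>j<q. g j = f j)} \<le> card (cur y0 (s + q))"
      using card_cur[OF vq] by (intro card_mono) auto
    then show "card {g q | g. g \<in> ?F \<and> (\<forall>j<q. g j = f j)} \<le> n" using card_cur[OF vq] by simp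
  qed simp
qed

lemma ov_prefix: "i < n + s \<Longrightarrow> ov s t x A i = x i"
  by (simp add: ov_def)

text \<open>Outside \<open>Tch x s t - Tch y s t\<close> this is the memory before the child, since
  cells not touched by \<open>x\<close> have not changed. So it supports the run of \<open>y\<close>
  and certifies the deleted keys, at the price of one memory of \<open>S\<close> cells.\<close>

definition hyb :: "nat \<Rightarrow> nat \<Rightarrow> (nat \<Rightarrow> nat) \<Rightarrow> (nat \<Rightarrow> nat) \<Rightarrow> mem" where
  "hyb s t x y = (\<lambda>e. if e \<in> Tch x s t \<inter> Tch y s t then Mem x s e else Mem x t e)"

text \<open>The cells in which a rerun of \<open>y\<close> does not restore the final contents;
  these go into the patch.\<close>

definition diff :: "nat \<Rightarrow> nat \<Rightarrow> (nat \<Rightarrow> nat) \<Rightarrow> (nat \<Rightarrow> nat) \<Rightarrow> nat set" where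
  "diff s t x y = {e \<in> Tch x s t \<inter> Tch y s t. Mem x t e \<noteq> Mem y t e}"

definition patches :: "nat \<Rightarrow> (nat set \<times> (nat \<Rightarrow> nat)) set" where
  "patches h = (SIGMA E:{E. E \<subseteq> {..<S} \<and> card E \<le> h}. E \<rightarrow>\<^sub>E {..<2 ^ w})"

text \<open>The hybrid memory, the cells touched by \<open>x\<close> alone, the common cells, the
  patch and the choice \<open>A\<close>. The cell sets may be stored as plain subsets because
  \<open>O(S)\<close> bits are below what is saved.\<close>

definition codes :: "nat \<Rightarrow> nat \<Rightarrow> (mem \<times> nat set \<times> nat set \<times> (nat set \<times> (nat \<Rightarrow> nat)) \<times> (nat \<Rightarrow> nat)) set" where
  "codes l h = {m. mem_ok S (2 ^ w) (init_mem D) m} \<times> Pow {..<S} \<times> Pow {..<S} \<times> patches h \<times> ({..<l} \<rightarrow>\<^sub>E {..<U})"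

lemma card_patches: "finite (patches h)" "card (patches h) \<le> 2 ^ S * (2 ^ w) ^ h"
proof -
  let ?Es = "{E. E \<subseteq> {..<S} \<and> card E \<le> h}"
  have fin: "finite ?Es" by (rule finite_subset[of _ "Pow {..<S}"]) auto
  have finE: "finite E" if "E \<in> ?Es" for E
    by (rule finite_subset[of _ "{..<S}"]) (use that in auto)
  show "finite (patches h)" unfolding patches_def using fin by (rule finite_SigmaI) (rule finite_PiE[OF finE]; simp)
  have "card (patches h) = (\<Sum>E\<in>?Es. card (E \<rightarrow>\<^sub>E {..<2 ^ w::nat}))"
    unfolding patches_def using fin by (rule card_SigmaI) (rule ballI, rule finite_PiE[OF finE]; simp)
  also have "\<dots> \<le> (\<Sum>E\<in>?Es. (2 ^ w) ^ h)"
  proof (rule sum_mono)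
    fix E assume E: "E \<in> ?Es"
    have "card (E \<rightarrow>\<^sub>E {..<2 ^ w::nat}) = (2 ^ w) ^ card E"
      unfolding card_funcsetE[OF finE[OF E]] card_lessThan ..
    also have "\<dots> \<le> (2 ^ w) ^ h" by (rule power_increasing) (use E in simp_all)
    finally show "card (E \<rightarrow>\<^sub>E {..<2 ^ w::nat}) \<le> (2 ^ w) ^ h" .
  qed
  also have "\<dots> = card ?Es * (2 ^ w) ^ h" by simp
  also have "\<dots> \<le> card (Pow {..<S}) * (2 ^ w) ^ h" by (intro mult_le_mono1 card_mono) auto
  also have "\<dots> = 2 ^ S * (2 ^ w) ^ h" by (simp add: card_Pow)
  finally show "card (patches h) \<le> 2 ^ S * (2 ^ w) ^ h" .
qed

lemma card_codes:
  "finite (codes l h)" "card (codes l h) \<le> (2 ^ w) ^ S * (2 ^ S * (2 ^ S * (2 ^ S * (2 ^ w) ^ h * U ^ l)))"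
proof -
  show "finite (codes l h)" unfolding codes_def
    using card_mem_ok[of S "2 ^ w" "init_mem D"] card_patches(1)[of h]
    by (intro finite_cartesian_product finite_PiE) simp_all
  have "card (codes l h) = (2 ^ w) ^ S * (2 ^ S * (2 ^ S * (card (patches h) * U ^ l)))"
    unfolding codes_def using card_mem_ok[of S "2 ^ w" "init_mem D"]
    by (simp add: card_cartesian_product card_Pow card_funcsetE)
  also have "\<dots> \<le> (2 ^ w) ^ S * (2 ^ S * (2 ^ S * (2 ^ S * (2 ^ w) ^ h * U ^ l)))"
    using card_patches(2)[of h] by (intro mult_le_mono2 mult_le_mono1)
  finally show "card (codes l h) \<le> (2 ^ w) ^ S * (2 ^ S * (2 ^ S * (2 ^ S * (2 ^ w) ^ h * U ^ l)))" .
qed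

text \<open>\<open>y\<close> itself witnesses that the deletions of \<open>x\<close> belong to
  \<open>delete_seqs\<close>: it starts from the memory of \<open>x\<close>, deletes the same keys,
  inserts \<open>A\<close> and never touches the unreliable cells
  \<open>Tch x s t - Tch y s t\<close>.\<close>

lemma alt_encoding:
  assumes st: "s \<le> t" "t \<le> n" and x: "valid x t" and A: "A \<in> Alt s t h x"
  defines "y \<equiv> ov s t x A"
  defines "c \<equiv> (hyb s t x y, Tch x s t - Tch y s t, Tch x s t \<inter> Tch y s t,
     (diff s t x y, restrict (Mem x t) (diff s t x y)), A)"
  shows "c \<in> codes (t - s) h" "dels s t x \<in> delete_seqs s t (fst c) (fst (snd c)) A"
proof -
  have vy: "valid y t" and near: "card (diff s t x y) \<le> h" and AU: "A \<in> {..<t - s} \<rightarrow>\<^sub>E {..<U}"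
    using A by (auto simp: Alt_def near_def diff_def y_def)
  have T: "Tch x s t \<subseteq> {..<S}" by (rule Tch_subset)
  have hy: "mem_ok S (2 ^ w) (init_mem D) (hyb s t x y)"
    using Mem_ok[of x s] Mem_ok[of x t] by (auto simp: mem_ok_def hyb_def)
  have "restrict (Mem x t) (diff s t x y) \<in> diff s t x y \<rightarrow>\<^sub>E {..<2 ^ w}"
    using Mem_ok[of x t] T by (auto simp: mem_ok_def diff_def)
  moreover have "diff s t x y \<subseteq> {..<S}" using T by (auto simp: diff_def)
  ultimately show "c \<in> codes (t - s) h"
    using hy near T AU unfolding codes_def c_def patches_def by auto
  have Mys: "Mem y s = Mem x s" using ov_prefix[of _ s t x A] st unfolding y_def by (intro Mem_cong) auto
  have "dels s t y = dels s t x"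
    unfolding dels_def using st by (intro restrict_ext) (auto simp: y_def ov_def)
  moreover have "\<forall>j<t - s. y (n + s + j) = A j" by (auto simp: y_def ov_def)
  moreover have "agree (- (Tch x s t - Tch y s t)) (Mem y s) (hyb s t x y)"
    using Mem_untouched[OF st(1), of _ x] unfolding agree_def Mys hyb_def by auto
  ultimately show "dels s t x \<in> delete_seqs s t (fst c) (fst (snd c)) A"
    unfolding delete_seqs_def c_def fst_conv snd_conv using vy by (auto intro!: exI[of _ y])
qed

definition decode :: "nat \<Rightarrow> nat \<Rightarrow> mem \<times> nat set \<times> nat set \<times> (nat set \<times> (nat \<Rightarrow> nat)) \<times> (nat \<Rightarrow> nat) \<Rightarrow> (nat \<Rightarrow> nat) \<Rightarrow> mem" where
  "decode s t c dl = (case c of (M, P, X, (E, f), A) \<Rightarrow>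
     (\<lambda>e. if e \<in> E then f e else if e \<in> X then
        ops_mem D (mops (\<lambda>p. if p < n then dl (p - s) else A (p - (n + s))) s t) M e else M e))"

text \<open>A common cell gets its final contents from the rerun of \<open>y\<close> or, where these
  are wrong, from the patch; every other cell is stored with its final contents in the hybrid
  memory.\<close>

lemma decode_alt:
  assumes st: "s \<le> t" "t \<le> n" and A: "A \<in> Alt s t h x"
  defines "y \<equiv> ov s t x A"
  shows "decode s t (hyb s t x y, Tch x s t - Tch y s t, Tch x s t \<inter> Tch y s t,
     (diff s t x y, restrict (Mem x t) (diff s t x y)), A) (dels s t x) = Mem x t"
proof -
  \<comment> \<open>The decoder knows only the keys of the child, and \<open>mops\<close> between
    \<open>s\<close> and \<open>t\<close> looks at no others. Positions below \<open>n\<close> are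
    deletions.\<close>
  define z where "z = (\<lambda>p. if p < n then dels s t x (p - s) else A (p - (n + s)))"
  have ops: "mops z s t = mops y s t"
    using st by (intro mops_cong) (auto simp: z_def y_def ov_def dels_def)
  have Mys: "Mem y s = Mem x s" using ov_prefix[of _ s t x A] st unfolding y_def by (intro Mem_cong) auto
  have "agree (Tch y s t) (Mem y s) (hyb s t x y)"
    using Mem_untouched[OF st(1), of _ x] unfolding agree_def Mys hyb_def by auto
  then have "agree (Tch y s t) (ops_mem D (mops y s t) (Mem y s)) (ops_mem D (mops y s t) (hyb s t x y))"
    using ops_local[of D "mops y s t" "Mem y s"] unfolding Tch_def by blast
  then have ag: "agree (Tch y s t) (Mem y t) (ops_mem D (mops z s t) (hyb s t x y))"
    using Mem_step[OF st(1), of y] ops by simp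
  show ?thesis
    unfolding decode_def prod.case z_def[symmetric]
    using ag by (auto simp: fun_eq_iff agree_def diff_def hyb_def)
qed

text \<open>Storing \<open>A\<close> costs a factor \<open>U ^ (t - s)\<close>, but there are at
  least \<open>G\<close> ways to choose it. Encoding pairs of an outcome and a choice, instead of
  outcomes, refunds this factor \<open>G\<close>.\<close>

lemma card_many_alt:
  assumes st: "s \<le> t" "t \<le> n" and nU: "n \<le> U"
  shows "card {x \<in> Om. G \<le> card (Alt s t h x)} * G * ((U choose n) * ff (U - n) (t - s))
    \<le> card Om * ((2 ^ w) ^ S * (2 ^ S * (2 ^ S * (2 ^ S * (2 ^ w) ^ h * U ^ (t - s)))) * n ^ (t - s))"
proof -
  let ?l = "t - s"
  let ?B = "{x \<in> Om. G \<le> card (Alt s t h x)}"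
  let ?key = "\<lambda>x. (cur x t, dels s t x)"
  let ?F = "fact n * ff (U - n - ?l) (n - ?l)"
  let ?C = "(2 ^ w) ^ S * (2 ^ S * (2 ^ S * (2 ^ S * (2 ^ w) ^ h * U ^ ?l)))"
  have finB: "finite ?B" using finite_Om by simp
  have 1: "card ?B \<le> card (?key ` ?B) * ?F"
  proof (rule card_le_image_mult[OF finB])
    fix q assume "q \<in> ?key ` ?B"
    have "card {x \<in> ?B. ?key x = q} \<le> card {x \<in> Om. ?key x = q}"
      using finite_Om by (intro card_mono) auto
    also have "\<dots> \<le> ?F" by (rule card_fiber[OF st])
    finally show "card {x \<in> ?B. ?key x = q} \<le> ?F" .
  qed
  \<comment> \<open>The code determines the current set and the deleted keys but not the rest of
    \<open>x\<close>, so each such pair is represented by one sample.\<close>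
  define rep where "rep = inv_into ?B ?key"
  have rep: "rep q \<in> ?B" "?key (rep q) = q" if "q \<in> ?key ` ?B" for q
    using inv_into_into[OF that] f_inv_into_f[OF that] unfolding rep_def by auto
  define T where "T = (SIGMA q:?key ` ?B. Alt s t h (rep q))"
  have "card (?key ` ?B) * G = (\<Sum>q\<in>?key ` ?B. G)" by simp
  also have "\<dots> \<le> (\<Sum>q\<in>?key ` ?B. card (Alt s t h (rep q)))"
    by (rule sum_mono) (use rep(1) in auto)
  also have "\<dots> = card T"
    unfolding T_def using finB finite_Alt by (subst card_SigmaI) auto
  also have "card T \<le> card (SIGMA c:codes ?l h. delete_seqs s t (fst c) (fst (snd c)) (snd (snd (snd (snd c)))))"
  proof (rule card_inj_on_le)
    let ?code = "\<lambda>(q, A). let x = rep q; y = ov s t x A in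
      ((hyb s t x y, Tch x s t - Tch y s t, Tch x s t \<inter> Tch y s t,
        (diff s t x y, restrict (Mem x t) (diff s t x y)), A), dels s t x)"
    show "?code ` T \<subseteq> (SIGMA c:codes ?l h. delete_seqs s t (fst c) (fst (snd c)) (snd (snd (snd (snd c)))))"
    proof
      fix z assume "z \<in> ?code ` T"
      then obtain q A where q: "q \<in> ?key ` ?B" "A \<in> Alt s t h (rep q)" "z = ?code (q, A)"
        unfolding T_def by auto
      have "valid (rep q) t" using rep(1)[OF q(1)] valid_Om st by auto
      from alt_encoding[OF st this q(2)] show "z \<in> (SIGMA c:codes ?l h. delete_seqs s t (fst c) (fst (snd c)) (snd (snd (snd (snd c)))))"
        unfolding q(3) by (simp add: Let_def)
    qed
    show "inj_on ?code T"
    proof (rule inj_onI)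
      fix u v assume uv: "u \<in> T" "v \<in> T" "?code u = ?code v"
      obtain q A where u: "u = (q, A)" by (cases u)
      obtain q' A' where v: "v = (q', A')" by (cases v)
      have q: "q \<in> ?key ` ?B" "A \<in> Alt s t h (rep q)" "q' \<in> ?key ` ?B" "A' \<in> Alt s t h (rep q')"
        using uv(1,2) unfolding T_def u v by auto
      have AA: "A = A'" "dels s t (rep q) = dels s t (rep q')" using uv(3) unfolding u v by (simp_all add: Let_def)
      have "decode s t (fst (?code u)) (snd (?code u)) = decode s t (fst (?code v)) (snd (?code v))"
        using uv(3) by simp
      then have "Mem (rep q) t = Mem (rep q') t"
        using decode_alt[OF st q(2)] decode_alt[OF st q(4)] unfolding u v by (simp add: Let_def)
      then have "cur (rep q) t = cur (rep q') t"
        using dec_Mem[of "rep q" t] dec_Mem[of "rep q'" t] rep(1)[OF q(1)] rep(1)[OF q(3)] valid_Om st by auto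
      then have "q = q'" using rep(2)[OF q(1)] rep(2)[OF q(3)] AA by metis
      then show "u = v" using AA u v by simp
    qed
    show "finite (SIGMA c:codes ?l h. delete_seqs s t (fst c) (fst (snd c)) (snd (snd (snd (snd c)))))"
      by (intro finite_SigmaI card_codes(1) finite_subset[OF card_delete_seqs(2)[OF st]] finite_PiE) auto
  qed
  also have "\<dots> = (\<Sum>c\<in>codes ?l h. card (delete_seqs s t (fst c) (fst (snd c)) (snd (snd (snd (snd c))))))"
    by (intro card_SigmaI card_codes(1) ballI finite_subset[OF card_delete_seqs(2)[OF st]] finite_PiE) auto
  also have "\<dots> \<le> (\<Sum>c\<in>codes ?l h. n ^ ?l)" by (intro sum_mono card_delete_seqs(1)[OF st])
  also have "\<dots> \<le> ?C * n ^ ?l" using card_codes(2)[of ?l h] by simp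
  finally have 2: "card (?key ` ?B) * G \<le> ?C * n ^ ?l" .
  have "card ?B * G * ((U choose n) * ff (U - n) ?l)
      \<le> card (?key ` ?B) * ?F * G * ((U choose n) * ff (U - n) ?l)"
    using 1 by (intro mult_le_mono1)
  also have "\<dots> = (card (?key ` ?B) * G) * ((U choose n) * ff (U - n) ?l * ?F)" by (simp only: mult_ac)
  also have "(U choose n) * ff (U - n) ?l * ?F = card Om"
    using fiber_card_Om[of ?l] st nU by simp
  also have "(card (?key ` ?B) * G) * card Om \<le> (?C * n ^ ?l) * card Om" using 2 by (rule mult_le_mono1)
  finally show ?thesis by (simp only: mult_ac)
qed

end

locale node = dyn_dict +
  fixes s0 l B d K :: nat
  assumes node_le: "s0 + B * l \<le> n" and l_pos: "0 < l"
begin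

text \<open>The keys inserted in children \<open>i, \<dots>, B - 1\<close> form a matrix with \<open>B - i\<close> rows and \<open>l\<close> columns.
Only the column-wise rearrangements are used: they already offer \<open>(B - i)^l\<close> choices for child \<open>i\<close>,
and a choice is given by one row index per column.\<close>

definition start :: "nat \<Rightarrow> nat" where
  "start i = s0 + i * l"

definition col :: "nat \<Rightarrow> nat \<Rightarrow> (nat \<Rightarrow> nat) \<Rightarrow> nat set" where
  "col i j x = (\<lambda>a. x (n + start i + a * l + j)) ` {..<B - i}"

definition rows :: "nat \<Rightarrow> (nat \<Rightarrow> nat) \<Rightarrow> (nat \<Rightarrow> nat) set" where
  "rows i x = (\<Pi>\<^sub>E j\<in>{..<l}. col i j x)"

definition choices :: "nat \<Rightarrow> (nat \<Rightarrow> nat) set" where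
  "choices i = {..<l} \<rightarrow>\<^sub>E {..<B - i}"

definition row :: "nat \<Rightarrow> (nat \<Rightarrow> nat) \<Rightarrow> (nat \<Rightarrow> nat) \<Rightarrow> nat \<Rightarrow> nat" where
  "row i c x = restrict (\<lambda>j. x (n + start i + c j * l + j)) {..<l}"

abbreviation alt :: "nat \<Rightarrow> (nat \<Rightarrow> nat) \<Rightarrow> (nat \<Rightarrow> nat) set" where
  "alt i x \<equiv> Alt (start i) (start (Suc i)) (2 * d) x"

definition nice :: "nat \<Rightarrow> (nat \<Rightarrow> nat) \<Rightarrow> bool" where
  "nice i x \<longleftrightarrow> card (alt i x \<inter> rows i x) * K \<le> (B - i) ^ l"

text \<open>\<open>M\<close> stands for the memory at the end of the node. It is a free argument
  because the union bound in \<open>card_many_good\<close> runs over all memories, and for a fixed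
  \<open>M\<close> the children can be treated one by one.\<close>

definition good :: "nat \<Rightarrow> mem \<Rightarrow> (nat \<Rightarrow> nat) \<Rightarrow> bool" where
  "good i M x \<longleftrightarrow> card {e \<in> Tch x (start i) (start (Suc i)). Mem x (start (Suc i)) e \<noteq> M e} \<le> d \<and> nice i x"

lemma start_Suc: "start (Suc i) = start i + l"
  by (simp add: start_def)

lemma start_mono: "i \<le> j \<Longrightarrow> start i \<le> start j"
  by (simp add: start_def)

lemma start_le: assumes "i \<le> B" shows "start i \<le> n"
  unfolding start_def by (rule order.trans[OF add_left_mono[OF mult_le_mono1[OF assms]] node_le])

lemma pos_less: "i \<le> B \<Longrightarrow> a < B - i \<Longrightarrow> j < l \<Longrightarrow> n + start i + a * l + j < n + start B"
proof -
  assume "i \<le> B" "a < B - i" "j < l"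
  then have "(i + a + 1) * l \<le> B * l" by (intro mult_le_mono1) simp
  with \<open>j < l\<close> show ?thesis by (simp add: start_def algebra_simps)
qed

lemma pos_lt_2n: "i \<le> B \<Longrightarrow> a < B - i \<Longrightarrow> j < l \<Longrightarrow> n + start i + a * l + j < 2 * n"
  using pos_less[of i a j] start_le[of B] by simp

lemma pos_inj: "j < l \<Longrightarrow> j' < l \<Longrightarrow> q + a * l + j = q + a' * l + j' \<Longrightarrow> a = a' \<and> j = j'" for q a a' j j' :: nat
proof -
  assume j: "j < l" "j' < l" "q + a * l + j = q + a' * l + j'"
  then have e: "a * l + j = a' * l + j'" by simp
  have "(a * l + j) div l = (a' * l + j') div l" using e by simp
  then have "a = a'" using j(1,2) by simp
  then show ?thesis using e by simp
qed

lemma Om_inj: "x \<in> Om \<Longrightarrow> p < 2 * n \<Longrightarrow> q < 2 * n \<Longrightarrow> x p = x q \<Longrightarrow> p = q"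
  unfolding Om_def inj_on_def by blast

lemma row_in_rows: "c \<in> choices i \<Longrightarrow> row i c x \<in> rows i x"
  unfolding choices_def rows_def row_def col_def by auto

lemma rows_eq: "rows i x = (\<lambda>c. row i c x) ` choices i"
proof
  show "(\<lambda>c. row i c x) ` choices i \<subseteq> rows i x" using row_in_rows by blast
  show "rows i x \<subseteq> (\<lambda>c. row i c x) ` choices i"
  proof
    fix A assume A: "A \<in> rows i x"
    then have "\<forall>j\<in>{..<l}. \<exists>a. a < B - i \<and> A j = x (n + start i + a * l + j)"
      unfolding rows_def col_def by (auto simp: PiE_def Pi_def)
    then obtain c where c: "\<And>j. j < l \<Longrightarrow> c j < B - i \<and> A j = x (n + start i + c j * l + j)"
      using bchoice[of "{..<l}"] by (metis lessThan_iff)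
    have "restrict c {..<l} \<in> choices i" using c by (auto simp: choices_def)
    moreover have "A = row i (restrict c {..<l}) x"
    proof
      fix j
      show "A j = row i (restrict c {..<l}) x j"
        using c[of j] A by (cases "j < l") (auto simp: row_def rows_def PiE_def extensional_def)
    qed
    ultimately show "A \<in> (\<lambda>c. row i c x) ` choices i" by blast
  qed
qed

lemma finite_choices: "finite (choices i)"
  unfolding choices_def by (rule finite_PiE) simp_all

lemma card_choices: "card (choices i) = (B - i) ^ l"
  unfolding choices_def by (simp add: card_funcsetE)

lemma Alt_cong:
  assumes "s \<le> t" "t \<le> n" and eq: "\<And>p. p < n + t \<Longrightarrow> x p = y p"
  shows "Alt s t h x = Alt s t h y"
proof -
  have o: "ov s t x A p = ov s t y A p" if "p < n + t" for p A
    using eq[OF that] by (simp add: ov_def)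
  have v: "valid (ov s t x A) t = valid (ov s t y A) t" for A
  proof -
    have "inj_on (ov s t x A) {..<n + t} = inj_on (ov s t y A) {..<n + t}"
      using o by (intro inj_on_cong) simp
    moreover have "ov s t x A ` {..<n + t} = ov s t y A ` {..<n + t}" using o by (intro image_cong) simp_all
    ultimately show ?thesis by (simp add: valid_def)
  qed
  have nr: "near s t h x (ov s t x A) = near s t h y (ov s t y A)" for A
  proof -
    have "Mem x t = Mem y t" "Mem (ov s t x A) t = Mem (ov s t y A) t"
      using assms o by (auto intro!: Mem_cong)
    moreover have "Tch x s t = Tch y s t" by (rule Tch_cong) (use assms in auto)
    moreover have "Tch (ov s t x A) s t = Tch (ov s t y A) s t"
      by (rule Tch_cong) (use assms o in auto)
    ultimately show ?thesis by (simp add: near_def)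
  qed
  show ?thesis unfolding Alt_def v nr ..
qed

lemma row_inj:
  assumes x: "x \<in> Om" and i: "i \<le> B"
  shows "inj_on (\<lambda>c. row i c x) (choices i)"
proof (rule inj_onI)
  fix c c' assume c: "c \<in> choices i" "c' \<in> choices i" and eq: "row i c x = row i c' x"
  show "c = c'"
  proof (rule PiE_ext)
    show "c \<in> {..<l} \<rightarrow>\<^sub>E {..<B - i}" "c' \<in> {..<l} \<rightarrow>\<^sub>E {..<B - i}" using c unfolding choices_def by auto
    fix j assume j: "j \<in> {..<l}"
    then have lt: "c j < B - i" "c' j < B - i" using c unfolding choices_def by auto
    have "row i c x j = row i c' x j" using eq by simp
    then have "x (n + start i + c j * l + j) = x (n + start i + c' j * l + j)" using j by (simp add: row_def)
    then have "n + start i + c j * l + j = n + start i + c' j * l + j"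
      using Om_inj[OF x pos_lt_2n[OF i lt(1)] pos_lt_2n[OF i lt(2)]] j by (metis lessThan_iff)
    then show "c j = c' j" using pos_inj[of j j "n + start i" "c j" "c' j"] j by simp
  qed
qed

subsection \<open>Children with few close choices\<close>

text \<open>The positions read by \<open>row i c\<close> that lie outside child \<open>i\<close>; \<open>alt i x\<close> does not depend on \<open>x\<close> there.\<close>

definition fresh :: "nat \<Rightarrow> (nat \<Rightarrow> nat) \<Rightarrow> nat set" where
  "fresh i c = (\<lambda>j. n + start i + c j * l + j) ` {j. j < l \<and> c j \<noteq> 0}"

text \<open>With the keys outside \<open>fresh i c\<close> fixed, \<open>alt i x\<close> is a fixed
  set of fewer than \<open>G\<close> sequences, and \<open>row i c x\<close> determines the
  \<open>l - z\<close> fresh keys. So fewer than \<open>G\<close> completions qualify, out of at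
  least \<open>(U / 2) ^ (l - z)\<close>.\<close>

lemma card_sparse_choice:
  assumes i: "i < B" and c: "c \<in> choices i" and U: "4 * n \<le> U"
  defines "z \<equiv> card {j. j < l \<and> c j = 0}"
  shows "card {x \<in> Om. card (alt i x) < G \<and> row i c x \<in> alt i x} * U ^ (l - z) \<le> card Om * (G * 2 ^ l)"
proof -
  let ?X = "{x \<in> Om. card (alt i x) < G \<and> row i c x \<in> alt i x}"
  let ?R = "{..<2 * n} - fresh i c"
  let ?key = "\<lambda>x::nat \<Rightarrow> nat. restrict x ?R"
  have clt: "c j < B - i" if "j < l" for j using c that unfolding choices_def by auto
  have finX: "finite ?X" using finite_Om by simp
  have fsub: "fresh i c \<subseteq> {..<2 * n}"
    unfolding fresh_def using pos_lt_2n[of i] clt i by auto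
  have fge: "n + start (Suc i) \<le> p" if "p \<in> fresh i c" for p
  proof -
    from that obtain j where "p = n + start i + c j * l + j" "c j \<noteq> 0" unfolding fresh_def by blast
    then have "p \<ge> n + start i + 1 * l + j" using mult_le_mono1[of 1 "c j" l] by simp
    then show ?thesis by (simp add: start_Suc)
  qed
  have cf: "card (fresh i c) = l - z"
  proof -
    have "inj_on (\<lambda>j. n + start i + c j * l + j) {j. j < l \<and> c j \<noteq> 0}"
      using pos_inj by (intro inj_onI) blast
    then have "card (fresh i c) = card {j. j < l \<and> c j \<noteq> 0}" unfolding fresh_def by (rule card_image)
    also have "{j. j < l \<and> c j \<noteq> 0} = {..<l} - {j. j < l \<and> c j = 0}" by auto
    also have "card \<dots> = l - z" unfolding z_def by (subst card_Diff_subset) auto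
    finally show ?thesis .
  qed
  have zl: "l - z \<le> 2 * n" using cf card_mono[OF _ fsub] by simp
  have 4: "card ?X \<le> card (?key ` ?X) * G"
  proof (rule card_le_image_mult[OF finX])
    fix f assume "f \<in> ?key ` ?X"
    then obtain x0 where x0: "x0 \<in> ?X" "f = ?key x0" by blast
    have "card {x \<in> ?X. ?key x = f} \<le> card (alt i x0)"
    proof (rule card_inj_on_le[where f = "row i c"])
      have agr: "x p = x0 p" if "?key x = f" "p < 2 * n" "p \<notin> fresh i c" for x p
      proof -
        have "?key x p = ?key x0 p" using that(1) x0(2) by simp
        then show ?thesis using that(2,3) by simp
      qed
      have alteq: "alt i x = alt i x0" if "?key x = f" for x
      proof (rule Alt_cong)
        show "start (Suc i) \<le> n" using i by (intro start_le) simp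
        then show "x p = x0 p" if "p < n + start (Suc i)" for p
          using agr[OF \<open>?key x = f\<close>, of p] fge[of p] that by fastforce
      qed (simp add: start_Suc)
      show "row i c ` {x \<in> ?X. ?key x = f} \<subseteq> alt i x0" using alteq by blast
      show "inj_on (row i c) {x \<in> ?X. ?key x = f}"
      proof (rule inj_onI)
        fix x y assume x: "x \<in> {x \<in> ?X. ?key x = f}" and y: "y \<in> {x \<in> ?X. ?key x = f}" and eq: "row i c x = row i c y"
        show "x = y"
        proof
          fix p
          consider "p \<in> fresh i c" | "p < 2 * n" "p \<notin> fresh i c" | "\<not> p < 2 * n" by blast
          then show "x p = y p"
          proof cases
            case 1
            then obtain j where j: "j < l" "p = n + start i + c j * l + j" unfolding fresh_def by blast
            have "row i c x j = row i c y j" using eq by simp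
            then show ?thesis using j by (simp add: row_def)
          next
            case 2
            then show ?thesis using agr[of x p] agr[of y p] x y by simp
          next
            case 3
            then have 3: "p \<notin> {..<2 * n}" by simp
            have ext: "x \<in> extensional {..<2 * n}" "y \<in> extensional {..<2 * n}" using x y by (auto simp: Om_def PiE_def)
            show ?thesis unfolding extensional_arb[OF ext(1) 3] extensional_arb[OF ext(2) 3] ..
          qed
        qed
      qed
    qed (rule finite_Alt)
    also have "\<dots> \<le> G" using x0 by simp
    finally show "card {x \<in> ?X. ?key x = f} \<le> G" .
  qed
  have "card (?key ` ?X) \<le> card {f \<in> ?R \<rightarrow>\<^sub>E {..<U}. inj_on f ?R}"
  proof (rule card_mono)
    show "finite {f \<in> ?R \<rightarrow>\<^sub>E {..<U}. inj_on f ?R}"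
      by (rule finite_subset[of _ "?R \<rightarrow>\<^sub>E {..<U}"], blast, rule finite_PiE) simp_all
    show "?key ` ?X \<subseteq> {f \<in> ?R \<rightarrow>\<^sub>E {..<U}. inj_on f ?R}"
    proof
      fix f assume "f \<in> ?key ` ?X"
      then obtain x where x: "x \<in> Om" "f = ?key x" by blast
      then have "inj_on x {..<2 * n}" "x \<in> {..<2 * n} \<rightarrow>\<^sub>E {..<U}" unfolding Om_def by blast+
      moreover have "?R \<subseteq> {..<2 * n}" by blast
      ultimately have "inj_on x ?R" "\<And>p. p \<in> ?R \<Longrightarrow> x p \<in> {..<U}"
        by (meson inj_on_subset, meson PiE_mem subsetD)
      then show "f \<in> {f \<in> ?R \<rightarrow>\<^sub>E {..<U}. inj_on f ?R}" unfolding x(2) by (simp add: inj_on_restrict_eq)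
    qed
  qed
  also have "\<dots> = ff U (2 * n - (l - z))"
    using card_inj_funcset[of ?R "{..<U}"] fsub cf
    by (simp add: card_Diff_subset finite_subset[OF fsub])
  finally have 1: "card ?X \<le> ff U (2 * n - (l - z)) * G"
    using 4 by (meson mult_le_mono1 order_trans)
  have "ff U (2 * n) = ff U (2 * n - (l - z) + (l - z))" using zl by simp
  also have "\<dots> = ff U (2 * n - (l - z)) * ff (U - (2 * n - (l - z))) (l - z)" by (rule ff_add)
  finally have 2: "card Om = ff U (2 * n - (l - z)) * ff (U - (2 * n - (l - z))) (l - z)" by (simp add: card_Om)
  \<comment> \<open>By \<open>4 * n \<le> U\<close>, half of the universe stays available to each
    fresh key.\<close>
  have "U ^ (l - z) \<le> (2 * (U - (2 * n - (l - z)) - (l - z))) ^ (l - z)"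
    using U zl by (intro power_mono) simp_all
  also have "\<dots> = 2 ^ (l - z) * (U - (2 * n - (l - z)) - (l - z)) ^ (l - z)" by (rule power_mult_distrib)
  also have "\<dots> \<le> 2 ^ l * ff (U - (2 * n - (l - z))) (l - z)"
    by (intro mult_le_mono ff_ge power_increasing) simp_all
  finally have 3: "U ^ (l - z) \<le> 2 ^ l * ff (U - (2 * n - (l - z))) (l - z)" .
  have "card ?X * U ^ (l - z) \<le> (ff U (2 * n - (l - z)) * G) * (2 ^ l * ff (U - (2 * n - (l - z))) (l - z))"
    by (rule mult_le_mono[OF 1 3])
  also have "\<dots> = card Om * (G * 2 ^ l)" unfolding 2 by (simp only: mult_ac)
  finally show ?thesis .
qed

text \<open>A zero entry picks the key that the child already has, so a choice with many zeros may
  be close for no reason. For a fixed set of at least \<open>d\<close> zero columns, at most one in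
  \<open>(B - i) ^ d\<close> choices remains, and there are at most \<open>2 ^ l\<close> such
  sets.\<close>

lemma card_many_zeros:
  assumes "i < B"
  shows "card {c \<in> choices i. d \<le> card {j. j < l \<and> c j = 0}} * (B - i) ^ d \<le> 2 ^ l * (B - i) ^ l"
proof -
  let ?m = "B - i"
  let ?Zs = "{Z. Z \<subseteq> {..<l} \<and> d \<le> card Z}"
  let ?C = "\<lambda>Z. (\<Pi>\<^sub>E j\<in>{..<l}. if j \<in> Z then {0::nat} else {..<?m})"
  have finZ: "finite ?Zs" by (rule finite_subset[of _ "Pow {..<l}"]) auto
  have "{c \<in> choices i. d \<le> card {j. j < l \<and> c j = 0}} \<subseteq> (\<Union>Z\<in>?Zs. ?C Z)"
  proof
    fix c assume c: "c \<in> {c \<in> choices i. d \<le> card {j. j < l \<and> c j = 0}}"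
    then have "{j. j < l \<and> c j = 0} \<in> ?Zs" by auto
    moreover have "c \<in> ?C {j. j < l \<and> c j = 0}" using c by (auto simp: choices_def PiE_def Pi_def)
    ultimately show "c \<in> (\<Union>Z\<in>?Zs. ?C Z)" by blast
  qed
  then have "card {c \<in> choices i. d \<le> card {j. j < l \<and> c j = 0}} \<le> card (\<Union>Z\<in>?Zs. ?C Z)"
    by (rule card_mono[rotated]) (use finZ in \<open>auto intro!: finite_PiE\<close>)
  also have "\<dots> \<le> (\<Sum>Z\<in>?Zs. card (?C Z))" by (rule card_UN_le[OF finZ])
  finally have "card {c \<in> choices i. d \<le> card {j. j < l \<and> c j = 0}} * ?m ^ d \<le> (\<Sum>Z\<in>?Zs. card (?C Z)) * ?m ^ d"
    by (rule mult_le_mono1)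
  also have "\<dots> = (\<Sum>Z\<in>?Zs. card (?C Z) * ?m ^ d)" by (rule sum_distrib_right)
  also have "\<dots> \<le> (\<Sum>Z\<in>?Zs. ?m ^ l)"
  proof (rule sum_mono)
    fix Z assume Z: "Z \<in> ?Zs"
    then have finZ: "finite Z" "card Z \<le> l" using finite_subset[of Z "{..<l}"] card_mono[of "{..<l}" Z] by auto
    have "card (?C Z) = (\<Prod>j\<in>{..<l}. if j \<in> Z then 1 else ?m)"
      by (subst card_PiE) (auto intro!: prod.cong)
    also have "\<dots> = ?m ^ card ({..<l} - Z)"
      by (subst prod.If_cases) (simp_all add: Diff_eq)
    also have "card ({..<l} - Z) = l - card Z" using Z finZ by (subst card_Diff_subset) auto
    finally have "card (?C Z) * ?m ^ d = ?m ^ (l - card Z + d)" by (simp add: power_add)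
    also have "\<dots> \<le> ?m ^ l" using assms Z finZ by (intro power_increasing) auto
    finally show "card (?C Z) * ?m ^ d \<le> ?m ^ l" .
  qed
  also have "\<dots> = card ?Zs * ?m ^ l" by simp
  also have "\<dots> \<le> 2 ^ l * ?m ^ l"
  proof -
    have "card ?Zs \<le> card (Pow {..<l})" by (rule card_mono) auto
    then show ?thesis by (simp add: card_Pow)
  qed
  finally show ?thesis .
qed

end

text \<open>This is \<open>card_fiber\<close> for an empty child: its deletion sequence is
  \<open>undefined\<close> everywhere, so that only the current set distinguishes the
  fibers.\<close>

lemma (in dyn_dict) card_cur_fiber:
  assumes "T \<le> n" "n \<le> U"
  shows "card {x \<in> Om. cur x T = Q} * (U choose n) \<le> card Om"
proof -
  have "dels T T x = (\<lambda>_. undefined)" for x by (simp add: dels_def fun_eq_iff)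
  then have "{x \<in> Om. cur x T = Q} = {x \<in> Om. (cur x T, dels T T x) = (Q, \<lambda>_. undefined)}" by simp
  then have "card {x \<in> Om. cur x T = Q} \<le> fact n * ff (U - n) n"
    using card_fiber[of T T "(Q, \<lambda>_. undefined)"] assms by simp
  then have "card {x \<in> Om. cur x T = Q} * (U choose n) \<le> fact n * ff (U - n) n * (U choose n)" by (rule mult_le_mono1)
  also have "\<dots> = card Om" using fiber_card_Om[of 0] assms by (simp add: ff_def mult_ac)
  finally show ?thesis .
qed

context node
begin

text \<open>A first moment argument over the choices \<open>c\<close>: those with at least
  \<open>d\<close> zeros are few by \<open>card_many_zeros\<close>, and each of the others is close
  for few samples by \<open>card_sparse_choice\<close>.\<close>

lemma card_not_nice:
  assumes i: "i < B" and U: "4 * n \<le> U" "B - i \<le> U" and dl: "2 * d \<le> l"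
  shows "card {x \<in> Om. card (alt i x) < U ^ (l - 2 * d) \<and> \<not> nice i x} * (B - i) ^ d \<le> card Om * (K * 2 ^ Suc l)"
proof -
  let ?m = "B - i"
  let ?G = "U ^ (l - 2 * d)"
  let ?S = "\<lambda>c. {x \<in> Om. card (alt i x) < ?G \<and> row i c x \<in> alt i x}"
  let ?z = "\<lambda>c::nat \<Rightarrow> nat. card {j. j < l \<and> c j = 0}"
  let ?Bad = "{x \<in> Om. card (alt i x) < ?G \<and> \<not> nice i x}"
  have U0: "0 < U" using i U(2) by linarith
  have m0: "0 < ?m" using i by simp
  have S1: "card (?S c) * ?m ^ d \<le> card Om * 2 ^ l" if c: "c \<in> choices i" "?z c < d" for c
  proof -
    \<comment> \<open>This is why alternatives count as many only from
      \<open>U ^ (l - 2 * d)\<close> on: fewer than \<open>d\<close> zeros leave a factor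
      \<open>U ^ d\<close> to spare, which pays for \<open>(B - i) ^ d\<close>.\<close>
    have "l - ?z c = (l - 2 * d) + (d + (d - ?z c))" using c(2) dl by simp
    then have e: "U ^ (l - ?z c) = ?G * (U ^ d * U ^ (d - ?z c))" by (metis power_add)
    have "?G * (card (?S c) * ?m ^ d) \<le> ?G * (card (?S c) * (U ^ d * U ^ (d - ?z c)))"
    proof -
      have "?m ^ d * 1 \<le> U ^ d * U ^ (d - ?z c)"
        using U0 U(2) by (intro mult_le_mono power_mono) simp_all
      then show ?thesis by (intro mult_le_mono2) simp
    qed
    also have "\<dots> = card (?S c) * U ^ (l - ?z c)" unfolding e by (simp only: mult_ac)
    also have "\<dots> \<le> card Om * (?G * 2 ^ l)" by (rule card_sparse_choice[OF i c(1) U(1)])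
    also have "\<dots> = ?G * (card Om * 2 ^ l)" by (simp only: mult_ac)
    finally show ?thesis using U0 by simp
  qed
  have "card ?Bad * ?m ^ l = (\<Sum>x\<in>?Bad. ?m ^ l)" by simp
  also have "\<dots> \<le> (\<Sum>x\<in>?Bad. K * card {c \<in> choices i. row i c x \<in> alt i x})"
  proof (rule sum_mono)
    fix x assume "x \<in> ?Bad"
    then have "?m ^ l \<le> card (alt i x \<inter> rows i x) * K" unfolding nice_def by simp
    also have "card (alt i x \<inter> rows i x) \<le> card ((\<lambda>c. row i c x) ` {c \<in> choices i. row i c x \<in> alt i x})"
      unfolding rows_eq by (rule card_mono) (use finite_choices in auto)
    also have "\<dots> \<le> card {c \<in> choices i. row i c x \<in> alt i x}" using finite_choices by (intro card_image_le) simp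
    finally show "?m ^ l \<le> K * card {c \<in> choices i. row i c x \<in> alt i x}" by (simp add: mult.commute)
  qed
  also have "\<dots> = K * (\<Sum>x\<in>?Bad. card {c \<in> choices i. row i c x \<in> alt i x})" by (simp add: sum_distrib_left)
  also have "(\<Sum>x\<in>?Bad. card {c \<in> choices i. row i c x \<in> alt i x})
      = (\<Sum>c\<in>choices i. card {x \<in> ?Bad. row i c x \<in> alt i x})"
    using finite_Om finite_choices by (intro sum_multicount_gen) auto
  also have "\<dots> \<le> (\<Sum>c\<in>choices i. card (?S c))"
    using finite_Om by (intro sum_mono card_mono) auto
  finally have 1: "card ?Bad * ?m ^ l \<le> K * (\<Sum>c\<in>choices i. card (?S c))" by simp
  have fin: "finite {c \<in> choices i. d \<le> ?z c}" "finite {c \<in> choices i. ?z c < d}" using finite_choices by simp_all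
  have "(\<Sum>c\<in>choices i. card (?S c)) * ?m ^ d = (\<Sum>c\<in>choices i. card (?S c) * ?m ^ d)" by (rule sum_distrib_right)
  also have "\<dots> = (\<Sum>c\<in>{c \<in> choices i. d \<le> ?z c}. card (?S c) * ?m ^ d) + (\<Sum>c\<in>{c \<in> choices i. ?z c < d}. card (?S c) * ?m ^ d)"
    using fin by (subst sum.union_disjoint[symmetric]) (auto intro!: sum.cong)
  also have "\<dots> \<le> (\<Sum>c\<in>{c \<in> choices i. d \<le> ?z c}. card Om * ?m ^ d) + (\<Sum>c\<in>{c \<in> choices i. ?z c < d}. card Om * 2 ^ l)"
  proof (intro add_mono sum_mono)
    fix c assume "c \<in> {c \<in> choices i. d \<le> ?z c}"
    show "card (?S c) * ?m ^ d \<le> card Om * ?m ^ d" using finite_Om by (intro mult_le_mono1 card_mono) auto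
  next
    fix c assume "c \<in> {c \<in> choices i. ?z c < d}"
    then show "card (?S c) * ?m ^ d \<le> card Om * 2 ^ l" using S1 by simp
  qed
  also have "\<dots> = card Om * (card {c \<in> choices i. d \<le> ?z c} * ?m ^ d) + card {c \<in> choices i. ?z c < d} * (card Om * 2 ^ l)"
    by simp
  also have "\<dots> \<le> card Om * (2 ^ l * ?m ^ l) + ?m ^ l * (card Om * 2 ^ l)"
  proof (intro add_mono mult_le_mono2 mult_le_mono1)
    show "card {c \<in> choices i. d \<le> ?z c} * ?m ^ d \<le> 2 ^ l * ?m ^ l" by (rule card_many_zeros[OF i])
    have "card {c \<in> choices i. ?z c < d} \<le> card (choices i)" using finite_choices by (intro card_mono) auto
    then show "card {c \<in> choices i. ?z c < d} \<le> ?m ^ l" unfolding card_choices .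
  qed
  finally have 2: "(\<Sum>c\<in>choices i. card (?S c)) * ?m ^ d \<le> card Om * (2 ^ Suc l) * ?m ^ l" by (simp add: mult_ac)
  have "(card ?Bad * ?m ^ d) * ?m ^ l = (card ?Bad * ?m ^ l) * ?m ^ d" by (simp only: mult_ac)
  also have "\<dots> \<le> (K * (\<Sum>c\<in>choices i. card (?S c))) * ?m ^ d" by (rule mult_le_mono1[OF 1])
  also have "\<dots> = K * ((\<Sum>c\<in>choices i. card (?S c)) * ?m ^ d)" by (simp only: mult_ac)
  also have "\<dots> \<le> K * (card Om * (2 ^ Suc l) * ?m ^ l)" by (rule mult_le_mono2[OF 2])
  also have "\<dots> = (card Om * (K * 2 ^ Suc l)) * ?m ^ l" by (simp only: mult_ac)
  finally show ?thesis using m0 by simp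
qed

subsection \<open>Rearranging columns\<close>

text \<open>In each column \<open>j\<close> the key of child \<open>i\<close>, in row 0, changes
  places with that in row \<open>c j\<close>. Thus the child receives \<open>row i c x\<close>, and
  as each \<open>c\<close> gives an involution, composing with it permutes
  \<open>Om\<close>.\<close>

definition col_swap :: "nat \<Rightarrow> (nat \<Rightarrow> nat) \<Rightarrow> nat \<Rightarrow> nat" where
  "col_swap i c p = (if n + start i \<le> p \<and> p < n + start B
     then let q = p - (n + start i); j = q mod l in n + start i + Transposition.transpose 0 (c j) (q div l) * l + j
     else p)"

lemma col_swap_outside: "p < n + start i \<or> n + start B \<le> p \<Longrightarrow> col_swap i c p = p"
  by (auto simp: col_swap_def)

lemma col_swap_pos:
  assumes "i \<le> B" "a < B - i" "j < l"
  shows "col_swap i c (n + start i + a * l + j) = n + start i + Transposition.transpose 0 (c j) a * l + j"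
proof -
  have "n + start i + a * l + j - (n + start i) = a * l + j" by simp
  moreover have "(a * l + j) mod l = j" "(a * l + j) div l = a" using assms(3) by simp_all
  ultimately show ?thesis using pos_less[OF assms] by (simp add: col_swap_def Let_def)
qed

lemma transpose_less:
  assumes "c \<in> choices i" "j < l" "a < B - i"
  shows "Transposition.transpose 0 (c j) a < B - i"
proof -
  have "c j \<in> {..<B - i}" using assms(1,2) unfolding choices_def by (meson PiE_mem lessThan_iff)
  moreover have "0 < B - i" using assms(3) by linarith
  ultimately show ?thesis using assms(3) unfolding Transposition.transpose_def lessThan_iff by presburger
qed

lemma pos_cases:
  assumes "i \<le> B" "n + start i \<le> p" "p < n + start B"
  obtains a j where "a < B - i" "j < l" "p = n + start i + a * l + j"
proof -
  let ?q = "p - (n + start i)"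
  have "n + start B = n + start i + (B - i) * l" using assms(1) by (simp add: start_def diff_mult_distrib)
  then have "?q < (B - i) * l" using assms(2,3) by linarith
  then have "?q div l < B - i" using l_pos by (simp add: div_less_iff_less_mult)
  moreover have "?q mod l < l" using l_pos by simp
  moreover have "p = n + start i + ?q div l * l + ?q mod l" using assms(2) by simp
  ultimately show ?thesis using that by blast
qed

lemma col_swap_invol:
  assumes "i \<le> B" "c \<in> choices i"
  shows "col_swap i c (col_swap i c p) = p"
proof (cases "n + start i \<le> p \<and> p < n + start B")
  case True
  then obtain a j where aj: "a < B - i" "j < l" "p = n + start i + a * l + j"
    using pos_cases[OF assms(1)] by blast
  show ?thesis unfolding aj(3)
    using col_swap_pos[OF assms(1) aj(1,2)] col_swap_pos[OF assms(1) transpose_less[OF assms(2) aj(2,1)] aj(2)]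
    by simp
next
  case False
  then show ?thesis by (simp add: col_swap_outside not_le not_less)
qed

lemma col_swap_range:
  assumes "i \<le> B" "c \<in> choices i" "n + start i \<le> p" "p < n + start B"
  shows "n + start i \<le> col_swap i c p" "col_swap i c p < n + start B"
proof -
  obtain a j where aj: "a < B - i" "j < l" "p = n + start i + a * l + j"
    using pos_cases[OF assms(1,3,4)] by blast
  show "n + start i \<le> col_swap i c p" unfolding aj(3) col_swap_pos[OF assms(1) aj(1,2)] by simp
  show "col_swap i c p < n + start B" unfolding aj(3) col_swap_pos[OF assms(1) aj(1,2)]
    by (rule pos_less[OF assms(1) transpose_less[OF assms(2) aj(2,1)] aj(2)])
qed

lemma col_swap_lt: 
  assumes "i \<le> B" "c \<in> choices i" "p < 2 * n"
  shows "col_swap i c p < 2 * n"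
proof (cases "n + start i \<le> p \<and> p < n + start B")
  case True
  then show ?thesis using col_swap_range(2)[OF assms(1,2), of p] start_le[of B] by simp
next
  case False
  then show ?thesis using assms(3) by (simp add: col_swap_outside not_le not_less)
qed

lemma comp_swap_Om:
  assumes i: "i \<le> B" and c: "c \<in> choices i" and x: "x \<in> Om"
  shows "x \<circ> col_swap i c \<in> Om"
proof -
  have 1: "inj_on x {..<2 * n}" "x \<in> {..<2 * n} \<rightarrow>\<^sub>E {..<U}" using x unfolding Om_def by blast+
  have "inj_on (x \<circ> col_swap i c) {..<2 * n}"
  proof (rule comp_inj_on)
    show "inj_on (col_swap i c) {..<2 * n}" by (rule inj_on_inverseI[of _ "col_swap i c"]) (rule col_swap_invol[OF i c])
    show "inj_on x (col_swap i c ` {..<2 * n})"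
      by (rule inj_on_subset[OF 1(1)]) (use col_swap_lt[OF i c] in auto)
  qed
  moreover have "x \<circ> col_swap i c \<in> {..<2 * n} \<rightarrow>\<^sub>E {..<U}"
  proof (rule PiE_I)
    fix p assume "p \<in> {..<2 * n}"
    then have "col_swap i c p \<in> {..<2 * n}" using col_swap_lt[OF i c] by simp
    then show "(x \<circ> col_swap i c) p \<in> {..<U}" using PiE_mem[OF 1(2)] by simp
  next
    fix p assume p: "p \<notin> {..<2 * n}"
    then have "col_swap i c p = p" using start_le[of B] by (intro col_swap_outside) auto
    then show "(x \<circ> col_swap i c) p = undefined" using PiE_arb[OF 1(2) p] by simp
  qed
  ultimately show ?thesis unfolding Om_def by blast
qed

lemma swap_image:
  assumes i: "i \<le> B" and c: "c \<in> choices i" and Q: "\<And>p. p \<in> Q \<Longrightarrow> col_swap i c p \<in> Q"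
  shows "(x \<circ> col_swap i c) ` Q = x ` Q"
proof -
  have "col_swap i c ` Q = Q"
  proof
    show "col_swap i c ` Q \<subseteq> Q" using Q by blast
    show "Q \<subseteq> col_swap i c ` Q"
    proof
      fix p assume "p \<in> Q"
      then show "p \<in> col_swap i c ` Q" using Q[of p] col_swap_invol[OF i c, of p] by (metis imageI)
    qed
  qed
  then show ?thesis by (metis image_comp)
qed

lemma swap_prefix: "p < n + start i \<Longrightarrow> (x \<circ> col_swap i c) p = x p"
  by (simp add: col_swap_outside)

lemma cur_swap:
  assumes i: "i \<le> B" and c: "c \<in> choices i"
  shows "cur (x \<circ> col_swap i c) (start B) = cur x (start B)"
proof -
  have "(x \<circ> col_swap i c) ` {start B..<n} = x ` {start B..<n}"
    by (rule image_cong) (simp_all add: col_swap_outside)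
  moreover have "(x \<circ> col_swap i c) ` {n..<n + start B} = x ` {n..<n + start B}"
  proof (rule swap_image[OF i c])
    fix p assume p: "p \<in> {n..<n + start B}"
    show "col_swap i c p \<in> {n..<n + start B}"
      using p col_swap_range[OF i c, of p] col_swap_outside[of p i c] by (cases "n + start i \<le> p") auto
  qed
  ultimately show ?thesis by (simp add: cur_def)
qed

text \<open>A column of an earlier child contains the corresponding column of child
  \<open>i\<close>, and the swap moves keys only within the latter. Taking columns as sets makes
  them blind to this.\<close>

lemma col_swap_same:
  assumes ki: "k \<le> i" "i \<le> B" and c: "c \<in> choices i" and j: "j < l"
  shows "col k j (x \<circ> col_swap i c) = col k j x"
proof -
  let ?Q = "(\<lambda>a. n + start k + a * l + j) ` {..<B - k}"
  have "(x \<circ> col_swap i c) ` ?Q = x ` ?Q"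
  proof (rule swap_image[OF ki(2) c])
    fix p assume "p \<in> ?Q"
    then obtain a where a: "a < B - k" "p = n + start k + a * l + j" by blast
    show "col_swap i c p \<in> ?Q"
    proof (cases "k + a < i")
      case True
      then have "(k + a + 1) * l \<le> i * l" by (intro mult_le_mono1) simp
      then have "p < n + start i" unfolding a(2) using j by (simp add: start_def algebra_simps)
      then have "col_swap i c p = p" by (simp add: col_swap_outside)
      then show ?thesis using \<open>p \<in> ?Q\<close> by simp
    next
      case False
      \<comment> \<open>Row \<open>a\<close> of child \<open>k\<close> is row
        \<open>k + a - i\<close> of child \<open>i\<close>.\<close>
      let ?a = "k + a - i"
      have e: "n + start i + b * l + j = n + start k + (i - k + b) * l + j" for b
      proof -
        have "i * l = k * l + (i - k) * l" using mult_le_mono1[OF ki(1), of l] by (simp add: diff_mult_distrib)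
        then show ?thesis by (simp add: start_def add_mult_distrib)
      qed
      have p: "p = n + start i + ?a * l + j" unfolding a(2) e using False ki(1) by simp
      have la: "?a < B - i" using a(1) False ki by simp
      have "col_swap i c p = n + start i + Transposition.transpose 0 (c j) ?a * l + j"
        unfolding p by (rule col_swap_pos[OF ki(2) la j])
      then have "col_swap i c p = n + start k + (i - k + Transposition.transpose 0 (c j) ?a) * l + j"
        unfolding e .
      moreover have "i - k + Transposition.transpose 0 (c j) ?a < B - k"
        using transpose_less[OF c j la] ki by simp
      ultimately show ?thesis by blast
    qed
  qed
  then show ?thesis by (simp add: col_def image_image)
qed

lemma rows_swap:
  assumes "k \<le> i" "i \<le> B" "c \<in> choices i"
  shows "rows k (x \<circ> col_swap i c) = rows k x"
  unfolding rows_def by (rule PiE_cong) (use col_swap_same[OF assms] in simp)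

text \<open>Everything in \<open>good k\<close> but the columns depends on keys before child
  \<open>i\<close>. So the goodness of earlier children survives averaging over the swaps of child
  \<open>i\<close>; this takes the place of independence.\<close>

lemma good_swap:
  assumes ki: "k < i" "i \<le> B" and c: "c \<in> choices i"
  shows "good k M (x \<circ> col_swap i c) = good k M x"
proof -
  have le: "start (Suc k) \<le> start i" using ki by (intro start_mono) simp
  have n: "start (Suc k) \<le> n" using ki by (intro start_le) simp
  have eq: "(x \<circ> col_swap i c) p = x p" if "p < n + start (Suc k)" for p
    using that le by (intro swap_prefix) simp
  have "alt k (x \<circ> col_swap i c) = alt k x" by (rule Alt_cong[OF _ n eq]) (simp_all add: start_Suc)
  moreover have "rows k (x \<circ> col_swap i c) = rows k x" using ki c by (intro rows_swap) simp_all
  moreover have "Mem (x \<circ> col_swap i c) (start (Suc k)) = Mem x (start (Suc k))" by (rule Mem_cong[OF eq n])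
  moreover have "Tch (x \<circ> col_swap i c) (start k) (start (Suc k)) = Tch x (start k) (start (Suc k))"
    by (rule Tch_cong[OF eq n]) (simp_all add: start_Suc)
  ultimately show ?thesis by (simp add: good_def nice_def)
qed

text \<open>The triangle inequality through \<open>M\<close>: where two final contents differ in a
  common cell, one of them differs from \<open>M\<close>. The two allowances of \<open>d\<close>
  cells add up to the radius \<open>2 * d\<close> in \<open>alt\<close>.\<close>

lemma good_clique:
  assumes i: "i < B" and x: "x \<in> Om" and c0: "c0 \<in> choices i" "good i M (x \<circ> col_swap i c0)"
    and c: "c \<in> choices i" "good i M (x \<circ> col_swap i c)"
  shows "row i c x \<in> alt i (x \<circ> col_swap i c0) \<inter> rows i (x \<circ> col_swap i c0)"
proof -
  let ?x0 = "x \<circ> col_swap i c0" and ?x1 = "x \<circ> col_swap i c"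
  let ?s = "start i" and ?t = "start (Suc i)"
  let ?y = "ov ?s ?t ?x0 (row i c x)"
  have iB: "i \<le> B" "Suc i \<le> B" using i by simp_all
  have tn: "?t \<le> n" by (rule start_le[OF iB(2)])
  have x1: "?x1 \<in> Om" by (rule comp_swap_Om[OF iB(1) c(1) x])
  \<comment> \<open>Overwriting and swapping give the same keys up to the end of the child only;
    later on, \<open>?y\<close> may repeat keys instead of exchanging them.\<close>
  have eq: "?y p = ?x1 p" if "p < n + ?t" for p
  proof (cases "p < n + ?s")
    case True
    then show ?thesis by (simp add: ov_def col_swap_outside)
  next
    case False
    define j where "j = p - (n + ?s)"
    have j: "j < l" "p = n + ?s + 0 * l + j" using False that by (auto simp: j_def start_Suc)
    have "?y p = row i c x j" using False that by (simp add: ov_def j_def)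
    also have "\<dots> = x (n + ?s + c j * l + j)" using j(1) by (simp add: row_def)
    also have "\<dots> = ?x1 p" unfolding j(2) using col_swap_pos[OF iB(1) _ j(1), of 0 c] i by simp
    finally show ?thesis .
  qed
  have vy: "valid ?y ?t"
  proof -
    have "inj_on ?y {..<n + ?t} = inj_on ?x1 {..<n + ?t}" using eq by (intro inj_on_cong) simp
    moreover have "?y ` {..<n + ?t} = ?x1 ` {..<n + ?t}" using eq by (intro image_cong) simp_all
    ultimately show ?thesis using valid_Om[OF x1 tn] by (simp add: valid_def)
  qed
  have My: "Mem ?y ?t = Mem ?x1 ?t" by (rule Mem_cong[OF eq tn])
  have Ty: "Tch ?y ?s ?t = Tch ?x1 ?s ?t" by (rule Tch_cong[OF eq tn]) (simp_all add: start_Suc)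
  have "near ?s ?t (2 * d) ?x0 ?y"
  proof -
    let ?E = "\<lambda>z. {e \<in> Tch z ?s ?t. Mem z ?t e \<noteq> M e}"
    have "{e \<in> Tch ?x0 ?s ?t \<inter> Tch ?y ?s ?t. Mem ?x0 ?t e \<noteq> Mem ?y ?t e} \<subseteq> ?E ?x0 \<union> ?E ?x1"
      unfolding My Ty by auto
    then have "card {e \<in> Tch ?x0 ?s ?t \<inter> Tch ?y ?s ?t. Mem ?x0 ?t e \<noteq> Mem ?y ?t e} \<le> card (?E ?x0 \<union> ?E ?x1)"
      by (rule card_mono[rotated]) simp
    also have "\<dots> \<le> card (?E ?x0) + card (?E ?x1)" by (rule card_Un_le)
    also have "\<dots> \<le> 2 * d" using c0(2) c(2) unfolding good_def by simp
    finally show ?thesis by (simp add: near_def)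
  qed
  moreover have "row i c x \<in> {..<?t - ?s} \<rightarrow>\<^sub>E {..<U}"
  proof -
    have "x (n + start i + c j * l + j) < U" if "j < l" for j
    proof -
      have "c j < B - i" using c(1) that unfolding choices_def by auto
      then have "n + start i + c j * l + j \<in> {..<2 * n}" using pos_lt_2n[OF iB(1)] that by simp
      then show ?thesis using x unfolding Om_def by blast
    qed
    then show ?thesis by (simp add: row_def start_Suc)
  qed
  ultimately have "row i c x \<in> alt i ?x0" using vy by (simp add: Alt_def)
  moreover have "row i c x \<in> rows i ?x0"
    using row_in_rows[OF c(1), of x] rows_swap[OF order_refl iB(1) c0(1), of x] by simp
  ultimately show ?thesis by blast
qed

text \<open>Double counting of pairs of a sample and a swap. For a fixed sample, all swaps that make
  child \<open>i\<close> good give rows close to any one of them, by \<open>good_clique\<close>, so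
  the niceness of that one bounds their number.\<close>

lemma card_good_step:
  assumes i: "i < B" and X: "X \<subseteq> Om" and inv: "\<And>x c. x \<in> X \<Longrightarrow> c \<in> choices i \<Longrightarrow> x \<circ> col_swap i c \<in> X"
  shows "card {x \<in> X. good i M x} * K \<le> card X"
proof -
  let ?m = "B - i"
  have iB: "i \<le> B" using i by simp
  have finX: "finite X" by (rule finite_subset[OF X finite_Om])
  have 1: "card {x \<in> X. good i M (x \<circ> col_swap i c)} = card {x \<in> X. good i M x}" if c: "c \<in> choices i" for c
  proof (rule bij_betw_same_card)
    have ii: "x \<circ> col_swap i c \<circ> col_swap i c = x" for x :: "nat \<Rightarrow> nat"
      using col_swap_invol[OF iB c] by (simp add: fun_eq_iff)
    show "bij_betw (\<lambda>x. x \<circ> col_swap i c) {x \<in> X. good i M (x \<circ> col_swap i c)} {x \<in> X. good i M x}"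
    proof (rule bij_betwI[where g = "\<lambda>x. x \<circ> col_swap i c"])
      show "(\<lambda>x. x \<circ> col_swap i c) \<in> {x \<in> X. good i M (x \<circ> col_swap i c)} \<rightarrow> {x \<in> X. good i M x}"
        using inv[OF _ c] by blast
      show "(\<lambda>x. x \<circ> col_swap i c) \<in> {x \<in> X. good i M x} \<rightarrow> {x \<in> X. good i M (x \<circ> col_swap i c)}"
        using inv[OF _ c] ii by (intro Pi_I) simp
    qed (rule ii)+
  qed
  have 2: "card {c \<in> choices i. good i M (x \<circ> col_swap i c)} * K \<le> ?m ^ l" if x: "x \<in> X" for x
  proof (cases "{c \<in> choices i. good i M (x \<circ> col_swap i c)} = {}")
    case False
    then obtain c0 where c0: "c0 \<in> choices i" "good i M (x \<circ> col_swap i c0)" by blast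
    let ?x0 = "x \<circ> col_swap i c0"
    have xO: "x \<in> Om" using x X by blast
    have "card {c \<in> choices i. good i M (x \<circ> col_swap i c)} \<le> card (alt i ?x0 \<inter> rows i ?x0)"
    proof (rule card_inj_on_le[where f = "\<lambda>c. row i c x"])
      show "inj_on (\<lambda>c. row i c x) {c \<in> choices i. good i M (x \<circ> col_swap i c)}"
        by (rule inj_on_subset[OF row_inj[OF xO iB]]) blast
      show "(\<lambda>c. row i c x) ` {c \<in> choices i. good i M (x \<circ> col_swap i c)} \<subseteq> alt i ?x0 \<inter> rows i ?x0"
        using good_clique[OF i xO c0] by blast
      show "finite (alt i ?x0 \<inter> rows i ?x0)" using finite_Alt by simp
    qed
    then have "card {c \<in> choices i. good i M (x \<circ> col_swap i c)} * K \<le> card (alt i ?x0 \<inter> rows i ?x0) * K"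
      by (rule mult_le_mono1)
    also have "\<dots> \<le> ?m ^ l" using c0(2) unfolding good_def nice_def by simp
    finally show ?thesis .
  next
    case True
    show ?thesis unfolding True by simp
  qed
  have "?m ^ l * (card {x \<in> X. good i M x} * K) = (\<Sum>c\<in>choices i. card {x \<in> X. good i M (x \<circ> col_swap i c)}) * K"
    using 1 by (simp add: card_choices)
  also have "(\<Sum>c\<in>choices i. card {x \<in> X. good i M (x \<circ> col_swap i c)})
      = (\<Sum>x\<in>X. card {c \<in> choices i. good i M (x \<circ> col_swap i c)})"
    using finX finite_choices by (intro sum_multicount_gen[symmetric]) auto
  also have "\<dots> * K = (\<Sum>x\<in>X. card {c \<in> choices i. good i M (x \<circ> col_swap i c)} * K)" by (rule sum_distrib_right)
  also have "\<dots> \<le> (\<Sum>x\<in>X. ?m ^ l)" by (intro sum_mono 2)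
  also have "\<dots> = ?m ^ l * card X" by simp
  finally show ?thesis using i by simp
qed

text \<open>The children in \<open>I\<close> are removed from the last to the first: swapping at the
  last one leaves the current set and the goodness of the earlier ones intact, so each contributes a
  factor \<open>K\<close>.\<close>

lemma card_good_pattern:
  assumes "k \<le> B" "I \<subseteq> {..<k}"
  shows "card {x \<in> Om. cur x (start B) = Q \<and> (\<forall>i\<in>I. good i M x)} * K ^ card I
    \<le> card {x \<in> Om. cur x (start B) = Q}"
  using assms
proof (induction k arbitrary: I)
  case (Suc k)
  let ?X = "\<lambda>I. {x \<in> Om. cur x (start B) = Q \<and> (\<forall>i\<in>I. good i M x)}"
  have finI: "finite I" using Suc.prems(2) by (rule finite_subset) simp
  show ?case
  proof (cases "k \<in> I")
    case True
    let ?J = "I - {k}"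
    have J: "?J \<subseteq> {..<k}" using Suc.prems(2) by auto
    have "?X I = {x \<in> ?X ?J. good k M x}" using True by auto
    moreover have "card {x \<in> ?X ?J. good k M x} * K \<le> card (?X ?J)"
    proof (rule card_good_step)
      show "k < B" using Suc.prems(1) by simp
      show "?X ?J \<subseteq> Om" by blast
      fix x c assume x: "x \<in> ?X ?J" and c: "c \<in> choices k"
      have kB: "k \<le> B" using Suc.prems(1) by simp
      have "good i M (x \<circ> col_swap k c)" if "i \<in> ?J" for i
        using good_swap[OF _ kB c, of i M x] J that x by blast
      moreover have "x \<circ> col_swap k c \<in> Om" using comp_swap_Om[OF kB c] x by blast
      moreover have "cur (x \<circ> col_swap k c) (start B) = Q" using cur_swap[OF kB c, of x] x by simp
      ultimately show "x \<circ> col_swap k c \<in> ?X ?J" by blast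
    qed
    ultimately have 1: "card (?X I) * K \<le> card (?X ?J)" by simp
    have "card I = Suc (card ?J)" using finI True by (metis card.remove)
    then have "card (?X I) * K ^ card I = (card (?X I) * K) * K ^ card ?J" by (simp add: mult_ac)
    also have "\<dots> \<le> card (?X ?J) * K ^ card ?J" by (rule mult_le_mono1[OF 1])
    also have "\<dots> \<le> card {x \<in> Om. cur x (start B) = Q}" using Suc.IH[of ?J] Suc.prems(1) J by simp
    finally show ?thesis .
  next
    case False
    then have "I \<subseteq> {..<k}" using Suc.prems(2) by (auto simp: less_Suc_eq)
    then show ?thesis using Suc.IH[of I] Suc.prems(1) by simp
  qed
qed simp

text \<open>A union bound over the final memory and a set of \<open>b\<close> good children. The
  memory also fixes the current set, which regains \<open>U choose n\<close> from the
  \<open>(2 ^ w) ^ S\<close> memories; so \<open>K ^ b\<close> has to beat only the redundancy and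
  \<open>2 ^ k\<close>.\<close>

lemma card_many_good:
  assumes kB: "k \<le> B" and nU: "n \<le> U"
  shows "card {x \<in> Om. b \<le> card {i. i < k \<and> good i (Mem x (start B)) x}} * K ^ b * (U choose n)
    \<le> (2 ^ w) ^ S * 2 ^ k * card Om"
proof -
  let ?Ms = "{m. mem_ok S (2 ^ w) (init_mem D) m}"
  let ?Is = "{I. I \<subseteq> {..<k} \<and> card I = b}"
  let ?X = "\<lambda>(M, I). {x \<in> Om. cur x (start B) = dec M \<and> (\<forall>i\<in>I. good i M x)}"
  let ?L = "{x \<in> Om. b \<le> card {i. i < k \<and> good i (Mem x (start B)) x}}"
  have finM: "finite ?Ms" "card ?Ms = (2 ^ w) ^ S" using card_mem_ok[of S "2 ^ w" "init_mem D"] by auto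
  have finI: "finite ?Is" by (rule finite_subset[of _ "Pow {..<k}"]) auto
  have fin: "finite (?Ms \<times> ?Is)" using finM(1) finI by (rule finite_cartesian_product)
  have TB: "start B \<le> n" by (rule start_le) simp
  have "?L \<subseteq> (\<Union>z\<in>?Ms \<times> ?Is. ?X z)"
  proof
    fix x assume x: "x \<in> ?L"
    let ?M = "Mem x (start B)"
    from x have "b \<le> card {i. i < k \<and> good i ?M x}" by simp
    then obtain I where I: "I \<subseteq> {i. i < k \<and> good i ?M x}" "card I = b"
      by (meson obtain_subset_with_card_n)
    have "x \<in> ?X (?M, I)" using x I(1) dec_Mem[OF valid_Om[OF _ TB] TB, of x] by auto
    moreover have "(?M, I) \<in> ?Ms \<times> ?Is" using I Mem_ok by auto
    ultimately show "x \<in> (\<Union>z\<in>?Ms \<times> ?Is. ?X z)" by blast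
  qed
  then have "card ?L \<le> card (\<Union>z\<in>?Ms \<times> ?Is. ?X z)"
    by (rule card_mono[rotated]) (use fin finite_Om in auto)
  also have "\<dots> \<le> (\<Sum>z\<in>?Ms \<times> ?Is. card (?X z))" by (rule card_UN_le[OF fin])
  finally have "card ?L * (K ^ b * (U choose n)) \<le> (\<Sum>z\<in>?Ms \<times> ?Is. card (?X z)) * (K ^ b * (U choose n))"
    by (rule mult_le_mono1)
  also have "\<dots> = (\<Sum>z\<in>?Ms \<times> ?Is. card (?X z) * K ^ b * (U choose n))"
    by (simp only: sum_distrib_right mult.assoc)
  also have "\<dots> \<le> (\<Sum>z\<in>?Ms \<times> ?Is. card Om)"
  proof (rule sum_mono)
    fix z assume z: "z \<in> ?Ms \<times> ?Is"
    obtain M I where zz: "z = (M, I)" by (cases z)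
    have I: "I \<subseteq> {..<k}" "card I = b" using z unfolding zz by auto
    have "card (?X z) * K ^ b \<le> card {x \<in> Om. cur x (start B) = dec M}"
      using card_good_pattern[OF kB I(1), of "dec M" M] unfolding zz I(2) by simp
    then have "card (?X z) * K ^ b * (U choose n) \<le> card {x \<in> Om. cur x (start B) = dec M} * (U choose n)"
      by (rule mult_le_mono1)
    also have "\<dots> \<le> card Om" by (rule card_cur_fiber[OF TB nU])
    finally show "card (?X z) * K ^ b * (U choose n) \<le> card Om" .
  qed
  also have "\<dots> = (2 ^ w) ^ S * card ?Is * card Om" using finM(2) by (simp add: card_cartesian_product)
  also have "\<dots> \<le> (2 ^ w) ^ S * 2 ^ k * card Om"
  proof -
    have "card ?Is \<le> card (Pow {..<k})" by (rule card_mono) auto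
    then show ?thesis by (simp add: card_Pow)
  qed
  finally show ?thesis by (simp only: mult_ac)
qed

end

section \<open>Cells touched again within a node\<close>

lemma (in dyn_dict) card_dense:
  assumes st: "s \<le> t" "t \<le> n" and nU: "n \<le> U" and U0: "0 < U"
    and H: "8 * ((2 ^ w) ^ S * (2 ^ S * (2 ^ S * (2 ^ S * (2 ^ w) ^ h * U ^ (t - s)))) * n ^ (t - s))
      \<le> G * ((U choose n) * ff (U - n) (t - s))"
  shows "card {x \<in> Om. G \<le> card (Alt s t h x)} * 8 \<le> card Om"
proof -
  let ?C = "(2 ^ w) ^ S * (2 ^ S * (2 ^ S * (2 ^ S * (2 ^ w) ^ h * U ^ (t - s)))) * n ^ (t - s)"
  let ?c = "card {x \<in> Om. G \<le> card (Alt s t h x)}"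
  show ?thesis
  proof (cases "?C = 0")
    case True
    then have n0: "n = 0" "0 < t - s" using U0 by (simp_all add: power_eq_0_iff)
    then show ?thesis using st by simp
  next
    case False
    have "(?c * 8) * ?C = ?c * (8 * ?C)" by (simp only: mult_ac)
    also have "\<dots> \<le> ?c * (G * ((U choose n) * ff (U - n) (t - s)))" by (rule mult_le_mono2[OF H])
    also have "\<dots> = ?c * G * ((U choose n) * ff (U - n) (t - s))" by (simp only: mult_ac)
    also have "\<dots> \<le> card Om * ?C" by (rule card_many_alt[OF st nU])
    finally have "(?c * 8) * ?C \<le> card Om * ?C" .
    then show ?thesis using False mult_le_cancel2 by blast
  qed
qed

definition (in dyn_dict) again :: "(nat \<Rightarrow> nat) \<Rightarrow> nat \<Rightarrow> nat \<Rightarrow> nat \<Rightarrow> nat set" where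
  "again x p q r = Tch x p q \<inter> Tch x q r"

context node
begin

text \<open>Each of the first \<open>k\<close> children has more than \<open>d\<close> of its cells
  changed later, or has many alternatives, or is not nice, or is good. On average the last three
  kinds make up at most 1/8, 1/8 and 2/8 of the \<open>k\<close> children. A cell whose contents
  change must be touched again.\<close>

lemma node_bound:
  assumes B: "B = 2 * k" and k0: "0 < k" and U: "4 * n \<le> U" "B \<le> U" "n \<le> U" and dl: "2 * d \<le> l"
    and H1: "8 * ((2 ^ w) ^ S * (2 ^ S * (2 ^ S * (2 ^ S * (2 ^ w) ^ (2 * d) * U ^ l))) * n ^ l)
      \<le> U ^ (l - 2 * d) * ((U choose n) * ff (U - n) l)"
    and H2: "8 * (K * 2 ^ Suc l) \<le> k ^ d"
    and H3: "8 * ((2 ^ w) ^ S * 2 ^ k) \<le> K ^ b * (U choose n)"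
    and H4: "8 * b \<le> k"
  shows "d * k * card Om \<le> 2 * (\<Sum>x\<in>Om. \<Sum>i<k. card (again x (start i) (start (Suc i)) (start B)))"
proof -
  let ?G = "U ^ (l - 2 * d)"
  let ?M = "\<lambda>x. Mem x (start B)"
  let ?Z = "\<lambda>i x. {e \<in> Tch x (start i) (start (Suc i)). Mem x (start (Suc i)) e \<noteq> ?M x e}"
  let ?big = "\<lambda>x. {i. i < k \<and> d < card (?Z i x)}"
  let ?dense = "\<lambda>i. {x \<in> Om. ?G \<le> card (alt i x)}"
  let ?bad = "\<lambda>i. {x \<in> Om. card (alt i x) < ?G \<and> \<not> nice i x}"
  let ?good = "\<lambda>x. {i. i < k \<and> good i (?M x) x}"
  let ?many = "{x \<in> Om. b \<le> card (?good x)}"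
  have U0: "0 < U" using U(2) B k0 by simp
  have iB: "i < B" if "i < k" for i using that B by simp
  have dense: "card (?dense i) * 8 \<le> card Om" if i: "i < k" for i
  proof -
    have eq: "start (Suc i) - start i = l" by (simp add: start_Suc)
    show ?thesis
      by (rule card_dense[OF _ _ U(3) U0]) (use H1 start_le[of "Suc i"] iB[OF i] in \<open>simp_all add: eq start_Suc\<close>)
  qed
  have bad: "card (?bad i) * 8 \<le> card Om" if i: "i < k" for i
  proof -
    \<comment> \<open>Here the restriction to the first half of the children enters: each still has
      \<open>k\<close> rows to choose from.\<close>
    have m: "k \<le> B - i" using i B by simp
    have "(card (?bad i) * 8) * (K * 2 ^ Suc l) = card (?bad i) * (8 * (K * 2 ^ Suc l))" by (simp only: mult_ac)
    also have "\<dots> \<le> card (?bad i) * (B - i) ^ d"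
      using H2 power_mono[OF m, of d] by (intro mult_le_mono2) simp
    also have "\<dots> \<le> card Om * (K * 2 ^ Suc l)"
      using U(2) by (intro card_not_nice[OF iB[OF i] U(1) _ dl]) simp
    finally have *: "(card (?bad i) * 8) * (K * 2 ^ Suc l) \<le> card Om * (K * 2 ^ Suc l)" .
    show ?thesis
    proof (cases "K = 0")
      case True
      then have "nice i x" for x unfolding nice_def using True by simp
      then show ?thesis by simp
    next
      case False
      then have "K * 2 ^ Suc l \<noteq> 0" by simp
      then show ?thesis using * mult_le_cancel2 by blast
    qed
  qed
  have many: "card ?many * 8 \<le> card Om"
  proof -
    have kB: "k \<le> B" using B by simp
    have "(card ?many * 8) * ((2 ^ w) ^ S * 2 ^ k) = card ?many * (8 * ((2 ^ w) ^ S * 2 ^ k))" by (simp only: mult_ac)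
    also have "\<dots> \<le> card ?many * (K ^ b * (U choose n))" by (rule mult_le_mono2[OF H3])
    also have "\<dots> = card ?many * K ^ b * (U choose n)" by (simp only: mult_ac)
    also have "\<dots> \<le> (2 ^ w) ^ S * 2 ^ k * card Om" by (rule card_many_good[OF kB U(3)])
    finally have "(card ?many * 8) * ((2 ^ w) ^ S * 2 ^ k) \<le> card Om * ((2 ^ w) ^ S * 2 ^ k)" by (simp only: mult_ac)
    moreover have "(2 ^ w) ^ S * 2 ^ k \<noteq> (0::nat)" by simp
    ultimately show ?thesis using mult_le_cancel2 by blast
  qed
  have split: "k \<le> card (?big x) + card {i. i < k \<and> x \<in> ?dense i} + card {i. i < k \<and> x \<in> ?bad i} + card (?good x)"
    if x: "x \<in> Om" for x
  proof -
    have "{..<k} \<subseteq> ((?big x \<union> {i. i < k \<and> x \<in> ?dense i}) \<union> {i. i < k \<and> x \<in> ?bad i}) \<union> ?good x"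
      using x unfolding good_def by (auto simp: not_le not_less)
    then have "card {..<k} \<le> card (((?big x \<union> {i. i < k \<and> x \<in> ?dense i}) \<union> {i. i < k \<and> x \<in> ?bad i}) \<union> ?good x)"
      by (rule card_mono[rotated]) simp
    also have "\<dots> \<le> card (?big x) + card {i. i < k \<and> x \<in> ?dense i} + card {i. i < k \<and> x \<in> ?bad i} + card (?good x)"
      by (intro order.trans[OF card_Un_le] add_mono order_refl)
    finally show ?thesis by simp
  qed
  have swap: "(\<Sum>x\<in>Om. card {i. i < k \<and> x \<in> A i}) = (\<Sum>i<k. card (A i))" if "\<And>i. A i \<subseteq> Om" for A
  proof -
    have "(\<Sum>x\<in>Om. card {i \<in> {..<k}. x \<in> A i}) = (\<Sum>i\<in>{..<k}. card {x \<in> Om. x \<in> A i})"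
      using finite_Om by (intro sum_multicount_gen) auto
    moreover have "{x \<in> Om. x \<in> A i} = A i" for i using that by blast
    moreover have "{i \<in> {..<k}. x \<in> A i} = {i. i < k \<and> x \<in> A i}" for x by blast
    ultimately show ?thesis by simp
  qed
  have D: "(\<Sum>x\<in>Om. card {i. i < k \<and> x \<in> ?dense i}) * 8 \<le> k * card Om"
  proof -
    have e: "(\<Sum>x\<in>Om. card {i. i < k \<and> x \<in> ?dense i}) = (\<Sum>i<k. card (?dense i))" by (rule swap) blast
    have "(\<Sum>i<k. card (?dense i)) * 8 = (\<Sum>i<k. card (?dense i) * 8)" by (rule sum_distrib_right)
    also have "\<dots> \<le> (\<Sum>i<k. card Om)" by (rule sum_mono, rule dense) simp
    finally show ?thesis unfolding e by simp
  qed
  have E: "(\<Sum>x\<in>Om. card {i. i < k \<and> x \<in> ?bad i}) * 8 \<le> k * card Om"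
  proof -
    have e: "(\<Sum>x\<in>Om. card {i. i < k \<and> x \<in> ?bad i}) = (\<Sum>i<k. card (?bad i))" by (rule swap) blast
    have "(\<Sum>i<k. card (?bad i)) * 8 = (\<Sum>i<k. card (?bad i) * 8)" by (rule sum_distrib_right)
    also have "\<dots> \<le> (\<Sum>i<k. card Om)" by (rule sum_mono, rule bad) simp
    finally show ?thesis unfolding e by simp
  qed
  have F: "(\<Sum>x\<in>Om. card (?good x)) * 8 \<le> 2 * (k * card Om)"
  proof -
    have le: "card (?good x) \<le> k" for x using card_mono[of "{..<k}" "?good x"] by auto
    \<comment> \<open>There are fewer than \<open>b\<close>, hence at most \<open>k / 8\<close>,
      good children unless the sample lies in the rare set \<open>?many\<close>, where all
      \<open>k\<close> may be good.\<close>
    have "(\<Sum>x\<in>Om. card (?good x)) \<le> (\<Sum>x\<in>Om. b + (if b \<le> card (?good x) then k else 0))"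
    proof (rule sum_mono)
      fix x
      show "card (?good x) \<le> b + (if b \<le> card (?good x) then k else 0)" using le[of x] by simp
    qed
    also have "\<dots> = b * card Om + k * card ?many"
      unfolding sum.distrib sum.inter_filter[symmetric, OF finite_Om] by (simp add: mult.commute)
    finally have "(\<Sum>x\<in>Om. card (?good x)) * 8 \<le> (8 * b) * card Om + k * (card ?many * 8)" by simp
    also have "\<dots> \<le> k * card Om + k * card Om" by (intro add_mono mult_le_mono1 mult_le_mono2 H4 many)
    finally show ?thesis by simp
  qed
  have "k * card Om = (\<Sum>x\<in>Om. k)" by simp
  also have "\<dots> \<le> (\<Sum>x\<in>Om. card (?big x) + card {i. i < k \<and> x \<in> ?dense i} + card {i. i < k \<and> x \<in> ?bad i} + card (?good x))"
    by (rule sum_mono[OF split])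
  also have "\<dots> = (\<Sum>x\<in>Om. card (?big x)) + (\<Sum>x\<in>Om. card {i. i < k \<and> x \<in> ?dense i})
     + (\<Sum>x\<in>Om. card {i. i < k \<and> x \<in> ?bad i}) + (\<Sum>x\<in>Om. card (?good x))" by (simp only: sum.distrib)
  finally have "k * card Om \<le> 2 * (\<Sum>x\<in>Om. card (?big x))" using D E F by linarith
  then have "d * (k * card Om) \<le> d * (2 * (\<Sum>x\<in>Om. card (?big x)))" by (rule mult_le_mono2)
  also have "\<dots> = 2 * (\<Sum>x\<in>Om. d * card (?big x))" by (simp add: sum_distrib_left mult_ac)
  also have "\<dots> \<le> 2 * (\<Sum>x\<in>Om. \<Sum>i<k. card (again x (start i) (start (Suc i)) (start B)))"
  proof (intro mult_le_mono2 sum_mono)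
    fix x assume x: "x \<in> Om"
    have "d * card (?big x) = (\<Sum>i\<in>?big x. d)" by simp
    also have "\<dots> \<le> (\<Sum>i\<in>?big x. card (again x (start i) (start (Suc i)) (start B)))"
    proof (rule sum_mono)
      fix i assume i: "i \<in> ?big x"
      have "start (Suc i) \<le> start B" using i B by (intro start_mono) auto
      then have "?Z i x \<subseteq> again x (start i) (start (Suc i)) (start B)"
        using Mem_untouched[of "start (Suc i)" "start B" _ x] unfolding again_def by fastforce
      then have "card (?Z i x) \<le> card (again x (start i) (start (Suc i)) (start B))"
        by (rule card_mono[rotated]) (simp add: again_def)
      then show "d \<le> card (again x (start i) (start (Suc i)) (start B))" using i by simp
    qed
    also have "\<dots> \<le> (\<Sum>i<k. card (again x (start i) (start (Suc i)) (start B)))"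
      by (rule sum_mono2) auto
    finally show "d * card (?big x) \<le> (\<Sum>i<k. card (again x (start i) (start (Suc i)) (start B)))" .
  qed
  finally show ?thesis by (simp only: mult.assoc)
qed

end

subsection \<open>Levels\<close>

text \<open>\<open>q\<close> is the next access to the cell \<open>e\<close> after \<open>p\<close>.
  Blocks of length \<open>a\<close> or \<open>b\<close> start at multiples of it, so equal quotients
  mean a common block: different children, same node.\<close>

definition gaps :: "(nat \<Rightarrow> nat set) \<Rightarrow> nat \<Rightarrow> nat \<Rightarrow> nat \<Rightarrow> (nat \<times> nat) set" where
  "gaps T N a b = {(p, e). p < N \<and> e \<in> T p \<and> (\<exists>q. p < q \<and> q < N \<and> e \<in> T q \<and> (\<forall>q'. p < q' \<and> q' < q \<longrightarrow> e \<notin> T q')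
     \<and> p div a \<noteq> q div a \<and> p div b = q div b)}"

text \<open>The next access is determined by the time and the cell. If the two times share a block
  of length \<open>b'\<close>, they share every block whose length is a multiple of
  \<open>b'\<close>.\<close>

lemma gaps_disjoint:
  assumes "b' dvd a"
  shows "gaps T N a b \<inter> gaps T N a' b' = {}"
proof (rule ccontr)
  assume "gaps T N a b \<inter> gaps T N a' b' \<noteq> {}"
  then obtain p e where pe: "(p, e) \<in> gaps T N a b" "(p, e) \<in> gaps T N a' b'" by auto
  from pe(1) obtain q where q: "p < q" "e \<in> T q" "\<forall>q'. p < q' \<and> q' < q \<longrightarrow> e \<notin> T q'" "p div a \<noteq> q div a"
    unfolding gaps_def by blast
  from pe(2) obtain q' where q': "p < q'" "e \<in> T q'" "\<forall>r. p < r \<and> r < q' \<longrightarrow> e \<notin> T r" "p div b' = q' div b'"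
    unfolding gaps_def by blast
  have "q = q'" using q q' by (metis linorder_neqE_nat)
  moreover obtain c where "a = b' * c" using assms by blast
  ultimately have "p div a = q div a" using q'(4) by (simp add: div_mult2_eq)
  then show False using q(4) by simp
qed

lemma sum_gaps_le:
  fixes J :: nat
  assumes fin: "\<And>p. finite (T p)" and dv: "\<And>i j. i < j \<Longrightarrow> j < J \<Longrightarrow> b j dvd a i"
  shows "(\<Sum>j<J. card (gaps T N (a j) (b j))) \<le> (\<Sum>p<N. card (T p))"
proof -
  have sub: "gaps T N a b \<subseteq> Sigma {..<N} T" for a b by (auto simp: gaps_def)
  have finS: "finite (Sigma {..<N} T)" using fin by auto
  have "(\<Sum>j<J. card (gaps T N (a j) (b j))) = card (\<Union>j<J. gaps T N (a j) (b j))"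
  proof (rule card_UN_disjoint[symmetric])
    show "\<forall>i\<in>{..<J}. finite (gaps T N (a i) (b i))" using finite_subset[OF sub finS] by blast
    show "\<forall>i\<in>{..<J}. \<forall>j\<in>{..<J}. i \<noteq> j \<longrightarrow> gaps T N (a i) (b i) \<inter> gaps T N (a j) (b j) = {}"
    proof (intro ballI impI)
      fix i j assume "i \<in> {..<J}" "j \<in> {..<J}" "i \<noteq> j"
      then have "i < J" "j < J" "i < j \<or> j < i" by auto
      then show "gaps T N (a i) (b i) \<inter> gaps T N (a j) (b j) = {}"
        using gaps_disjoint[OF dv[of i j], of T N "b i" "a j"] gaps_disjoint[OF dv[of j i], of T N "b j" "a i"]
        by blast
    qed
  qed simp
  also have "\<dots> \<le> card (Sigma {..<N} T)" by (rule card_mono[OF finS]) (use sub in blast)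
  also have "\<dots> = (\<Sum>p<N. card (T p))" using fin by simp
  finally show ?thesis .
qed

text \<open>A cell touched in child \<open>i\<close> and again later in the node is charged at its
  last access in child \<open>i\<close>: the next access then lies in a later child of the same
  node. The time of that last access gives back \<open>v\<close> and \<open>i\<close>.\<close>

lemma gaps_ge:
  assumes fin: "\<And>p. finite (T p)" and a: "0 < a" and N: "V * (m * a) \<le> N" and km: "k \<le> m"
  shows "(\<Sum>v<V. \<Sum>i<k. card ((\<Union>p\<in>{v * (m * a) + i * a..<v * (m * a) + Suc i * a}. T p)
      \<inter> (\<Union>p\<in>{v * (m * a) + Suc i * a..<v * (m * a) + m * a}. T p))) \<le> card (gaps T N a (m * a))"
proof -
  let ?lo = "\<lambda>v i. v * (m * a) + i * a"
  let ?A = "\<lambda>(v, i). (\<Union>p\<in>{?lo v i..<?lo v (Suc i)}. T p) \<inter> (\<Union>p\<in>{?lo v (Suc i)..<?lo v m}. T p)"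
  let ?P = "\<lambda>((v, i), e). {p \<in> {?lo v i..<?lo v (Suc i)}. e \<in> T p}"
  let ?f = "\<lambda>z. (Max (?P z), snd z)"
  have finA: "finite (?A z)" for z using fin by (cases z) auto
  have divI: "x div a = c" if "c * a \<le> x" "x < Suc c * a" for x c
    using that by (intro div_nat_eqI) (simp_all only: mult.commute)
  have "(\<Sum>v<V. \<Sum>i<k. card (?A (v, i))) = (\<Sum>z\<in>{..<V} \<times> {..<k}. card (?A z))"
    unfolding sum.cartesian_product by (rule sum.cong) auto
  also have "\<dots> = card (Sigma ({..<V} \<times> {..<k}) ?A)" using finA by (intro card_SigmaI[symmetric]) auto
  also have "\<dots> \<le> card (gaps T N a (m * a))"
  proof (rule card_inj_on_le)
    have key: "Max (?P ((v, i), e)) \<in> ?P ((v, i), e) \<and> (\<forall>p\<in>?P ((v, i), e). p \<le> Max (?P ((v, i), e)))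
        \<and> Max (?P ((v, i), e)) div a = v * m + i"
      if "e \<in> ?A (v, i)" for v i e
    proof -
      have ne: "?P ((v, i), e) \<noteq> {}" using that by auto
      have fn: "finite (?P ((v, i), e))" by simp
      have M: "Max (?P ((v, i), e)) \<in> ?P ((v, i), e)" by (rule Max_in[OF fn ne])
      then have "(v * m + i) * a \<le> Max (?P ((v, i), e))" "Max (?P ((v, i), e)) < Suc (v * m + i) * a"
        by (simp_all add: algebra_simps)
      then have "Max (?P ((v, i), e)) div a = v * m + i" by (rule divI)
      then show ?thesis using M Max_ge[OF fn] by blast
    qed
    show "inj_on ?f (Sigma ({..<V} \<times> {..<k}) ?A)"
    proof (rule inj_onI)
      fix z z' assume z: "z \<in> Sigma ({..<V} \<times> {..<k}) ?A" and z': "z' \<in> Sigma ({..<V} \<times> {..<k}) ?A" and eq: "?f z = ?f z'"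
      obtain v i e where zz: "z = ((v, i), e)" by (metis surj_pair)
      obtain v' i' e' where zz': "z' = ((v', i'), e')" by (metis surj_pair)
      have i: "i < m" "i' < m" "e \<in> ?A (v, i)" "e' \<in> ?A (v', i')" using z z' km unfolding zz zz' by auto
      have e0: "Max (?P z) = Max (?P z') \<and> snd z = snd z'" using eq by (simp only: prod.inject)
      then have e: "e = e'" "Max (?P z) = Max (?P z')" unfolding zz zz' by (simp, blast)
      have "v * m + i = v' * m + i'" using key[OF i(3)] key[OF i(4)] e(2) unfolding zz zz' by simp
      then have "(v * m + i) div m = (v' * m + i') div m" "(v * m + i) mod m = (v' * m + i') mod m" by simp_all
      then have "v = v'" "i = i'" using i(1,2) by simp_all
      then show "z = z'" unfolding zz zz' using e by simp
    qed
    show "?f ` Sigma ({..<V} \<times> {..<k}) ?A \<subseteq> gaps T N a (m * a)"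
    proof
      fix y assume "y \<in> ?f ` Sigma ({..<V} \<times> {..<k}) ?A"
      then obtain z where z: "z \<in> Sigma ({..<V} \<times> {..<k}) ?A" "y = ?f z" by blast
      obtain v i e where zz: "z = ((v, i), e)" by (metis surj_pair)
      have vi: "v < V" "i < m" "e \<in> ?A (v, i)" using z(1) km unfolding zz by auto
      define p where "p = Max (?P ((v, i), e))"
      have p: "?lo v i \<le> p" "p < ?lo v (Suc i)" "e \<in> T p" "p div a = v * m + i"
        and pmax: "\<And>p'. ?lo v i \<le> p' \<Longrightarrow> p' < ?lo v (Suc i) \<Longrightarrow> e \<in> T p' \<Longrightarrow> p' \<le> p"
        using key[OF vi(3)] unfolding p_def[symmetric] by auto
      obtain r where r: "?lo v (Suc i) \<le> r" "r < ?lo v m" "e \<in> T r" using vi(3) by auto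
      define q where "q = (LEAST q. p < q \<and> e \<in> T q)"
      have ex: "p < r \<and> e \<in> T r" using p(2) r by simp
      have q: "p < q" "e \<in> T q" "q \<le> r" using LeastI[of "\<lambda>q. p < q \<and> e \<in> T q", OF ex] Least_le[of "\<lambda>q. p < q \<and> e \<in> T q", OF ex]
        unfolding q_def by auto
      have qmin: "e \<notin> T q'" if "p < q'" "q' < q" for q'
        using not_less_Least[of q' "\<lambda>q. p < q \<and> e \<in> T q"] that unfolding q_def by blast
      have qhi: "?lo v (Suc i) \<le> q" using pmax[of q] q p(1) by (meson le_less_trans less_imp_le not_le)
      have up: "q < (v + 1) * (m * a)" using q(3) r(2) by simp
      have "(v + 1) * (m * a) \<le> V * (m * a)" using vi(1) by (intro mult_le_mono1) simp
      then have qN: "q < N" using up N by linarith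
      have "p div a \<noteq> q div a"
      proof -
        have "Suc (v * m + i) * a \<le> q" using qhi by (simp add: algebra_simps)
        then have "Suc (v * m + i) \<le> q div a" using a by (simp add: less_eq_div_iff_mult_less_eq)
        then show ?thesis using p(4) by simp
      qed
      moreover have "p div (m * a) = v"
      proof -
        have "p div (m * a) = p div a div m" by (metis div_mult2_eq mult.commute)
        then show ?thesis using p(4) vi(2) by simp
      qed
      moreover have "q div (m * a) = v"
      proof (rule div_nat_eqI)
        show "m * a * v \<le> q" using p(1) q(1) by (simp add: mult_ac)
        show "q < m * a * Suc v" using up by (simp add: mult_ac)
      qed
      ultimately show "y \<in> gaps T N a (m * a)"
        unfolding z(2) zz gaps_def snd_conv p_def[symmetric] using p(3) q(1,2) qN qmin by (auto intro!: exI[of _ q])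
    qed
    show "finite (gaps T N a (m * a))"
    proof (rule finite_subset)
      show "gaps T N a (m * a) \<subseteq> Sigma {..<N} T" by (auto simp: gaps_def)
      show "finite (Sigma {..<N} T)" using fin by auto
    qed
  qed
  finally show ?thesis by simp
qed

context dyn_dict
begin

text \<open>The arithmetic hypotheses of \<open>node_bound\<close> for children of length
  \<open>l\<close> in a node with \<open>2 * k\<close> of them, put together so that
  \<open>level_okI\<close> can treat them apart from the data structure's runs.\<close>

definition level_ok :: "nat \<Rightarrow> nat \<Rightarrow> nat \<Rightarrow> bool" where
  "level_ok l k d \<longleftrightarrow> 0 < l \<and> 0 < k \<and> 2 * k \<le> U \<and> 2 * d \<le> l
    \<and> 8 * ((2 ^ w) ^ S * (2 ^ S * (2 ^ S * (2 ^ S * (2 ^ w) ^ (2 * d) * U ^ l))) * n ^ l)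
      \<le> U ^ (l - 2 * d) * ((U choose n) * ff (U - n) l)
    \<and> (\<exists>K b. 8 * (K * 2 ^ Suc l) \<le> k ^ d \<and> 8 * ((2 ^ w) ^ S * 2 ^ k) \<le> K ^ b * (U choose n) \<and> 8 * b \<le> k)"

lemma level_bound:
  assumes ok: "level_ok l k d" and U: "4 * n \<le> U" and N: "V * (2 * k * l) \<le> N" "N \<le> n"
  shows "V * (d * k * card Om) \<le> 2 * (\<Sum>x\<in>Om. card (gaps (\<lambda>p. Tch x p (Suc p)) N l (2 * k * l)))"
proof -
  let ?B = "2 * k"
  let ?T = "\<lambda>x p. Tch x p (Suc p)"
  from ok obtain K b where ok': "0 < l" "0 < k" "2 * k \<le> U" "2 * d \<le> l"
    and H: "8 * ((2 ^ w) ^ S * (2 ^ S * (2 ^ S * (2 ^ S * (2 ^ w) ^ (2 * d) * U ^ l))) * n ^ l)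
      \<le> U ^ (l - 2 * d) * ((U choose n) * ff (U - n) l)"
      "8 * (K * 2 ^ Suc l) \<le> k ^ d" "8 * ((2 ^ w) ^ S * 2 ^ k) \<le> K ^ b * (U choose n)" "8 * b \<le> k"
    unfolding level_ok_def by blast
  have one: "d * k * card Om \<le> 2 * (\<Sum>x\<in>Om. \<Sum>i<k. card ((\<Union>p\<in>{v * (?B * l) + i * l..<v * (?B * l) + Suc i * l}. ?T x p)
      \<inter> (\<Union>p\<in>{v * (?B * l) + Suc i * l..<v * (?B * l) + ?B * l}. ?T x p)))" if v: "v < V" for v
  proof -
    have "(v + 1) * (?B * l) \<le> V * (?B * l)" using v by (intro mult_le_mono1) simp
    then have le: "v * (?B * l) + ?B * l \<le> n" using N by simp
    interpret node D n U w S "v * (?B * l)" l ?B d K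
      by unfold_locales (use le ok' in simp_all)
    have nU: "n \<le> U" using U by simp
    have again_eq: "again x (start i) (start (Suc i)) (start ?B)
        = (\<Union>p\<in>{v * (?B * l) + i * l..<v * (?B * l) + Suc i * l}. ?T x p)
        \<inter> (\<Union>p\<in>{v * (?B * l) + Suc i * l..<v * (?B * l) + ?B * l}. ?T x p)" if "i < k" for x i
    proof -
      have le: "start i \<le> start (Suc i)" "start (Suc i) \<le> start ?B" using that by (intro start_mono; simp)+
      show ?thesis unfolding again_def Tch_UN[OF le(1)] Tch_UN[OF le(2)] unfolding start_def ..
    qed
    have "d * k * card Om \<le> 2 * (\<Sum>x\<in>Om. \<Sum>i<k. card (again x (start i) (start (Suc i)) (start ?B)))"
      by (rule node_bound[OF refl ok'(2) U ok'(3) nU ok'(4) H])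
    also have "\<dots> = 2 * (\<Sum>x\<in>Om. \<Sum>i<k. card ((\<Union>p\<in>{v * (?B * l) + i * l..<v * (?B * l) + Suc i * l}. ?T x p)
        \<inter> (\<Union>p\<in>{v * (?B * l) + Suc i * l..<v * (?B * l) + ?B * l}. ?T x p)))"
      by (intro arg_cong[where f = "\<lambda>u. 2 * u"] sum.cong refl, subst again_eq) simp_all
    finally show ?thesis .
  qed
  have "V * (d * k * card Om) = (\<Sum>v<V. d * k * card Om)" by simp
  also have "\<dots> \<le> (\<Sum>v<V. 2 * (\<Sum>x\<in>Om. \<Sum>i<k. card ((\<Union>p\<in>{v * (?B * l) + i * l..<v * (?B * l) + Suc i * l}. ?T x p)
      \<inter> (\<Union>p\<in>{v * (?B * l) + Suc i * l..<v * (?B * l) + ?B * l}. ?T x p))))"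
    by (rule sum_mono, rule one) simp
  also have "\<dots> = 2 * (\<Sum>x\<in>Om. \<Sum>v<V. \<Sum>i<k. card ((\<Union>p\<in>{v * (?B * l) + i * l..<v * (?B * l) + Suc i * l}. ?T x p)
      \<inter> (\<Union>p\<in>{v * (?B * l) + Suc i * l..<v * (?B * l) + ?B * l}. ?T x p)))"
    unfolding sum_distrib_left[symmetric] by (subst sum.swap) (rule refl)
  also have "\<dots> \<le> 2 * (\<Sum>x\<in>Om. card (gaps (?T x) N l (?B * l)))"
    by (intro mult_le_mono2 sum_mono gaps_ge finite_Tch ok'(1) N(1)) simp
  finally show ?thesis .
qed

text \<open>With powers of two as lengths, the nodes of each level fill the first
  \<open>2 ^ E 0\<close> meta-operations exactly, and the divisibility required by
  \<open>sum_gaps_le\<close> holds. As \<open>d = l / 2 ^ g\<close>, all levels contribute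
  equally.\<close>

lemma levels_bound:
  fixes E :: "nat \<Rightarrow> nat"
  assumes U: "4 * n \<le> U" and E0: "2 ^ E 0 \<le> n" and dec: "\<And>j. j < J \<Longrightarrow> E (Suc j) < E j"
    and g: "\<And>j. j < J \<Longrightarrow> g \<le> E (Suc j)"
    and ok: "\<And>j. j < J \<Longrightarrow> level_ok (2 ^ E (Suc j)) (2 ^ (E j - E (Suc j) - 1)) (2 ^ (E (Suc j) - g))"
  shows "J * (2 ^ E 0 * card Om) \<le> 4 * 2 ^ g * (\<Sum>x\<in>Om. \<Sum>p<n. card (Tch x p (Suc p)))"
proof -
  let ?T = "\<lambda>x p. Tch x p (Suc p)"
  let ?N = "2 ^ E 0 :: nat"
  let ?W = "\<lambda>x j. card (gaps (?T x) ?N (2 ^ E (Suc j)) (2 ^ E j))"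
  have mono: "E j \<le> E i" if "i \<le> j" "j \<le> J" for i j
    using that
  proof (induction j rule: dec_induct)
    case (step m)
    then show ?case using dec[of m] by simp
  qed simp
  have lev: "2 ^ E 0 * card Om \<le> 4 * 2 ^ g * (\<Sum>x\<in>Om. ?W x j)" if j: "j < J" for j
  proof -
    let ?l = "2 ^ E (Suc j) :: nat" and ?k = "2 ^ (E j - E (Suc j) - 1) :: nat" and ?d = "2 ^ (E (Suc j) - g) :: nat"
    let ?V = "2 ^ (E 0 - E j) :: nat"
    have 1: "2 * ?k * ?l = 2 ^ E j"
    proof -
      have "E j = Suc (E j - E (Suc j) - 1 + E (Suc j))" using dec[OF j] by simp
      then show ?thesis by (metis mult.assoc power_Suc power_add)
    qed
    have 2: "?V * 2 ^ E j = ?N" using mono[of 0 j] j by (simp flip: power_add)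
    have "?V * (2 * ?k * ?l) \<le> ?N" using 1 2 by simp
    from level_bound[OF ok[OF j] U this E0]
    have "?V * (?d * ?k * card Om) \<le> 2 * (\<Sum>x\<in>Om. ?W x j)" unfolding 1 .
    then have "2 * 2 ^ g * (?V * (?d * ?k * card Om)) \<le> 2 * 2 ^ g * (2 * (\<Sum>x\<in>Om. ?W x j))" by (rule mult_le_mono2)
    moreover have "2 * 2 ^ g * (?V * (?d * ?k * card Om)) = ?N * card Om"
    proof -
      have "2 ^ g * ?d = ?l" using g[OF j] by (simp flip: power_add)
      moreover have "2 * 2 ^ g * (?V * (?d * ?k * card Om)) = ?V * (2 * ?k * (2 ^ g * ?d)) * card Om"
        by (simp only: mult_ac)
      ultimately have "2 * 2 ^ g * (?V * (?d * ?k * card Om)) = ?V * (2 * ?k * ?l) * card Om" by (simp only:)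
      then show ?thesis unfolding 1 2 .
    qed
    ultimately have "?N * card Om \<le> 2 * 2 ^ g * (2 * (\<Sum>x\<in>Om. ?W x j))" by (simp only:)
    then show ?thesis by linarith
  qed
  have "J * (2 ^ E 0 * card Om) = (\<Sum>j<J. 2 ^ E 0 * card Om)" by simp
  also have "\<dots> \<le> (\<Sum>j<J. 4 * 2 ^ g * (\<Sum>x\<in>Om. ?W x j))" by (rule sum_mono, rule lev) simp
  also have "\<dots> = 4 * 2 ^ g * (\<Sum>x\<in>Om. \<Sum>j<J. ?W x j)"
    unfolding sum_distrib_left[symmetric] by (subst sum.swap) (rule refl)
  also have "\<dots> \<le> 4 * 2 ^ g * (\<Sum>x\<in>Om. \<Sum>p<?N. card (?T x p))"
  proof (intro mult_le_mono2 sum_mono sum_gaps_le finite_Tch)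
    fix i j assume "i < j" "j < J"
    then show "(2::nat) ^ E j dvd 2 ^ E (Suc i)" using mono[of "Suc i" j] by (intro le_imp_power_dvd) simp
  qed
  also have "\<dots> \<le> 4 * 2 ^ g * (\<Sum>x\<in>Om. \<Sum>p<n. card (?T x p))"
    by (intro mult_le_mono2 sum_mono sum_mono2) (use E0 in auto)
  finally show ?thesis .
qed

text \<open>With fewer than \<open>q\<close> probes, the memory after the initial insertions is the
  initial one with a patch of at most \<open>q\<close> cells, and each patch accounts for one
  current set only.\<close>

lemma base_bound:
  assumes nU: "n \<le> U" and H: "2 * (2 ^ S * (2 ^ w) ^ q) \<le> U choose n"
  shows "q * card Om \<le> 2 * (\<Sum>x\<in>Om. ops_cost D (init_ops x) (init_mem D))"
proof -
  let ?c = "\<lambda>x. ops_cost D (init_ops x) (init_mem D)"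
  let ?L = "{x \<in> Om. ?c x < q}"
  let ?app = "\<lambda>(E, f). \<lambda>e. if e \<in> E then f e else init_mem D e"
  have finP: "finite (patches q)" by (rule card_patches)
  have "?L \<subseteq> (\<Union>z\<in>patches q. {x \<in> Om. cur x 0 = dec (?app z)})"
  proof
    fix x assume x: "x \<in> ?L"
    let ?E = "ops_touched D (init_ops x) (init_mem D)"
    have M0: "Mem x 0 = ops_mem D (init_ops x) (init_mem D)" by (simp add: Mem_def)
    have "mem_ok S (2 ^ w) (init_mem D) (init_mem D)" using dict by (auto simp: dictionary_def mem_ok_def)
    then have sub: "?E \<subseteq> {..<S}" by (rule ops_ok[OF dict, THEN conjunct1])
    have "card ?E \<le> q" using card_ops_touched_le[of D "init_ops x" "init_mem D"] x by simp
    moreover have "restrict (Mem x 0) ?E \<in> ?E \<rightarrow>\<^sub>E {..<2 ^ w}"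
      using Mem_ok[of x 0] sub by (auto simp: mem_ok_def)
    ultimately have "(?E, restrict (Mem x 0) ?E) \<in> patches q" using sub unfolding patches_def by blast
    moreover have "?app (?E, restrict (Mem x 0) ?E) = Mem x 0"
      using ops_untouched[of _ D "init_ops x" "init_mem D"] by (auto simp: fun_eq_iff M0)
    moreover have "cur x 0 = dec (Mem x 0)" using dec_Mem[of x 0] valid_Om[of x 0] x by simp
    ultimately show "x \<in> (\<Union>z\<in>patches q. {x \<in> Om. cur x 0 = dec (?app z)})" using x by force
  qed
  then have "card ?L \<le> card (\<Union>z\<in>patches q. {x \<in> Om. cur x 0 = dec (?app z)})"
    by (rule card_mono[rotated]) (use finP finite_Om in auto)
  also have "\<dots> \<le> (\<Sum>z\<in>patches q. card {x \<in> Om. cur x 0 = dec (?app z)})" by (rule card_UN_le[OF finP])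
  finally have "card ?L * (U choose n) \<le> (\<Sum>z\<in>patches q. card {x \<in> Om. cur x 0 = dec (?app z)}) * (U choose n)"
    by (rule mult_le_mono1)
  also have "\<dots> = (\<Sum>z\<in>patches q. card {x \<in> Om. cur x 0 = dec (?app z)} * (U choose n))" by (rule sum_distrib_right)
  also have "\<dots> \<le> (\<Sum>z\<in>patches q. card Om)" by (rule sum_mono, rule card_cur_fiber) (use nU in simp_all)
  also have "\<dots> \<le> (2 ^ S * (2 ^ w) ^ q) * card Om" using card_patches(2)[of q] by simp
  finally have 1: "card ?L * (U choose n) \<le> (2 ^ S * (2 ^ w) ^ q) * card Om" .
  have "(2 * card ?L) * (2 ^ S * (2 ^ w) ^ q) = card ?L * (2 * (2 ^ S * (2 ^ w) ^ q))" by (simp only: mult_ac)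
  also have "\<dots> \<le> card ?L * (U choose n)" by (rule mult_le_mono2[OF H])
  finally have "(2 * card ?L) * (2 ^ S * (2 ^ w) ^ q) \<le> card Om * (2 ^ S * (2 ^ w) ^ q)" using 1 by (simp only: mult_ac)
  moreover have "2 ^ S * (2 ^ w) ^ q \<noteq> (0::nat)" by simp
  ultimately have 2: "2 * card ?L \<le> card Om" using mult_le_cancel2 by blast
  have "card (Om - ?L) = card Om - card ?L" using finite_Om by (intro card_Diff_subset) auto
  then have "card Om \<le> 2 * card (Om - ?L)" using 2 by simp
  then have "q * card Om \<le> q * (2 * card (Om - ?L))" by (rule mult_le_mono2)
  also have "\<dots> = 2 * (\<Sum>x\<in>Om - ?L. q)" by simp
  also have "\<dots> \<le> 2 * (\<Sum>x\<in>Om - ?L. ?c x)" by (intro mult_le_mono2 sum_mono) auto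
  also have "\<dots> \<le> 2 * (\<Sum>x\<in>Om. ?c x)" using finite_Om by (intro mult_le_mono2 sum_mono2) auto
  finally show ?thesis .
qed

end

subsection \<open>The hard distribution\<close>

fun ops_of :: "nat list \<times> nat list \<Rightarrow> op list" where
  "ops_of (d # ds, a # as) = Qry d # Del d # Ins a # ops_of (ds, as)"
| "ops_of _ = []"

text \<open>The outcomes of drawing \<open>i\<close> keys without replacement.\<close>

definition dlists :: "nat \<Rightarrow> 'a set \<Rightarrow> 'a list set" where
  "dlists i A = {xs. length xs = i \<and> distinct xs \<and> set xs \<subseteq> A}"

lemma dlists_0: "dlists 0 A = {[]}"
  by (auto simp: dlists_def)

lemma dlists_Suc: "dlists (Suc i) A = (\<Union>a\<in>A. (#) a ` dlists i (A - {a}))"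
proof
  show "dlists (Suc i) A \<subseteq> (\<Union>a\<in>A. (#) a ` dlists i (A - {a}))"
  proof
    fix xs assume xs: "xs \<in> dlists (Suc i) A"
    then obtain a ys where "xs = a # ys" by (cases xs) (auto simp: dlists_def)
    then show "xs \<in> (\<Union>a\<in>A. (#) a ` dlists i (A - {a}))" using xs by (auto simp: dlists_def)
  qed
  show "(\<Union>a\<in>A. (#) a ` dlists i (A - {a})) \<subseteq> dlists (Suc i) A" by (auto simp: dlists_def)
qed

lemma finite_dlists: "finite A \<Longrightarrow> finite (dlists i A)"
  by (rule finite_subset[OF _ finite_lists_length_eq[of A i]]) (auto simp: dlists_def)

lemma card_dlists: "finite A \<Longrightarrow> i \<le> card A \<Longrightarrow> card (dlists i A) = ff (card A) i"
proof (induction i arbitrary: A)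
  case (Suc i)
  have "card (dlists (Suc i) A) = (\<Sum>a\<in>A. card ((#) a ` dlists i (A - {a})))"
    unfolding dlists_Suc
  proof (rule card_UN_disjoint)
    show "\<forall>a\<in>A. finite ((#) a ` dlists i (A - {a}))"
      using Suc.prems(1) by (intro ballI finite_imageI finite_dlists) simp
  qed (use Suc.prems(1) in auto)
  also have "\<dots> = (\<Sum>a\<in>A. ff (card A - 1) i)"
  proof (rule sum.cong[OF refl])
    fix a assume a: "a \<in> A"
    have "card ((#) a ` dlists i (A - {a})) = card (dlists i (A - {a}))" by (rule card_image) simp
    also have "\<dots> = ff (card A - 1) i" using Suc.IH[of "A - {a}"] Suc.prems a by simp
    finally show "card ((#) a ` dlists i (A - {a})) = ff (card A - 1) i" .
  qed
  also have "\<dots> = ff (card A) (1 + i)" unfolding ff_add by (simp add: ff_def)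
  finally show ?case by simp
qed (simp add: dlists_0 ff_def)

lemma dlists_nonempty: assumes "finite A" "i \<le> card A" shows "dlists i A \<noteq> {}"
proof -
  obtain C where C: "C \<subseteq> A" "card C = i" "finite C" using obtain_subset_with_card_n[OF assms(2)] by blast
  obtain xs where "set xs = C" "distinct xs" using finite_distinct_list[OF C(3)] by blast
  then have "xs \<in> dlists i A" using C distinct_card[of xs] by (simp add: dlists_def)
  then show ?thesis by blast
qed

text \<open>Injectivity of \<open>f\<close> makes the images disjoint, and all have size
  \<open>c\<close>, so a uniform mixture gives all elements equal weight.\<close>

lemma uniform_prepend:
  fixes F :: "'a \<Rightarrow> 'b set"
  assumes A: "finite A" "A \<noteq> {}" and F: "\<And>a. a \<in> A \<Longrightarrow> finite (F a) \<and> F a \<noteq> {} \<and> card (F a) = c"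
    and inj: "\<And>a a' y y'. f a y = f a' y' \<Longrightarrow> a = a' \<and> y = y'"
  shows "pmf_of_set A \<bind> (\<lambda>a. map_pmf (f a) (pmf_of_set (F a))) = pmf_of_set (\<Union>a\<in>A. f a ` F a)"
proof -
  have i: "inj_on (f a) X" for a X using inj by (auto simp: inj_on_def)
  have "pmf_of_set A \<bind> (\<lambda>a. map_pmf (f a) (pmf_of_set (F a))) = pmf_of_set A \<bind> (\<lambda>a. pmf_of_set (f a ` F a))"
    using A F i by (intro bind_pmf_cong refl map_pmf_of_set_inj) auto
  also have "\<dots> = pmf_of_set (\<Union>a\<in>A. f a ` F a)"
  proof (rule pmf_of_set_UN[symmetric])
    show "finite (\<Union>a\<in>A. f a ` F a)" using A F by auto
    show "disjoint_family_on (\<lambda>a. f a ` F a) A" using inj by (fastforce simp: disjoint_family_on_def)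
    show "card (f a ` F a) = c" if "a \<in> A" for a using F[OF that] card_image[OF i] by metis
  qed (use A F in auto)
  finally show ?thesis .
qed

lemma bind_pmf_of_set_times:
  assumes "finite A" "A \<noteq> {}" "finite B" "B \<noteq> {}"
  shows "pmf_of_set (A \<times> B) \<bind> h = pmf_of_set A \<bind> (\<lambda>a. pmf_of_set B \<bind> (\<lambda>b. h (a, b)))"
proof -
  have "pmf_of_set A \<bind> (\<lambda>a. map_pmf (Pair a) (pmf_of_set B)) = pmf_of_set (\<Union>a\<in>A. Pair a ` B)"
    using assms by (intro uniform_prepend[where c = "card B"]) auto
  moreover have "(\<Union>a\<in>A. Pair a ` B) = A \<times> B" by auto
  ultimately have "pmf_of_set (A \<times> B) = pmf_of_set A \<bind> (\<lambda>a. map_pmf (Pair a) (pmf_of_set B))" by simp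
  then show ?thesis by (simp add: bind_assoc_pmf bind_map_pmf)
qed

text \<open>Only keys of \<open>K\<close> are deleted, so an inserted key stays, and removing
  \<open>d\<close> from the current set makes no new key insertable. The pool for the insertions
  thus shrinks by the drawn keys only, and the lists of deletions and insertions are
  independent.\<close>

lemma meta_ops_uniform:
  assumes "finite rem" "rem \<subseteq> K" "i \<le> card rem" "i \<le> card ({..<U} - (K \<union> cur))"
  shows "meta_ops U K rem cur i = map_pmf ops_of (pmf_of_set (dlists i rem \<times> dlists i ({..<U} - (K \<union> cur))))"
  using assms
proof (induction i arbitrary: rem cur)
  case 0
  show ?case by (simp add: dlists_0 pmf_of_set_singleton)
next
  case (Suc i)
  let ?V = "{..<U} - (K \<union> cur)"
  let ?G = "\<lambda>d a. dlists i (rem - {d}) \<times> dlists i (?V - {a})"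
  let ?f = "\<lambda>d a (ds, as). (d # ds, a # as)"
  have finV: "finite ?V" by simp
  have "0 < card rem" "0 < card ?V" using Suc.prems(3,4) by linarith+
  then have remne: "rem \<noteq> {}" "?V \<noteq> {}" using card_gt_0_iff by blast+
  have G: "finite (?G d a) \<and> ?G d a \<noteq> {} \<and> card (?G d a) = ff (card rem - 1) i * ff (card ?V - 1) i"
    if "d \<in> rem" "a \<in> ?V" for d a
  proof -
    have c: "card (rem - {d}) = card rem - 1" "card (?V - {a}) = card ?V - 1" using that by (simp_all add: card_Diff_singleton)
    have l: "i \<le> card (rem - {d})" "i \<le> card (?V - {a})" unfolding c using Suc.prems(3,4) by simp_all
    have fn: "finite (rem - {d})" "finite (?V - {a})" using Suc.prems(1) by simp_all
    show ?thesis
      using finite_dlists[OF fn(1)] finite_dlists[OF fn(2)] dlists_nonempty[OF fn(1) l(1)] dlists_nonempty[OF fn(2) l(2)]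
        card_dlists[OF fn(1) l(1)] card_dlists[OF fn(2) l(2)] unfolding c
      by (simp add: card_cartesian_product)
  qed
  have step: "meta_ops U K (rem - {d}) (insert a (cur - {d})) i \<bind> (\<lambda>rest. return_pmf (Qry d # Del d # Ins a # rest))
      = map_pmf ops_of (map_pmf (?f d a) (pmf_of_set (?G d a)))" if d: "d \<in> rem" and a: "a \<in> ?V" for d a
  proof -
    have eq: "{..<U} - (K \<union> insert a (cur - {d})) = ?V - {a}" using d Suc.prems(2) by auto
    have c: "card (rem - {d}) = card rem - 1" "card (?V - {a}) = card ?V - 1" using d a by (simp_all add: card_Diff_singleton)
    have "finite (rem - {d})" "rem - {d} \<subseteq> K" using Suc.prems(1,2) by auto
    moreover have "i \<le> card (rem - {d})" "i \<le> card (?V - {a})" unfolding c using Suc.prems(3,4) by simp_all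
    ultimately have IH: "meta_ops U K (rem - {d}) (insert a (cur - {d})) i = map_pmf ops_of (pmf_of_set (?G d a))"
      using Suc.IH[of "rem - {d}" "insert a (cur - {d})"] unfolding eq by blast
    show ?thesis unfolding IH map_pmf_def[symmetric] map_pmf_comp
      by (intro map_pmf_cong refl) auto
  qed
  have set_eq: "{..<U} - K - (cur - {d}) = ?V" if "d \<in> rem" for d using that Suc.prems(2) by auto
  have "meta_ops U K rem cur (Suc i) = pmf_of_set rem \<bind> (\<lambda>d. pmf_of_set ?V \<bind> (\<lambda>a.
      map_pmf ops_of (map_pmf (?f d a) (pmf_of_set (?G d a)))))"
    unfolding meta_ops.simps
    using Suc.prems(1) remne step set_eq by (intro bind_pmf_cong refl) (auto intro!: bind_pmf_cong)
  also have "\<dots> = map_pmf ops_of (pmf_of_set rem \<bind> (\<lambda>d. pmf_of_set ?V \<bind> (\<lambda>a. map_pmf (?f d a) (pmf_of_set (?G d a)))))"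
    by (simp add: map_bind_pmf)
  also have "pmf_of_set rem \<bind> (\<lambda>d. pmf_of_set ?V \<bind> (\<lambda>a. map_pmf (?f d a) (pmf_of_set (?G d a))))
      = pmf_of_set (rem \<times> ?V) \<bind> (\<lambda>z. map_pmf (?f (fst z) (snd z)) (pmf_of_set (?G (fst z) (snd z))))"
    unfolding bind_pmf_of_set_times[OF Suc.prems(1) remne(1) finV remne(2)] fst_conv snd_conv ..
  also have "\<dots> = pmf_of_set (\<Union>z\<in>rem \<times> ?V. ?f (fst z) (snd z) ` ?G (fst z) (snd z))"
    using Suc.prems(1) remne finV G by (intro uniform_prepend[where c = "ff (card rem - 1) i * ff (card ?V - 1) i"]) auto
  also have "(\<Union>z\<in>rem \<times> ?V. ?f (fst z) (snd z) ` ?G (fst z) (snd z)) = dlists (Suc i) rem \<times> dlists (Suc i) ?V"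
    unfolding dlists_Suc by fastforce
  finally show ?case .
qed

lemma ops_of_map: "ops_of (map f xs, map h xs) = concat (map (\<lambda>r. [Qry (f r), Del (f r), Ins (h r)]) xs)"
  by (induction xs) auto

text \<open>All of \<open>K\<close> is deleted in the end, so \<open>K\<close> is the set of the
  deletion list. Hence the pairs of lists for different \<open>K\<close> form disjoint sets of equal
  size, and together they correspond to the injective functions on \<open>2 * n\<close>
  positions.\<close>

lemma (in dyn_dict) hard_dist_uniform:
  assumes U: "2 * n \<le> U"
  shows "hard_dist n U = map_pmf (\<lambda>x. init_ops x @ mops x 0 n) (pmf_of_set Om)"
proof -
  let ?Ks = "{K. K \<subseteq> {..<U} \<and> card K = n}"
  let ?H = "\<lambda>K. dlists n K \<times> dlists n ({..<U} - K)"
  let ?o = "\<lambda>z. map Ins (sorted_list_of_set (set (fst z))) @ ops_of z"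
  let ?g = "\<lambda>x::nat \<Rightarrow> nat. (map x [0..<n], map (\<lambda>r. x (n + r)) [0..<n])"
  have finK: "finite K" if "K \<in> ?Ks" for K using that by (metis (no_types, lifting) finite_lessThan finite_subset mem_Collect_eq)
  have cK: "card ({..<U} - K) = U - n" if "K \<in> ?Ks" for K
    using that finK[OF that] by (simp add: card_Diff_subset)
  have H: "finite (?H K) \<and> ?H K \<noteq> {} \<and> card (?H K) = ff n n * ff (U - n) n" if K: "K \<in> ?Ks" for K
  proof -
    have f: "finite K" "finite ({..<U} - K)" and l: "n \<le> card K" "n \<le> card ({..<U} - K)"
      using finK[OF K] cK[OF K] K U by auto
    have "card K = n" using K by simp
    then show ?thesis
      using finite_dlists[OF f(1)] finite_dlists[OF f(2)] dlists_nonempty[OF f(1) l(1)] dlists_nonempty[OF f(2) l(2)]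
        card_dlists[OF f(1) l(1)] card_dlists[OF f(2) l(2)] cK[OF K]
      by (simp add: card_cartesian_product)
  qed
  have finKs: "finite ?Ks" by (rule finite_subset[of _ "Pow {..<U}"]) auto
  have neKs: "?Ks \<noteq> {}"
  proof -
    have "{..<n} \<in> ?Ks" using U by auto
    then show ?thesis by blast
  qed
  have setH: "set (fst z) = K" if K: "K \<in> ?Ks" and z: "z \<in> ?H K" for K z
  proof (rule card_subset_eq[OF finK[OF K]])
    show "set (fst z) \<subseteq> K" using z by (auto simp: dlists_def)
    show "card (set (fst z)) = card K" using z K by (auto simp: dlists_def distinct_card)
  qed
  have step: "meta_ops U K K K n \<bind> (\<lambda>rest. return_pmf (map Ins (sorted_list_of_set K) @ rest))
      = map_pmf ?o (pmf_of_set (?H K))" if K: "K \<in> ?Ks" for K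
  proof -
    have "n \<le> card K" "n \<le> card ({..<U} - (K \<union> K))" using cK[OF K] K U by auto
    then have m: "meta_ops U K K K n = map_pmf ops_of (pmf_of_set (?H K))"
      using meta_ops_uniform[of K K n U K] finK[OF K] by simp
    have "set_pmf (pmf_of_set (?H K)) = ?H K" using H[OF K] by (intro set_pmf_of_set) auto
    then show ?thesis unfolding m map_pmf_def[symmetric] map_pmf_comp
      using setH[OF K] by (intro map_pmf_cong refl) simp
  qed
  have "hard_dist n U = pmf_of_set ?Ks \<bind> (\<lambda>K. map_pmf ?o (pmf_of_set (?H K)))"
    unfolding hard_dist_def using step by (intro bind_pmf_cong refl) (simp add: set_pmf_of_set[OF neKs finKs])
  also have "\<dots> = map_pmf ?o (pmf_of_set ?Ks \<bind> (\<lambda>K. pmf_of_set (?H K)))" by (simp add: map_bind_pmf)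
  also have "pmf_of_set ?Ks \<bind> (\<lambda>K. pmf_of_set (?H K)) = pmf_of_set (\<Union>K\<in>?Ks. ?H K)"
  proof (rule pmf_of_set_UN[symmetric])
    show "finite (\<Union>K\<in>?Ks. ?H K)" using finKs H by (intro finite_UN_I) blast+
    show "disjoint_family_on ?H ?Ks" unfolding disjoint_family_on_def using setH by blast
    show "?H K \<noteq> {}" if "K \<in> ?Ks" for K using H[OF that] by blast
    show "card (?H K) = ff n n * ff (U - n) n" if "K \<in> ?Ks" for K using H[OF that] by blast
  qed (rule neKs)
  also have "(\<Union>K\<in>?Ks. ?H K) = ?g ` Om"
  proof
    show "(\<Union>K\<in>?Ks. ?H K) \<subseteq> ?g ` Om"
    proof
      fix z assume "z \<in> (\<Union>K\<in>?Ks. ?H K)"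
      then obtain K where K: "K \<in> ?Ks" "z \<in> ?H K" by blast
      obtain ds as where z: "z = (ds, as)" by (cases z)
      have ds: "length ds = n" "distinct ds" "set ds \<subseteq> K" and as: "length as = n" "distinct as" "set as \<subseteq> {..<U} - K"
        using K(2) unfolding z dlists_def by auto
      define x where "x = restrict (\<lambda>p. (ds @ as) ! p) {..<2 * n}"
      have dist: "distinct (ds @ as)" using ds as by auto
      have "inj_on x {..<2 * n}"
        unfolding x_def inj_on_restrict_eq using inj_on_nth[OF dist, of "{..<2 * n}"] ds(1) as(1) by auto
      moreover have "x \<in> {..<2 * n} \<rightarrow>\<^sub>E {..<U}"
      proof -
        have "(ds @ as) ! p \<in> {..<U}" if "p < 2 * n" for p
        proof -
          have "(ds @ as) ! p \<in> set (ds @ as)" using that ds(1) as(1) by (intro nth_mem) simp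
          then show ?thesis using ds(3) as(3) K(1) by auto
        qed
        then show ?thesis unfolding x_def by simp
      qed
      ultimately have "x \<in> Om" by (simp add: Om_def)
      moreover have "z = ?g x" unfolding z x_def using ds(1) as(1)
        by (auto intro!: nth_equalityI simp: nth_append)
      ultimately show "z \<in> ?g ` Om" by blast
    qed
    show "?g ` Om \<subseteq> (\<Union>K\<in>?Ks. ?H K)"
    proof
      fix z assume "z \<in> ?g ` Om"
      then obtain x where x: "x \<in> Om" "z = ?g x" by blast
      then have inj: "inj_on x {..<2 * n}" and r: "x \<in> {..<2 * n} \<rightarrow>\<^sub>E {..<U}" by (simp_all add: Om_def)
      have xU: "x p < U" if "p < 2 * n" for p using PiE_mem[OF r, of p] that by simp
      let ?K = "x ` {..<n}"
      have injn: "inj_on x {..<n}" by (rule inj_on_subset[OF inj]) auto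
      have "?K \<in> ?Ks" using card_image[OF injn] xU by auto
      moreover have "map x [0..<n] \<in> dlists n ?K"
        using injn by (auto simp: dlists_def distinct_map lessThan_atLeast0)
      moreover have "map (\<lambda>r. x (n + r)) [0..<n] \<in> dlists n ({..<U} - ?K)"
      proof -
        have "inj_on (\<lambda>r. x (n + r)) {0..<n}" 
          by (rule inj_onI) (use inj_onD[OF inj] in fastforce)
        moreover have "x (n + r) \<notin> ?K" if "r < n" for r
        proof
          assume "x (n + r) \<in> ?K"
          then obtain p where "p < n" "x (n + r) = x p" by blast
          then have "n + r = p" using inj_onD[OF inj, of "n + r" p] that by simp
          then show False using \<open>p < n\<close> by simp
        qed
        moreover have "x (n + r) < U" if "r < n" for r using xU[of "n + r"] that by simp
        ultimately have "(\<lambda>r. x (n + r)) ` {0..<n} \<subseteq> {..<U} - ?K" "inj_on (\<lambda>r. x (n + r)) {0..<n}"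
          by ((intro image_subsetI, simp), blast)
        then show ?thesis by (simp add: dlists_def distinct_map)
      qed
      ultimately show "z \<in> (\<Union>K\<in>?Ks. ?H K)" unfolding x(2) by blast
    qed
  qed
  also have "pmf_of_set (?g ` Om) = map_pmf ?g (pmf_of_set Om)"
  proof (rule map_pmf_of_set_inj[symmetric])
    show "inj_on ?g Om"
    proof (rule inj_onI)
      fix x y assume x: "x \<in> Om" and y: "y \<in> Om" and eq: "?g x = ?g y"
      have "x p = y p" if "p < 2 * n" for p
      proof (cases "p < n")
        case True
        then show ?thesis using eq by auto
      next
        case False
        then have "p - n < n" "n + (p - n) = p" using that by auto
        moreover have "\<forall>r<n. x (n + r) = y (n + r)" using eq by auto
        ultimately show ?thesis by metis
      qed
      moreover have "x \<in> {..<2 * n} \<rightarrow>\<^sub>E {..<U}" "y \<in> {..<2 * n} \<rightarrow>\<^sub>E {..<U}" using x y unfolding Om_def by blast+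
      ultimately show "x = y" by (intro PiE_ext[of x _ _ y]) auto
    qed
    have "0 < ff U (2 * n)" unfolding ff_def using U by (intro prod_pos) auto
    then show "Om \<noteq> {}" using card_Om by (metis card.empty less_irrefl)
  qed (rule finite_Om)
  also have "map_pmf ?o (map_pmf ?g (pmf_of_set Om)) = map_pmf (\<lambda>x. init_ops x @ mops x 0 n) (pmf_of_set Om)"
    unfolding map_pmf_comp
    by (intro map_pmf_cong refl) (simp add: ops_of_map init_ops_def mops_def lessThan_atLeast0)
  finally show ?thesis .
qed

lemma (in dyn_dict) expected_cost:
  assumes U: "2 * n \<le> U"
  shows "measure_pmf.expectation (hard_dist n U) (\<lambda>os. real (cost D os)) * card Om
      = (\<Sum>x\<in>Om. real (cost D (init_ops x @ mops x 0 n)))"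
    and "0 < card Om"
proof -
  have "0 < ff U (2 * n)" unfolding ff_def using U by (intro prod_pos) auto
  then show pos: "0 < card Om" using card_Om by simp
  then have ne: "Om \<noteq> {}" by auto
  show "measure_pmf.expectation (hard_dist n U) (\<lambda>os. real (cost D os)) * card Om
      = (\<Sum>x\<in>Om. real (cost D (init_ops x @ mops x 0 n)))"
    unfolding hard_dist_uniform[OF U] using pos by (simp add: integral_pmf_of_set[OF ne finite_Om])
qed

lemma (in dyn_dict) cost_split:
  "cost D (init_ops x @ mops x 0 n) = ops_cost D (init_ops x) (init_mem D) + ops_cost D (mops x 0 n) (Mem x 0)"
  using ops_cost_append[of D "init_ops x" "mops x 0 n" "init_mem D"] by (simp add: cost_def ops_cost_def Mem_def)

subsection \<open>Iterated logarithms\<close>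

lemma iter_log_0 [simp]: "iter_log 0 x = x"
  by (simp add: iter_log_def)

lemma iter_log_Suc: "iter_log (Suc j) x = log 2 (iter_log j x)"
  by (simp add: iter_log_def)

lemma ln2_half: "1 / 2 \<le> ln (2::real)"
  using ln2_ge_two_thirds by simp

lemma two_powr_ge_linear:
  fixes y :: real
  assumes "1 \<le> y"
  shows "y + 1 \<le> 2 powr y"
proof -
  have "1 + (y - 1) * ln 2 \<le> exp ((y - 1) * ln 2)" by (rule exp_ge_add_one_self)
  moreover have "(y - 1) * (1 / 2) \<le> (y - 1) * ln 2" using assms ln2_half by (intro mult_left_mono) auto
  ultimately have "y + 1 \<le> 2 * exp ((y - 1) * ln 2)" by (simp add: field_simps)
  also have "\<dots> = 2 * 2 powr (y - 1)" by (simp add: powr_def)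
  also have "\<dots> = 2 powr y" by (simp add: powr_diff)
  finally show ?thesis .
qed

lemma two_powr_ge: "(y::real) \<le> 2 powr y"
proof (cases "1 \<le> y")
  case True
  then show ?thesis using two_powr_ge_linear[of y] by simp
next
  case False
  show ?thesis
  proof (cases "0 \<le> y")
    case True
    then have "1 \<le> 2 powr y" by (simp add: ge_one_powr_ge_zero)
    then show ?thesis using False by simp
  next
    case False
    have "0 < 2 powr y" by simp
    then show ?thesis using False by linarith
  qed
qed

lemma two_log_le:
  fixes y :: real
  assumes "4 \<le> y"
  shows "2 * log 2 y \<le> y"
proof -
  have "ln (y / 4) \<le> y / 4 - 1" using assms by (intro ln_le_minus_one) simp
  moreover have "ln (y / 4) = ln y - 2 * ln 2"
  proof -
    have "ln (4::real) = ln (2 ^ 2)" by simp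
    also have "\<dots> = 2 * ln 2" by (subst ln_realpow) auto
    finally show ?thesis using assms by (simp add: ln_div)
  qed
  ultimately have 1: "2 * ln y \<le> 4 * ln 2 + (y - 4) / 2" by (simp add: field_simps)
  have "(y - 4) / 2 \<le> (y - 4) * ln 2" using assms mult_left_mono[OF ln2_half, of "y - 4"] by simp
  then have "2 * ln y \<le> y * ln 2" using 1 by (simp add: algebra_simps)
  then show ?thesis by (simp add: log_def field_simps)
qed

lemma iter_log_up:
  assumes pos: "\<And>j. j < k \<Longrightarrow> 1 < iter_log j x" and t: "t < k"
  shows "iter_log (k - Suc t) x = 2 powr iter_log (k - t) x"
proof -
  have "k - t = Suc (k - Suc t)" using t by simp
  then have "iter_log (k - t) x = log 2 (iter_log (k - Suc t) x)" by (simp only: iter_log_Suc)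
  moreover have "0 < iter_log (k - Suc t) x" using pos[of "k - Suc t"] t by simp
  ultimately show ?thesis by simp
qed

text \<open>Counted from the deep end, each step is an exponential and gains at least 1 once the
  value is at least 1. The maximum is there because \<open>iter_log k x\<close> itself may be below
  1.\<close>

lemma iter_log_growth:
  assumes pos: "\<And>j. j < k \<Longrightarrow> 1 < iter_log j x" and t: "t < k"
  shows "max 1 (iter_log k x) + real t \<le> iter_log (k - Suc t) x"
  using t
proof (induction t)
  case 0
  have "iter_log (k - 1) x = 2 powr iter_log k x" using iter_log_up[OF pos, of k 0] 0 by simp
  then show ?case using two_powr_ge[of "iter_log k x"] pos[of "k - 1"] 0 by simp
next
  case (Suc t)
  have "iter_log (k - Suc (Suc t)) x = 2 powr iter_log (k - Suc t) x"
    using iter_log_up[OF pos, of k "Suc t"] Suc.prems by simp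
  moreover have "iter_log (k - Suc t) x + 1 \<le> 2 powr iter_log (k - Suc t) x"
    using pos[of "k - Suc t"] Suc.prems by (intro two_powr_ge_linear) simp
  ultimately show ?case using Suc by simp
qed

text \<open>Giving up \<open>t + 2\<close> logarithms gains a factor \<open>2 ^ t\<close>, which
  absorbs the constants in the requirement on the first level.\<close>

lemma iter_log_exponential:
  assumes pos: "\<And>j. j < k \<Longrightarrow> 1 < iter_log j x" and t: "Suc t < k"
  shows "2 ^ t * (iter_log k x + 1) \<le> iter_log (k - Suc (Suc t)) x"
proof -
  let ?m = "max 1 (iter_log k x)"
  have "2 ^ t * (iter_log k x + 1) \<le> 2 ^ t * (?m + 1)" by (intro mult_left_mono) auto
  also have "\<dots> \<le> 2 ^ t * 2 powr ?m" by (intro mult_left_mono two_powr_ge_linear) auto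
  also have "\<dots> = 2 powr (?m + real t)" by (simp add: powr_add powr_realpow)
  also have "\<dots> \<le> 2 powr iter_log (k - Suc t) x"
    using iter_log_growth[OF pos, of k t] t by (intro powr_mono) auto
  also have "\<dots> = iter_log (k - Suc (Suc t)) x" using iter_log_up[OF pos, of k "Suc t"] t by simp
  finally show ?thesis .
qed

lemma iter_log_ge_4:
  assumes pos: "\<And>j. j < k \<Longrightarrow> 1 < iter_log j x" and j: "j + 4 \<le> k"
  shows "4 \<le> iter_log j x"
proof -
  have "max 1 (iter_log k x) + real (k - Suc j) \<le> iter_log (k - Suc (k - Suc j)) x"
    by (rule iter_log_growth[OF pos]) (use j in auto)
  moreover have "k - Suc (k - Suc j) = j" "3 \<le> k - Suc j" using j by auto
  ultimately show ?thesis by simp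
qed

lemma iter_log_le:
  assumes pos: "\<And>j. j < k \<Longrightarrow> 1 < iter_log j x" and ij: "i \<le> j" "j \<le> k"
  shows "iter_log j x \<le> iter_log i x"
  using ij
proof (induction j rule: dec_induct)
  case (step m)
  have "0 < iter_log m x" using pos[of m] step by simp
  then have "iter_log m x = 2 powr (log 2 (iter_log m x))" by simp
  then have "log 2 (iter_log m x) \<le> iter_log m x" using two_powr_ge[of "log 2 (iter_log m x)"] by linarith
  then show ?case using step by (simp add: iter_log_Suc)
qed simp

text \<open>The node sizes are \<open>L\<^sub>j = 2^(e - depth c j)\<close>; the increments are forced by \<open>log B \<ge> c L\<^sub>0 / L\<^sub>j\<close>.\<close>

primrec depth :: "real \<Rightarrow> nat \<Rightarrow> nat" where
  "depth c 0 = 0"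
| "depth c (Suc j) = depth c j + nat \<lceil>c * 2 ^ depth c j\<rceil> + 1"

text \<open>A level costs two logarithms: one undoes the exponential growth of
  \<open>2 ^ depth c j\<close>, the other absorbs the factor 2 in the invariant. The slack
  \<open>c + 2 \<le> c'\<close> covers the rounding and the \<open>+ 1\<close> in
  \<open>depth\<close>.\<close>

lemma depth_iter_log:
  assumes c: "0 < c" "c + 2 \<le> c'" and base: "2 * c' \<le> iter_log m x"
    and four: "\<And>j. j \<le> m \<Longrightarrow> 4 \<le> iter_log j x" and jm: "2 * j \<le> m"
  shows "2 * c' * 2 ^ depth c j \<le> iter_log (m - 2 * j) x"
  using jm
proof (induction j)
  case 0
  then show ?case using base by simp
next
  case (Suc j)
  define f where "f = depth c j"
  define v where "v = c' * 2 ^ f"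
  let ?\<kappa> = "nat \<lceil>c * 2 ^ f\<rceil>"
  define y where "y = iter_log (m - 2 * Suc j) x"
  have "m - 2 * j = Suc (Suc (m - 2 * Suc j))" using Suc.prems by simp
  then have e: "iter_log (m - 2 * j) x = log 2 (log 2 y)" by (simp only: iter_log_Suc y_def)
  have y4: "4 \<le> y" unfolding y_def by (rule four) simp
  have one: "(1::real) \<le> 2 ^ f" by simp
  have v0: "0 < v" using c by (simp add: v_def)
  have 1: "2 * v \<le> log 2 (log 2 y)" using Suc.IH Suc.prems unfolding e v_def f_def by simp
  have "real ?\<kappa> \<le> c * 2 ^ f + 1" using c by (simp add: of_nat_nat ceiling_correct)
  moreover have "c * 2 ^ f + 2 * 2 ^ f \<le> v" unfolding v_def using c(2) by (simp flip: distrib_right)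
  ultimately have \<kappa>: "real ?\<kappa> + 1 \<le> v" using one by linarith
  have "c' * 2 ^ depth c (Suc j) = v * 2 powr (real ?\<kappa> + 1)"
    unfolding v_def f_def by (simp add: power_add powr_add powr_realpow mult_ac)
  \<comment> \<open>\<open>2 powr v\<close> is spent twice, on the factor \<open>v\<close> and on
    the increment of the depth.\<close>
  also have "\<dots> \<le> 2 powr v * 2 powr v"
    using v0 two_powr_ge[of v] \<kappa> by (intro mult_mono powr_mono) auto
  also have "\<dots> = 2 powr (2 * v)" by (simp flip: powr_add)
  also have "\<dots> \<le> 2 powr (log 2 (log 2 y))" using 1 by (intro powr_mono) auto
  also have "\<dots> = log 2 y" using y4 by (intro powr_log_cancel) auto
  finally have "2 * c' * 2 ^ depth c (Suc j) \<le> 2 * log 2 y" by simp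
  also have "\<dots> \<le> y" by (rule two_log_le[OF y4])
  finally show ?case unfolding y_def .
qed

lemma depth_mono: "i \<le> j \<Longrightarrow> depth c i \<le> depth c j"
  by (rule lift_Suc_mono_le[of "depth c"]) simp_all

section \<open>The numerical conditions of a level\<close>

lemma le_of_log2_le:
  assumes "0 < X" "0 < Y" "log 2 (real X) \<le> log 2 (real Y)"
  shows "X \<le> Y"
  using assms by simp

text \<open>For the compression, \<open>W\<close> makes the patch cheap and \<open>C1\<close> pays
  for the redundancy and the cell sets. \<open>C2\<close> and \<open>C3\<close> make the information
  about the rows exceed the redundancy. The 10 in \<open>r + 10\<close> covers the other terms of
  order \<open>n\<close>: in the compression these are \<open>3 * S \<le> 6 * n\<close> for the cell
  sets, \<open>l \<le> n\<close> for halving \<open>U\<close>, and constants.\<close>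

lemma (in dyn_dict) level_okI:
  fixes a r lam :: real and g \<kappa> l d :: nat
  assumes n: "1 \<le> n" and U: "4 * n \<le> U" and r: "0 \<le> r"
    and space: "real S * real w \<le> log 2 (real (U choose n)) + real n * r"
    and lam: "lam = log 2 (real n)" and a: "a * lam \<le> log 2 (real U) - lam" and wU: "log 2 (real U) \<le> real w"
    and S: "S \<le> 2 * n"
    and l: "l = 2 ^ g * d" "1 \<le> d" "1 \<le> g" "l * 2 ^ \<kappa> \<le> n"
    and W: "4 * real d * real w \<le> a * real l * lam / 4"
    and C1: "real n * (r + 10) \<le> a / 2 * real l * lam"
    and C2: "2 * (2 ^ g + 4) \<le> \<kappa>" and C3: "16 * 2 ^ g * (real n * (r + 10)) \<le> real \<kappa> * real l * 2 ^ \<kappa>"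
  shows "level_ok l (2 ^ \<kappa>) d"
proof -
  have l0: "0 < l" using l by simp
  have U0: "0 < U" using U n by simp
  have nU: "n \<le> U" using U by simp
  have ln: "l \<le> n" and kn: "2 ^ \<kappa> \<le> n"
  proof -
    have "l \<le> l * 2 ^ \<kappa>" by simp
    then show "l \<le> n" using l(4) by (rule order.trans)
    have "2 ^ \<kappa> \<le> l * 2 ^ \<kappa>" using l0 by simp
    then show "2 ^ \<kappa> \<le> n" using l(4) by (rule order.trans)
  qed
  have bin: "0 < U choose n" using nU by simp
  have dl: "2 * d \<le> l"
  proof -
    have "2 ^ 1 * d \<le> 2 ^ g * d" using l(3) by (intro mult_le_mono1 power_increasing) auto
    then show ?thesis by (simp add: l(1))
  qed
  let ?b = "log 2 (real (U choose n))"
  let ?u = "log 2 (real U)"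
  have n1: "1 \<le> real n" using n by simp
  have nr: "real n * (r + 10) = real n * r + 10 * real n" by (simp add: algebra_simps)
  have Ssp: "real S * real w - ?b \<le> real n * r" using space by simp
  have H1: "8 * ((2 ^ w) ^ S * (2 ^ S * (2 ^ S * (2 ^ S * (2 ^ w) ^ (2 * d) * U ^ l))) * n ^ l)
      \<le> U ^ (l - 2 * d) * ((U choose n) * ff (U - n) l)"
  proof -
    have 1: "8 * ((2 ^ w) ^ S * (2 ^ S * (2 ^ S * (2 ^ S * (2 ^ w) ^ (2 * d) * U ^ l))) * n ^ l)
       = 2 ^ (3 + w * S + 3 * S + w * (2 * d)) * (U ^ l * n ^ l)"
    proof -
      have 8: "(8::nat) = 2 ^ 3" and 3: "3 * S = S + S + S" by simp_all
      show ?thesis unfolding 8 3 power_add power_mult by (simp only: mult_ac)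
    qed
    have half: "real U / 2 \<le> real (U - n - l)" using U ln by simp
    have f0: "0 < (U - n - l) ^ l" using U ln n by simp
    have "2 ^ (3 + w * S + 3 * S + w * (2 * d)) * (U ^ l * n ^ l) \<le> U ^ (l - 2 * d) * ((U choose n) * (U - n - l) ^ l)"
    proof (rule le_of_log2_le)
      show "0 < 2 ^ (3 + w * S + 3 * S + w * (2 * d)) * (U ^ l * n ^ l)" using U0 n by simp
      show "0 < U ^ (l - 2 * d) * ((U choose n) * (U - n - l) ^ l)" using U0 bin f0 by simp
      let ?v = "log 2 (real (U - n - l))"
      have L: "log 2 (real (2 ^ (3 + w * S + 3 * S + w * (2 * d)) * (U ^ l * n ^ l)))
        = 3 + real S * real w + 3 * real S + 2 * (real d * real w) + real l * ?u + real l * lam"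
        using U0 n by (simp add: log_mult log_nat_power lam algebra_simps)
      have R: "log 2 (real (U ^ (l - 2 * d) * ((U choose n) * (U - n - l) ^ l)))
        = real l * ?u - 2 * (real d * ?u) + ?b + real l * ?v"
        using U0 bin f0 dl U ln n by (simp add: log_mult log_nat_power of_nat_diff algebra_simps)
      have "log 2 (real U / 2) \<le> ?v" using half U0 by (subst log_le_cancel_iff) auto
      then have hl: "?u - 1 \<le> ?v" using U0 by (simp add: log_divide)
      have "real l * ?u - real l \<le> real l * ?v" using mult_left_mono[OF hl, of "real l"] by (simp add: right_diff_distrib)
      moreover have "a * real l * lam \<le> real l * ?u - real l * lam"
        using mult_left_mono[OF a, of "real l"] by (simp add: right_diff_distrib mult_ac)
      moreover have "real d * ?u \<le> real d * real w" by (rule mult_left_mono[OF wU]) simp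
      moreover have "0 \<le> real d * real w" by simp
      moreover have "real S \<le> 2 * real n" using S by linarith
      moreover have "real l \<le> real n" using ln by simp
      moreover have "4 * (real d * real w) \<le> a * real l * lam / 4" using W by simp
      moreover have "real n * r + 10 * real n \<le> (a * real l * lam) / 2" using C1 nr by simp
      ultimately show "log 2 (real (2 ^ (3 + w * S + 3 * S + w * (2 * d)) * (U ^ l * n ^ l)))
        \<le> log 2 (real (U ^ (l - 2 * d) * ((U choose n) * (U - n - l) ^ l)))"
        unfolding L R using Ssp n1 by linarith
    qed
    also have "\<dots> \<le> U ^ (l - 2 * d) * ((U choose n) * ff (U - n) l)"
      by (intro mult_le_mono2 ff_ge)
    finally show ?thesis unfolding 1 .
  qed
  \<comment> \<open>The exponent gives up \<open>2 ^ g\<close> for the factor \<open>2 ^ l\<close>,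
    as \<open>l = 2 ^ g * d\<close>, and 4 for the constant factor 16 in \<open>H2\<close>; by
    \<open>C2\<close> at least half of \<open>\<kappa>\<close> is left.\<close>
  define \<beta> where "\<beta> = \<kappa> - 2 ^ g - 4"
  have \<beta>: "\<beta> + 2 ^ g + 4 = \<kappa>" "\<kappa> \<le> 2 * \<beta>" using C2 by (simp_all add: \<beta>_def)
  have \<kappa>3: "3 \<le> \<kappa>" using C2 by simp
  have H2: "8 * (2 ^ (d * \<beta>) * 2 ^ Suc l) \<le> ((2::nat) ^ \<kappa>) ^ d"
  proof -
    have "8 * (2 ^ (d * \<beta>) * 2 ^ Suc l) = (2::nat) ^ (3 + d * \<beta> + Suc l)" by (simp add: power_add)
    also have "\<dots> \<le> 2 ^ (\<kappa> * d)"
    proof (rule power_increasing)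
      have "\<kappa> * d = d * \<beta> + 2 ^ g * d + 4 * d" by (simp flip: \<beta>(1) add: algebra_simps)
      then show "3 + d * \<beta> + Suc l \<le> \<kappa> * d" using l(1,2) by simp
    qed simp
    finally show ?thesis unfolding power_mult[of "2::nat" \<kappa> d] .
  qed
  \<comment> \<open>\<open>2 ^ (\<kappa> - 3)\<close> is the value of \<open>b\<close>, one eighth
    of the children considered; each good child yields \<open>d * \<beta>\<close> bits.\<close>
  have H3: "8 * ((2 ^ w) ^ S * 2 ^ (2 ^ \<kappa>)) \<le> (2 ^ (d * \<beta>)) ^ (2 ^ (\<kappa> - 3)) * (U choose n)"
  proof (rule le_of_log2_le)
    show "0 < (8::nat) * ((2 ^ w) ^ S * 2 ^ (2 ^ \<kappa>))" by simp
    show "0 < (2 ^ (d * \<beta>)) ^ (2 ^ (\<kappa> - 3)) * (U choose n)" using bin by simp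
    have e: "8 * ((2 ^ w) ^ S * 2 ^ (2 ^ \<kappa>)) = (2::nat) ^ (3 + w * S + 2 ^ \<kappa>)" by (simp add: power_add power_mult)
    have L: "log 2 (real (8 * ((2 ^ w) ^ S * 2 ^ (2 ^ \<kappa>)))) = 3 + real S * real w + 2 ^ \<kappa>"
      unfolding e of_nat_power by (simp add: log_nat_power)
    have R: "log 2 (real ((2 ^ (d * \<beta>)) ^ (2 ^ (\<kappa> - 3)) * (U choose n))) = real d * real \<beta> * 2 ^ (\<kappa> - 3) + ?b"
      using bin by (simp add: log_mult log_nat_power)
    have k8: "(2::real) ^ \<kappa> = 8 * 2 ^ (\<kappa> - 3)"
    proof -
      have "(2::real) ^ \<kappa> = 2 ^ (3 + (\<kappa> - 3))" using \<kappa>3 by simp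
      then show ?thesis unfolding power_add by simp
    qed
    have "16 * 2 ^ g * (real n * (r + 10)) \<le> real \<kappa> * (2 ^ g * real d) * 2 ^ \<kappa>" using C3 by (simp add: l(1))
    also have "\<dots> = 2 ^ g * (real \<kappa> * real d * (8 * 2 ^ (\<kappa> - 3)))" unfolding k8 by (simp only: mult_ac)
    also have "\<dots> \<le> 2 ^ g * ((2 * real \<beta>) * real d * (8 * 2 ^ (\<kappa> - 3)))"
    proof -
      have "real \<kappa> \<le> 2 * real \<beta>" using \<beta>(2) by linarith
      then show ?thesis by (intro mult_left_mono mult_right_mono) auto
    qed
    also have "\<dots> = 16 * 2 ^ g * (real d * real \<beta> * 2 ^ (\<kappa> - 3))" by simp
    finally have "16 * 2 ^ g * (real n * (r + 10)) \<le> 16 * 2 ^ g * (real d * real \<beta> * 2 ^ (\<kappa> - 3))" .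
    then have "real n * (r + 10) \<le> real d * real \<beta> * 2 ^ (\<kappa> - 3)" by simp
    moreover have "(2::real) ^ \<kappa> \<le> real n" using kn by (metis of_nat_le_iff of_nat_numeral of_nat_power)
    ultimately show "log 2 (real (8 * ((2 ^ w) ^ S * 2 ^ (2 ^ \<kappa>)))) \<le> log 2 (real ((2 ^ (d * \<beta>)) ^ (2 ^ (\<kappa> - 3)) * (U choose n)))"
      unfolding L R using Ssp nr n1 by linarith
  qed
  have H4: "8 * 2 ^ (\<kappa> - 3) \<le> (2::nat) ^ \<kappa>"
  proof -
    have "(2::nat) ^ \<kappa> = 2 ^ (3 + (\<kappa> - 3))" using \<kappa>3 by simp
    then show ?thesis unfolding power_add by simp
  qed
  have "2 * 2 ^ \<kappa> \<le> U" using kn U by simp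
  moreover have "\<exists>K b. 8 * (K * 2 ^ Suc l) \<le> (2 ^ \<kappa>) ^ d \<and> 8 * ((2 ^ w) ^ S * 2 ^ 2 ^ \<kappa>) \<le> K ^ b * (U choose n) \<and> 8 * b \<le> 2 ^ \<kappa>"
    by (rule exI[of _ "2 ^ (d * \<beta>)"], rule exI[of _ "2 ^ (\<kappa> - 3)"], intro conjI H2 H3 H4)
  moreover have "0 < (2::nat) ^ \<kappa>" by simp
  ultimately show ?thesis unfolding level_ok_def using l0 dl H1 by (intro conjI)
qed

text \<open>Only the first \<open>2 ^ e\<close> meta-operations are used, more than half of them.
  \<open>D1\<close> stops before the nodes are too short for the compression to pay for the
  redundancy. In \<open>c\<close>, 64 is the 16 of \<open>C3\<close>, doubled for
  \<open>n < 2 * 2 ^ e\<close> and again because a node has length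
  \<open>2 * 2 ^ \<kappa> * l\<close>.\<close>

lemma (in dyn_dict) many_levels:
  fixes \<alpha> r lam :: real
  assumes n: "1 \<le> n" and U: "4 * n \<le> U" and r: "0 \<le> r"
    and space: "real S * real w \<le> log 2 (real (U choose n)) + real n * r"
    and lam: "lam = log 2 (real n)" and a: "\<alpha> * lam \<le> log 2 (real U) - lam" and wU: "log 2 (real U) \<le> real w"
    and S: "S \<le> 2 * n" and g: "1 \<le> g" and W: "16 * real w \<le> 2 ^ g * \<alpha> * lam"
    and e: "2 ^ e \<le> n" "n < 2 * 2 ^ e"
    and c: "c = 64 * 2 ^ g * (r + 10)"
    and D1: "(r + 10) * 2 ^ depth c J \<le> \<alpha> / 4 * lam" and D2: "depth c J + g \<le> e"
  shows "J * (2 ^ e * card Om) \<le> 4 * 2 ^ g * (\<Sum>x\<in>Om. \<Sum>p<n. card (Tch x p (Suc p)))"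
proof -
  define E where "E = (\<lambda>j. e - depth c j)"
  have le: "depth c j + g \<le> e" if "j \<le> J" for j
    using depth_mono[OF that, of c] D2 by simp
  have E0: "E 0 = e" by (simp add: E_def)
  have "J * (2 ^ E 0 * card Om) \<le> 4 * 2 ^ g * (\<Sum>x\<in>Om. \<Sum>p<n. card (Tch x p (Suc p)))"
  proof (rule levels_bound[OF U])
    show "2 ^ E 0 \<le> n" using e E0 by simp
    fix j assume j: "j < J"
    \<comment> \<open>\<open>2 ^ \<kappa>\<close> is half the number of children; the
      \<open>+ 1\<close> in \<open>depth\<close> accounts for the other half.\<close>
    define \<kappa> where "\<kappa> = nat \<lceil>c * 2 ^ depth c j\<rceil>"
    have dS: "depth c (Suc j) = depth c j + \<kappa> + 1" by (simp add: \<kappa>_def)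
    have leS: "depth c j + \<kappa> + 1 + g \<le> e" using le[of "Suc j"] j dS by simp
    show "E (Suc j) < E j" using leS dS unfolding E_def by linarith
    show gE: "g \<le> E (Suc j)" using leS dS unfolding E_def by linarith
    have \<kappa>E: "E j - E (Suc j) - 1 = \<kappa>" using leS dS unfolding E_def by linarith
    define l where "l = (2::nat) ^ E (Suc j)"
    have eS: "2 ^ e = l * 2 ^ depth c (Suc j)"
      unfolding l_def E_def power_add[symmetric] using leS dS by simp
    have e2: "2 ^ e = 2 * (l * 2 ^ \<kappa>) * 2 ^ depth c j"
      unfolding eS dS by (simp add: power_add mult_ac)
    have c0: "640 * 2 ^ g \<le> c" using r unfolding c by simp
    have "c * 1 \<le> c * 2 ^ depth c j"
    proof (rule mult_left_mono)
      have "0 \<le> (640::real) * 2 ^ g" by simp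
      then show "0 \<le> c" using c0 by linarith
    qed simp
    moreover have ck: "c * 2 ^ depth c j \<le> real \<kappa>" unfolding \<kappa>_def by (rule real_nat_ceiling_ge)
    ultimately have \<kappa>g: "640 * 2 ^ g \<le> real \<kappa>" using c0 by linarith
    have nl: "real n < 2 * 2 ^ e" using e(2) by (metis of_nat_less_iff of_nat_mult of_nat_numeral of_nat_power)
    have reS: "(2::real) ^ e = real l * 2 ^ depth c (Suc j)"
      using arg_cong[OF eS, of real] by simp
    have re2: "(2::real) ^ e = 2 * (real l * 2 ^ \<kappa>) * 2 ^ depth c j"
      using arg_cong[OF e2, of real] by simp
    have "level_ok l (2 ^ \<kappa>) (2 ^ (E (Suc j) - g))"
    proof (rule level_okI[OF n U r space lam a wU S])
      show "l = 2 ^ g * 2 ^ (E (Suc j) - g)" unfolding l_def power_add[symmetric] using gE by simp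
      show "1 \<le> (2::nat) ^ (E (Suc j) - g)" by simp
      show "1 \<le> g" by (rule g)
      have "l * 2 ^ \<kappa> \<le> 2 ^ e" unfolding e2 by simp
      then show "l * 2 ^ \<kappa> \<le> n" using e(1) by linarith
      show "4 * real (2 ^ (E (Suc j) - g)) * real w \<le> \<alpha> * real l * lam / 4"
      proof -
        have "(2::real) ^ E (Suc j) = 2 ^ g * 2 ^ (E (Suc j) - g)" unfolding power_add[symmetric] using gE by simp
        then have "\<alpha> * real l * lam = 2 ^ (E (Suc j) - g) * (2 ^ g * \<alpha> * lam)" by (simp add: l_def)
        moreover have "2 ^ (E (Suc j) - g) * (16 * real w) \<le> 2 ^ (E (Suc j) - g) * (2 ^ g * \<alpha> * lam)"
          by (rule mult_left_mono[OF W]) simp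
        ultimately have "2 ^ (E (Suc j) - g) * (16 * real w) \<le> \<alpha> * real l * lam" by (simp only:)
        then show ?thesis by (simp add: mult_ac)
      qed
      show "real n * (r + 10) \<le> \<alpha> / 2 * real l * lam"
      proof -
        have "(r + 10) * 2 ^ depth c (Suc j) \<le> (r + 10) * 2 ^ depth c J"
          using r depth_mono[of "Suc j" J c] j by (intro mult_left_mono power_increasing) auto
        then have 1: "(r + 10) * 2 ^ depth c (Suc j) \<le> \<alpha> / 4 * lam" using D1 by linarith
        have "real n * (r + 10) \<le> (2 * 2 ^ e) * (r + 10)" using nl r by (intro mult_right_mono) auto
        also have "\<dots> = 2 * real l * ((r + 10) * 2 ^ depth c (Suc j))" unfolding reS by (simp only: mult_ac)
        also have "\<dots> \<le> 2 * real l * (\<alpha> / 4 * lam)" by (rule mult_left_mono[OF 1]) simp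
        finally show ?thesis by (simp add: mult_ac)
      qed
      show "2 * (2 ^ g + 4) \<le> \<kappa>"
      proof -
        have "(1::real) \<le> 2 ^ g" by simp
        moreover have "real (2 * (2 ^ g + 4)) = 2 * 2 ^ g + 8" by simp
        ultimately have "real (2 * (2 ^ g + 4)) \<le> real \<kappa>" using \<kappa>g by linarith
        then show ?thesis by (simp only: of_nat_le_iff)
      qed
      show "16 * 2 ^ g * (real n * (r + 10)) \<le> real \<kappa> * real l * 2 ^ \<kappa>"
      proof -
        have "real n * (r + 10) \<le> (2 * 2 ^ e) * (r + 10)" using nl r by (intro mult_right_mono) auto
        then have "16 * 2 ^ g * (real n * (r + 10)) \<le> 16 * 2 ^ g * ((2 * 2 ^ e) * (r + 10))" by (intro mult_left_mono) auto
        also have "\<dots> = (c * 2 ^ depth c j) * (real l * 2 ^ \<kappa>)" unfolding re2 c by simp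
        also have "\<dots> \<le> real \<kappa> * (real l * 2 ^ \<kappa>)" by (rule mult_right_mono[OF ck]) simp
        finally show ?thesis by (simp only: mult.assoc)
      qed
    qed
    then show "level_ok (2 ^ E (Suc j)) (2 ^ (E j - E (Suc j) - 1)) (2 ^ (E (Suc j) - g))"
      unfolding \<kappa>E l_def .
  qed
  then show ?thesis unfolding E0 .
qed

section \<open>The parameters of the theorem\<close>

lemma universe_bounds:
  fixes \<alpha> :: real
  assumes \<alpha>: "0 < \<alpha>" and n: "1 \<le> n" and U: "U = nat \<lceil>real n powr (1 + \<alpha>)\<rceil>" and w: "w = nat \<lceil>log 2 (real U)\<rceil>"
  shows "real n * real n powr \<alpha> \<le> real U" "(1 + \<alpha>) * log 2 (real n) \<le> log 2 (real U)"
    "log 2 (real U) \<le> real w" "real w \<le> (1 + \<alpha>) * log 2 (real n) + 2"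
proof -
  let ?x = "real n powr (1 + \<alpha>)"
  have n1: "1 \<le> real n" using n by simp
  have x1: "1 \<le> ?x" using n1 \<alpha> by (intro ge_one_powr_ge_zero) auto
  have Ux: "?x \<le> real U" unfolding U by (rule real_nat_ceiling_ge)
  have Ux2: "real U \<le> 2 * ?x"
  proof -
    have "real U = real_of_int \<lceil>?x\<rceil>" unfolding U using x1 by simp
    also have "\<dots> \<le> ?x + 1" by linarith
    finally show ?thesis using x1 by linarith
  qed
  have U0: "1 \<le> real U" using Ux x1 by linarith
  have "?x = real n * real n powr \<alpha>" using n1 by (simp add: powr_add)
  then show "real n * real n powr \<alpha> \<le> real U" using Ux by simp
  have lx: "log 2 ?x = (1 + \<alpha>) * log 2 (real n)" using n1 by (simp add: log_powr)
  have "log 2 ?x \<le> log 2 (real U)" using Ux x1 n by (intro log_mono) auto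
  then show "(1 + \<alpha>) * log 2 (real n) \<le> log 2 (real U)" using lx by simp
  show "log 2 (real U) \<le> real w" unfolding w by (rule real_nat_ceiling_ge)
  have "log 2 (real U) \<le> log 2 (2 * ?x)" using Ux2 U0 by (intro log_mono) auto
  also have "\<dots> = 1 + log 2 ?x" using n by (simp add: log_mult)
  finally have 1: "log 2 (real U) \<le> (1 + \<alpha>) * log 2 (real n) + 1" using lx by simp
  have "0 \<le> log 2 (real U)" using U0 by simp
  then have "real w = real_of_int \<lceil>log 2 (real U)\<rceil>" unfolding w by simp
  also have "\<dots> \<le> log 2 (real U) + 1" by linarith
  finally show "real w \<le> (1 + \<alpha>) * log 2 (real n) + 2" using 1 by linarith
qed

lemma (in dyn_dict) expected_cost_base:
  fixes \<alpha> :: real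
  assumes \<alpha>: "0 < \<alpha>" and n: "1 \<le> n" and U: "4 * n \<le> U" and lam: "lam = log 2 (real n)" and big: "6 \<le> \<alpha> * lam"
    and a: "\<alpha> * lam \<le> log 2 (real U) - lam" and w: "real w \<le> 2 * (1 + \<alpha>) * lam" and S: "S \<le> 2 * n"
    and nb: "16 * (1 + \<alpha>) / \<alpha> \<le> real n"
  shows "\<alpha> / (32 * (1 + \<alpha>)) * real n \<le> measure_pmf.expectation (hard_dist n U) (\<lambda>os. real (cost D os))"
proof -
  let ?e = "measure_pmf.expectation (hard_dist n U) (\<lambda>os. real (cost D os))"
  \<comment> \<open>Patching \<open>y\<close> words of at most
    \<open>2 * (1 + \<alpha>) * lam\<close> bits costs a quarter of the
    \<open>n * \<alpha> * lam\<close> bits that the initial set contains at least.\<close>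
  define y where "y = \<alpha> * real n / (8 * (1 + \<alpha>))"
  define q where "q = nat \<lfloor>y\<rfloor>"
  have y2: "2 \<le> y" using \<alpha> nb unfolding y_def by (simp add: field_simps)
  have qy: "real q \<le> y" "y - 1 \<le> real q" using y2 unfolding q_def by linarith+
  have nU: "n \<le> U" "2 * n \<le> U" using U by simp_all
  have U0: "0 < U" using n U by simp
  have n1: "1 \<le> real n" using n by simp
  have lam0: "0 \<le> lam" using n1 lam by simp
  have H: "2 * (2 ^ S * (2 ^ w) ^ q) \<le> U choose n"
  proof (rule le_of_log2_le)
    show "0 < (2::nat) * (2 ^ S * (2 ^ w) ^ q)" by simp
    show b0: "0 < U choose n" using nU by simp
    have e: "2 * (2 ^ S * (2 ^ w) ^ q) = (2::nat) ^ (1 + S + w * q)" by (simp add: power_add power_mult)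
    have L: "log 2 (real (2 * (2 ^ S * (2 ^ w) ^ q))) = 1 + real S + real w * real q"
      unfolding e of_nat_power of_nat_numeral by (subst log_nat_power) simp_all
    have "(real U / real n) ^ n \<le> real (U choose n)" using binomial_ge_n_over_k_pow_k[OF nU(1), where ?'a = real] by simp
    moreover have "0 < (real U / real n) ^ n" using U0 n by simp
    ultimately have "log 2 ((real U / real n) ^ n) \<le> log 2 (real (U choose n))" by (intro log_mono) auto
    moreover have "log 2 ((real U / real n) ^ n) = real n * (log 2 (real U) - lam)"
      using U0 n lam by (simp add: log_nat_power log_divide)
    moreover have "real n * (\<alpha> * lam) \<le> real n * (log 2 (real U) - lam)" by (rule mult_left_mono[OF a]) simp
    ultimately have R: "real n * (\<alpha> * lam) \<le> log 2 (real (U choose n))" by linarith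
    have "real w * real q \<le> (2 * (1 + \<alpha>) * lam) * y" using w qy(1) lam0 \<alpha> by (intro mult_mono) auto
    also have "\<dots> = real n * (\<alpha> * lam) / 4"
    proof -
      have "1 + \<alpha> \<noteq> 0" using \<alpha> by simp
      then show ?thesis unfolding y_def by (simp add: field_simps)
    qed
    finally have 1: "real w * real q \<le> real n * (\<alpha> * lam) / 4" .
    have 2: "real n * 6 \<le> real n * (\<alpha> * lam)" by (rule mult_left_mono[OF big]) simp
    have "real S \<le> 2 * real n" using S by linarith
    then show "log 2 (real (2 * (2 ^ S * (2 ^ w) ^ q))) \<le> log 2 (real (U choose n))"
      unfolding L using 1 2 R n1 by linarith
  qed
  have "q * card Om \<le> 2 * (\<Sum>x\<in>Om. ops_cost D (init_ops x) (init_mem D))" by (rule base_bound[OF nU(1) H])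
  also have "\<dots> \<le> 2 * (\<Sum>x\<in>Om. cost D (init_ops x @ mops x 0 n))"
    unfolding cost_split by (intro mult_le_mono2 sum_mono) simp
  finally have "real (q * card Om) \<le> real (2 * (\<Sum>x\<in>Om. cost D (init_ops x @ mops x 0 n)))"
    by (simp only: of_nat_le_iff)
  then have "real q * real (card Om) \<le> 2 * (\<Sum>x\<in>Om. real (cost D (init_ops x @ mops x 0 n)))" by simp
  also have "\<dots> = (2 * ?e) * real (card Om)" using expected_cost(1)[OF nU(2)] by simp
  finally have "real q \<le> 2 * ?e" using expected_cost(2)[OF nU(2)] by simp
  moreover have "y / 2 \<le> y - 1" using y2 by simp
  \<comment> \<open>One factor 2 is lost in rounding \<open>y\<close> to \<open>q\<close> and one in
    \<open>base_bound\<close>.\<close>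
  ultimately have "y / 4 \<le> ?e" using qy(2) by linarith
  then show ?thesis unfolding y_def by simp
qed

lemma (in dyn_dict) expected_cost_levels:
  assumes U: "2 * n \<le> U" and e: "n < 2 * 2 ^ e"
    and H: "J * (2 ^ e * card Om) \<le> 4 * 2 ^ g * (\<Sum>x\<in>Om. \<Sum>p<n. card (Tch x p (Suc p)))"
  shows "real J * real n / (8 * 2 ^ g) \<le> measure_pmf.expectation (hard_dist n U) (\<lambda>os. real (cost D os))"
proof -
  let ?e = "measure_pmf.expectation (hard_dist n U) (\<lambda>os. real (cost D os))"
  have "J * (2 ^ e * card Om) \<le> 4 * 2 ^ g * (\<Sum>x\<in>Om. cost D (init_ops x @ mops x 0 n))"
  proof (rule order.trans[OF H], intro mult_le_mono2 sum_mono)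
    fix x
    show "(\<Sum>p<n. card (Tch x p (Suc p))) \<le> cost D (init_ops x @ mops x 0 n)"
      using cost_ge[of x n] unfolding cost_split by simp
  qed
  then have "real (J * (2 ^ e * card Om)) \<le> real (4 * 2 ^ g * (\<Sum>x\<in>Om. cost D (init_ops x @ mops x 0 n)))"
    by (simp only: of_nat_le_iff)
  then have "(real J * 2 ^ e) * real (card Om) \<le> 4 * 2 ^ g * (\<Sum>x\<in>Om. real (cost D (init_ops x @ mops x 0 n)))"
    by (simp add: mult_ac)
  also have "\<dots> = (4 * 2 ^ g * ?e) * real (card Om)" using expected_cost(1)[OF U] by simp
  finally have 1: "real J * 2 ^ e \<le> 4 * 2 ^ g * ?e" using expected_cost(2)[OF U] by simp
  have "real n \<le> 2 * 2 ^ e" using e by (metis less_imp_le of_nat_le_iff of_nat_mult of_nat_numeral of_nat_power)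
  then have "real J * real n \<le> real J * (2 * 2 ^ e)" by (intro mult_left_mono) auto
  then have "real J * real n \<le> (8 * 2 ^ g) * ?e" using 1 by linarith
  then show ?thesis by (simp add: field_simps)
qed

subsection \<open>The lower bound\<close>

theorem theorem4:
  fixes \<alpha> :: real
  assumes "\<alpha> > 0"
  shows "\<exists>c>0. \<exists>n0::nat. \<forall>n\<ge>n0. \<forall>k::nat. 1 \<le> k \<and> k \<le> log_star (real n) \<longrightarrow>
           (\<forall>(D::dict) (S::nat).
              let U = nat \<lceil>real n powr (1 + \<alpha>)\<rceil>; w = nat \<lceil>log 2 (real U)\<rceil> in
              dictionary n U w S D \<and>
              real S * real w \<le> log 2 (real (U choose n)) + real n * iter_log k (real n)
              \<longrightarrow> measure_pmf.expectation (hard_dist n U) (\<lambda>os. real (cost D os))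
                    \<ge> c * real n * real k)"
proof -
  note \<alpha> = assms
  \<comment> \<open>Chosen for \<open>16 * w \<le> 2 ^ g * \<alpha> * lam\<close>, given that
    \<open>w \<le> 2 * (1 + \<alpha>) * lam\<close>.\<close>
  obtain g0 where g0: "32 * (1 + \<alpha>) / \<alpha> < 2 ^ g0" using real_arch_pow[of 2 "32 * (1 + \<alpha>) / \<alpha>"] by auto
  define g where "g = Suc g0"
  have g: "32 * (1 + \<alpha>) / \<alpha> \<le> 2 ^ g" "1 \<le> g"
  proof -
    have "(2::real) ^ g0 \<le> 2 ^ g" unfolding g_def by (intro power_increasing) auto
    then show "32 * (1 + \<alpha>) / \<alpha> \<le> 2 ^ g" using g0 by linarith
  qed (simp add: g_def)
  \<comment> \<open>\<open>A * (r + 10)\<close> will be the growth constant \<open>cc\<close>. As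
    \<open>2 * (cc + 2)\<close> is at most \<open>20 * (A + 1) * (r + 1)\<close>, giving up
    \<open>t + 2\<close> logarithms makes room for it.\<close>
  define A where "A = (64::real) * 2 ^ g"
  obtain t0 where t0: "20 * (A + 1) < 2 ^ t0" using real_arch_pow[of 2 "20 * (A + 1)"] by auto
  define t where "t = t0 + 2"
  have t: "20 * (A + 1) \<le> 2 ^ t" "2 \<le> t"
  proof -
    have "(2::real) ^ t0 \<le> 2 ^ t" unfolding t_def by (intro power_increasing) auto
    then show "20 * (A + 1) \<le> 2 ^ t" using t0 by linarith
  qed (simp add: t_def)
  \<comment> \<open>The choice of \<open>J\<close> below gives \<open>k \<le> 2 * J + t + 5\<close>.
    From \<open>k1\<close> on, \<open>t + 5\<close> is below \<open>k / 2\<close>, so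
    \<open>k \<le> 4 * J\<close>.\<close>
  define k1 where "k1 = 2 * t + 12"
  define c1 where "c1 = \<alpha> / (32 * (1 + \<alpha>)) / real k1"
  define c2 where "c2 = 1 / (32 * (2::real) ^ g)"
  define c where "c = min c1 c2"
  have k10: "0 < real k1" by (simp add: k1_def)
  have c1: "0 < c1" unfolding c1_def using \<alpha> k10 by simp
  have c0: "0 < c" "c \<le> c1" "c \<le> c2" using c1 by (simp_all add: c_def c2_def)
  have "\<forall>\<^sub>F x::real in at_top. 4 \<le> log 2 x" by real_asymp
  moreover have "\<forall>\<^sub>F x::real in at_top. 6 \<le> \<alpha> * log 2 x" using \<alpha> by real_asymp
  moreover have "\<forall>\<^sub>F x::real in at_top. 4 \<le> x powr \<alpha>" using \<alpha> by real_asymp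
  moreover have "\<forall>\<^sub>F x::real in at_top. log 2 (log 2 x) \<le> \<alpha> / 4 * log 2 x" using \<alpha> by real_asymp
  moreover have "\<forall>\<^sub>F x::real in at_top. 2 ^ g * log 2 (log 2 x) \<le> x / 2" by real_asymp
  moreover have "\<forall>\<^sub>F x::real in at_top. 16 * (1 + \<alpha>) / \<alpha> \<le> x" by real_asymp
  ultimately have "\<forall>\<^sub>F x::real in at_top. 4 \<le> log 2 x \<and> 6 \<le> \<alpha> * log 2 x \<and> 4 \<le> x powr \<alpha>
      \<and> log 2 (log 2 x) \<le> \<alpha> / 4 * log 2 x \<and> 2 ^ g * log 2 (log 2 x) \<le> x / 2 \<and> 16 * (1 + \<alpha>) / \<alpha> \<le> x"
    by (intro eventually_conj)
  then obtain x0 where x0: "\<And>x. x0 \<le> x \<Longrightarrow> 4 \<le> log 2 x \<and> 6 \<le> \<alpha> * log 2 x \<and> 4 \<le> x powr \<alpha>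
      \<and> log 2 (log 2 x) \<le> \<alpha> / 4 * log 2 x \<and> 2 ^ g * log 2 (log 2 x) \<le> x / 2 \<and> 16 * (1 + \<alpha>) / \<alpha> \<le> x"
    unfolding eventually_at_top_linorder by blast
  define n0 where "n0 = max 1 (nat \<lceil>x0\<rceil>)"
  have "c * real n * real k \<le> measure_pmf.expectation (hard_dist n U) (\<lambda>os. real (cost D os))"
    if nn: "n0 \<le> n" and k: "1 \<le> k" "k \<le> log_star (real n)" and U: "U = nat \<lceil>real n powr (1 + \<alpha>)\<rceil>"
      and w: "w = nat \<lceil>log 2 (real U)\<rceil>" and D: "dictionary n U w S D"
      and sp: "real S * real w \<le> log 2 (real (U choose n)) + real n * iter_log k (real n)"
    for n k D S U w
  proof -
    interpret dyn_dict D n U w S by (unfold_locales) (rule D)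
    let ?e = "measure_pmf.expectation (hard_dist n U) (\<lambda>os. real (cost D os))"
    define lam where "lam = log 2 (real n)"
    define r where "r = iter_log k (real n)"
    have n1: "1 \<le> n" using nn by (simp add: n0_def)
    have "x0 \<le> real n" using nn unfolding n0_def by linarith
    from x0[OF this] have big: "4 \<le> lam" "6 \<le> \<alpha> * lam" "4 \<le> real n powr \<alpha>" "log 2 lam \<le> \<alpha> / 4 * lam"
      "2 ^ g * log 2 lam \<le> real n / 2" "16 * (1 + \<alpha>) / \<alpha> \<le> real n" unfolding lam_def by blast+
    note ub = universe_bounds[OF \<alpha> n1 U w, folded lam_def]
    have "real n * 4 \<le> real n * real n powr \<alpha>" by (rule mult_left_mono[OF big(3)]) simp
    then have "real (4 * n) \<le> real U" using ub(1) by simp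
    then have U4: "4 * n \<le> U" by (simp only: of_nat_le_iff)
    have a: "\<alpha> * lam \<le> log 2 (real U) - lam" using ub(2) by (simp add: algebra_simps)
    have "0 \<le> \<alpha> * lam" using big(2) by linarith
    then have w2: "real w \<le> 2 * (1 + \<alpha>) * lam" using ub(4) big(1) by (simp add: algebra_simps)
    \<comment> \<open>Minimality in \<open>log_star\<close> keeps all iterates before the
      \<open>k\<close>-th above 1, so that every logarithm taken has a positive argument.\<close>
    have pos: "1 < iter_log j (real n)" if "j < k" for j
    proof -
      have "j < (LEAST k. iter_log k (real n) \<le> 1)" using that k(2) by (simp add: log_star_def)
      from not_less_Least[OF this] show ?thesis by simp
    qed
    have r0: "0 \<le> r"
    proof -
      have "k = Suc (k - 1)" using k(1) by simp
      then have "r = log 2 (iter_log (k - 1) (real n))" unfolding r_def using iter_log_Suc by metis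
      then show ?thesis using pos[of "k - 1"] k(1) by simp
    qed
    have rlam: "r \<le> lam"
      unfolding r_def lam_def using iter_log_le[OF pos, of k 1 k] k(1) iter_log_Suc[of 0 "real n"] by simp
    \<comment> \<open>The binomial coefficient and the redundancy take at most \<open>n\<close>
      words each.\<close>
    have S2: "S \<le> 2 * n"
    proof -
      have U0: "0 < U" "n \<le> U" using U4 n1 by auto
      have "real (U choose n) \<le> real (U ^ n)" using binomial_le_pow[OF U0(2)] by (simp only: of_nat_le_iff)
      then have "log 2 (real (U choose n)) \<le> log 2 (real (U ^ n))" using U0 by (intro log_mono) auto
      also have "\<dots> = real n * log 2 (real U)" using U0 by (simp add: log_nat_power)
      also have "\<dots> \<le> real n * real w" by (rule mult_left_mono[OF ub(3)]) simp
      finally have 1: "log 2 (real (U choose n)) \<le> real n * real w" .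
      have lw: "lam \<le> real w" using a \<open>0 \<le> \<alpha> * lam\<close> ub(3) by linarith
      have "real n * r \<le> real n * real w" using rlam lw by (intro mult_left_mono) auto
      then have "real S * real w \<le> (2 * real n) * real w" using sp 1 unfolding r_def[symmetric] by linarith
      moreover have "0 < real w" using lw big(1) by linarith
      ultimately have "real S \<le> real (2 * n)" by simp
      then show ?thesis by (simp only: of_nat_le_iff)
    qed
    show ?thesis
    proof (cases "k < k1")
      case True
      \<comment> \<open>For bounded \<open>k\<close> a cost of order \<open>n\<close> is enough,
        since \<open>c1\<close> contains the factor \<open>1 / k1\<close>.\<close>
      have "c * real n * real k \<le> c1 * real n * real k1"
        using c0 True c1 by (intro mult_mono) auto
      also have "\<dots> = \<alpha> / (32 * (1 + \<alpha>)) * real n" unfolding c1_def using k10 by simp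
      also have "\<dots> \<le> ?e"
        by (rule expected_cost_base[OF \<alpha> n1 U4 lam_def big(2) a w2 S2 big(6)])
      finally show ?thesis .
    next
      case False
      define m where "m = k - Suc (Suc t)"
      \<comment> \<open>Two logarithms are kept in reserve, so that \<open>2 ^ depth cc J\<close>
        stays below \<open>log 2 lam\<close>, which is small enough for both \<open>D1\<close> and
        \<open>D2\<close>.\<close>
      define J where "J = (m - 2) div 2"
      define cc where "cc = 64 * 2 ^ g * (r + 10)"
      have kt: "k1 \<le> k" "m + Suc (Suc t) = k" "2 * J \<le> m - 2" "2 \<le> m" "m \<le> 2 * J + 3"
        using False unfolding m_def J_def k1_def by auto
      have base: "2 * (cc + 2) \<le> iter_log m (real n)"
      proof -
        have A0: "0 \<le> A" by (simp add: A_def)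
        have "2 * (cc + 2) \<le> 2 * ((A + 1) * (r + 10))" using r0 unfolding cc_def A_def by (simp add: algebra_simps)
        also have "\<dots> \<le> 2 * ((A + 1) * (10 * (r + 1)))" using r0 A0 by (intro mult_left_mono) auto
        also have "\<dots> = 20 * (A + 1) * (r + 1)" by (simp add: algebra_simps)
        also have "\<dots> \<le> 2 ^ t * (r + 1)" using t(1) r0 by (intro mult_right_mono) auto
        also have "\<dots> \<le> iter_log m (real n)" unfolding r_def m_def
          by (rule iter_log_exponential[OF pos]) (use kt in auto)
        finally show ?thesis .
      qed
      have cc0: "0 < cc" unfolding cc_def using r0 by simp
      have four: "4 \<le> iter_log j (real n)" if "j \<le> m" for j
        by (rule iter_log_ge_4[OF pos]) (use that kt t(2) in auto)
      have "2 * (cc + 2) * 2 ^ depth cc J \<le> iter_log (m - 2 * J) (real n)"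
        by (rule depth_iter_log[OF cc0 order_refl base four]) (use kt in auto)
      also have "\<dots> \<le> iter_log 2 (real n)"
        by (rule iter_log_le[OF pos]) (use kt in auto)
      also have "iter_log 2 (real n) = log 2 lam" by (simp add: iter_log_Suc numeral_2_eq_2 lam_def)
      finally have dep: "2 * (cc + 2) * 2 ^ depth cc J \<le> log 2 lam" .
      have "r + 10 \<le> 2 * (cc + 2)"
      proof -
        have "1 * (r + 10) \<le> cc" unfolding cc_def using r0 by (intro mult_right_mono) (auto simp: mult_ge1_I)
        then have "r + 10 \<le> cc" by simp
        moreover from this have "0 \<le> cc" using r0 by simp
        ultimately show ?thesis by simp
      qed
      then have "(r + 10) * 2 ^ depth cc J \<le> 2 * (cc + 2) * 2 ^ depth cc J" by (intro mult_right_mono) auto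
      then have D1: "(r + 10) * 2 ^ depth cc J \<le> \<alpha> / 4 * lam" using dep big(4) by linarith
      obtain e where e: "2 ^ e \<le> n" "n < 2 ^ (e + 1)"
        using ex_power_ivl1[of 2 n] n1 by auto
      have e': "n < 2 * 2 ^ e" using e(2) by simp
      have D2: "depth cc J + g \<le> e"
      proof -
        have "1 * 2 ^ depth cc J \<le> 2 * (cc + 2) * (2::real) ^ depth cc J" using cc0 by (intro mult_right_mono) auto
        then have "(2::real) ^ depth cc J \<le> log 2 lam" unfolding mult_1 using dep by (rule order.trans)
        then have "(2::real) ^ g * 2 ^ depth cc J \<le> 2 ^ g * log 2 lam" by (intro mult_left_mono) auto
        also have "\<dots> \<le> real n / 2" by (rule big(5))
        also have "\<dots> < 2 ^ e"
        proof -
          have "real n < real (2 * 2 ^ e)" using e' by (simp only: of_nat_less_iff)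
          then show ?thesis by simp
        qed
        finally have "(2::real) ^ (depth cc J + g) < 2 ^ e" by (simp add: power_add mult.commute)
        then show ?thesis by simp
      qed
      have W: "16 * real w \<le> 2 ^ g * \<alpha> * lam"
      proof -
        have "32 * (1 + \<alpha>) \<le> 2 ^ g * \<alpha>" using g(1) \<alpha> by (simp add: field_simps)
        then have "32 * (1 + \<alpha>) * lam \<le> 2 ^ g * \<alpha> * lam" using big(1) by (intro mult_right_mono) auto
        then show ?thesis using w2 by linarith
      qed
      have "J * (2 ^ e * card Om) \<le> 4 * 2 ^ g * (\<Sum>x\<in>Om. \<Sum>p<n. card (Tch x p (Suc p)))"
        by (rule many_levels[OF n1 U4 r0 sp[folded r_def] lam_def a ub(3) S2 g(2) W e(1) e' cc_def D1 D2])
      then have "real J * real n / (8 * 2 ^ g) \<le> ?e"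
        using U4 by (intro expected_cost_levels[OF _ e']) simp_all
      moreover have "c * real n * real k \<le> real J * real n / (8 * 2 ^ g)"
      proof -
        have "k \<le> 4 * J" using kt(1,2,5) unfolding k1_def by linarith
        then have "real k \<le> 4 * real J" by linarith
        then have "c * real n * real k \<le> c2 * real n * (4 * real J)" using c0 by (intro mult_mono) auto
        also have "\<dots> = real J * real n / (8 * 2 ^ g)" unfolding c2_def by simp
        finally show ?thesis .
      qed
      ultimately show ?thesis by linarith
    qed
  qed
  then show ?thesis using c0(1) unfolding Let_def by blast
qed

end
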